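(* Let $\mu\in\mathcal{P}_p(\mathbb{R}^N)$, $\delta>0$, and let $f:\mathbb{R}^N\to\mathbb{R}$ be a lower semicontinuous function such that $f(x)\ge -C(1+\|x\|^{p-\varepsilon})$ for all $x\in\mathbb{R}^N$, for some $\varepsilon>0$ and some constant $C>0$. Define $V_N^\delta(x,y):=f(y)$ and, for $t=N-1,\dots,0$, $$V_t^\delta(x_{1:t},y_{1:t}):=\sup_{\gamma^{t+1}\in\Pi_\delta(\mu_{x_{1:t}},\cdot)}\int V_{t+1}^\delta(x_{1:t+1},y_{1:t+1})\,\gamma^{t+1}(dx_{t+1},dy_{t+1}),$$ and define $$V(\delta):=\sup_{\nu\in B_\delta(\mu)}\int f(y)\,\nu(dy).$$ Then $V(\delta)=V_0^\delta$.
   Context: Fix $N\in\mathbb{N}$ and $p\in[1,\infty)$. For $x\in\mathbb{R}^k$ let $\|x\|=(\sum_{t=1}^k|x_t|^p)^{1/p}$ and $x_{s:t}=(x_s,\dots,x_t)$. $\mathcal{P}(\mathbb{R}^k)$ is the set of Borel probability measures and $\mathcal{P}_p(\mathbb{R}^k)$ those with $\int\|x\|^p\,\nu(dx)<\infty$. For $\mu\in\mathcal{P}_p(\mathbb{R}^N)$ write the disintegration $\mu=\mu^1\otimes\mu_{x_1}\otimes\dots\otimes\mu_{x_{1:N-1}}$, where $\mu^1$ is the first marginal, $\mu_{x_{1:t}}\in\mathcal{P}(\mathbb{R})$ is the (regular) conditional distribution of the $(t+1)$-st coordinate given that the first $t$ coordinates equal $x_{1:t}$, and $\mu_{x_{1:0}}:=\mu^1$.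 For $\pi\in\mathcal{P}(\mathbb{R}^2)$ set $\mathcal{C}_p(\pi)=(\int|x-y|^p\,\pi(dx,dy))^{1/p}$. For $\eta\in\mathcal{P}(\mathbb{R})$, $\Pi(\eta,\cdot)$ is the set of $\pi\in\mathcal{P}(\mathbb{R}^2)$ with first marginal $\eta$ (second marginal arbitrary) and $\Pi_\delta(\eta,\cdot):=\{\pi\in\Pi(\eta,\cdot):\mathcal{C}_p(\pi)<\delta\}$. For two measures, $\Pi(\mu,\nu)$ denotes the set of couplings. Bicausal couplings: for $\mu,\nu\in\mathcal{P}_p(\mathbb{R}^N)$, a coupling $\gamma\in\Pi(\mu,\nu)$, disintegrated as $\gamma=\gamma^1\otimes\gamma_{x_1,y_1}\otimes\dots\otimes\gamma_{x_{1:N-1},y_{1:N-1}}$ (with $\gamma^1$ the law of $(x_1,y_1)$ and $\gamma_{x_{1:t},y_{1:t}}$ the conditional law of $(x_{t+1},y_{t+1})$ given $(x_{1:t},y_{1:t})$), is bicausal if $\gamma^1\in\Pi(\mu^1,\nu^1)$ and $\gamma_{x_{1:t},y_{1:t}}\in\Pi(\mu_{x_{1:t}},\nu_{y_{1:t}})$ for $\gamma$-a.e. $(x,y)$, $t=1,\dots,N-1$. The set of these is $\Pi_{\mathrm{bc}}(\mu,\nu)$. Adapted $(p,\infty)$-Wasserstein distance: define functionals $\mathcal{F}_{t,p}$ on $\mathcal{P}_p(\mathbb{R}^{N-t}\times\mathbb{R}^{N-t})$ (values in $[0,\infty]$) by $\mathcal{F}_{N,p}:=0$ and $\mathcal{F}_{t,p}(\gamma):=\mathcal{C}_p(\gamma^1)\vee\|\mathcal{F}_{t+1,p}(\bar\gamma_{x_1,y_1})\|_{L^\infty(\gamma^1)}$,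 where $\gamma^1$ is the law of the first coordinate pair $(x_1,y_1)$ under $\gamma$ and $\bar\gamma_{x_1,y_1}$ is the conditional law of all remaining coordinate pairs given $(x_1,y_1)$. Then $\mathcal{AW}_p^\infty(\mu,\nu):=\inf_{\gamma\in\Pi_{\mathrm{bc}}(\mu,\nu)}\mathcal{F}_{0,p}(\gamma)$, and $B_\delta(\mu):=\{\nu\in\mathcal{P}_p(\mathbb{R}^N):\mathcal{AW}_p^\infty(\mu,\nu)<\delta\}$. *)

theory Defs
  imports "HOL-Probability.Probability"
begin

text \<open>
  \<open>\<real>\<^sup>k\<close> is the finite product \<open>PiM {1..k} (\<lambda>_. borel)\<close>, whose points are the functions
  \<open>nat \<Rightarrow> real\<close> that are \<open>undefined\<close> outside \<open>{1..k}\<close>.  A block of coordinates \<open>x\<^sub>s, \<dots>, x\<^sub>t\<close>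
  keeps its labels and is \<open>restrict x {s..t}\<close>, a point of \<open>PiM {s..t} (\<lambda>_. borel)\<close>; in
  particular \<open>x\<^sub>1\<^sub>:\<^sub>0\<close> is the only point \<open>\<lambda>_. undefined\<close> of the product over \<open>{1..0} = {}\<close>.
\<close>

abbreviation coords :: "nat set \<Rightarrow> (nat \<Rightarrow> real) measure" where
  "coords I \<equiv> PiM I (\<lambda>_. borel)"

definition pnorm :: "real \<Rightarrow> nat \<Rightarrow> (nat \<Rightarrow> real) \<Rightarrow> real" where
  "pnorm p k x = (\<Sum>t = 1..k. \<bar>x t\<bar> powr p) powr (1 / p)"

definition P_p :: "real \<Rightarrow> nat \<Rightarrow> (nat \<Rightarrow> real) measure set" where
  "P_p p k = {\<nu> \<in> space (prob_algebra (coords {1..k})).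
     (\<integral>\<^sup>+ x. ennreal (pnorm p k x powr p) \<partial>\<nu>) < \<infinity>}"

definition lower_semicontinuous :: "nat \<Rightarrow> ((nat \<Rightarrow> real) \<Rightarrow> real) \<Rightarrow> bool" where
  "lower_semicontinuous k f \<longleftrightarrow>
     (\<forall>a. openin (product_topology (\<lambda>_. euclideanreal) {1..k})
            {x \<in> PiE {1..k} (\<lambda>_. UNIV). a < f x})"

text \<open>
  Integrals of extended real functions, as the difference of the integrals of the positive and
  the negative part.  The value functions below are in general universally measurable and not
  Borel measurable, hence the completion.  The negative parts that matter are integrable, so the
  value \<open>\<infinity> - \<infinity> = \<infinity>\<close> of the ereal subtraction plays no role.
\<close>

definition ext_integral :: "'a measure \<Rightarrow> ('a \<Rightarrow> ereal) \<Rightarrow> ereal" where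
  "ext_integral M g =
     enn2ereal (\<integral>\<^sup>+ x. e2ennreal (g x) \<partial>completion M) -
     enn2ereal (\<integral>\<^sup>+ x. e2ennreal (- g x) \<partial>completion M)"

text \<open>
  \<open>is_cond_law P X A Y B K\<close>: the kernel \<open>K\<close> from \<open>A\<close> to \<open>B\<close> is a version of the regular
  conditional distribution under \<open>P\<close> of \<open>Y\<close> (with values in \<open>B\<close>) given \<open>X\<close> (with values
  in \<open>A\<close>).  Between the standard Borel spaces used here a version exists and is unique up to
  \<open>distr P A X\<close>-null sets; \<open>cond_law\<close> picks one, and is only used in notions that do not
  depend on the version.
\<close>

definition is_cond_law ::
  "'a measure \<Rightarrow> ('a \<Rightarrow> 'b) \<Rightarrow> 'b measure \<Rightarrow> ('a \<Rightarrow> 'c) \<Rightarrow> 'c measure \<Rightarrow> ('b \<Rightarrow> 'c measure) \<Rightarrow> bool"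
where
  "is_cond_law P X A Y B K \<longleftrightarrow>
     K \<in> A \<rightarrow>\<^sub>M prob_algebra B \<and>
     (\<forall>S\<in>sets A. \<forall>T\<in>sets B.
        emeasure P {\<omega> \<in> space P. X \<omega> \<in> S \<and> Y \<omega> \<in> T} =
        (\<integral>\<^sup>+ x\<in>S. emeasure (K x) T \<partial>distr P A X))"

definition cond_law ::
  "'a measure \<Rightarrow> ('a \<Rightarrow> 'b) \<Rightarrow> 'b measure \<Rightarrow> ('a \<Rightarrow> 'c) \<Rightarrow> 'c measure \<Rightarrow> 'b \<Rightarrow> 'c measure"
where
  "cond_law P X A Y B = (SOME K. is_cond_law P X A Y B K)"

text \<open>
  \<open>\<kappa> t x\<close> is \<open>\<mu>\<close> conditioned on \<open>x = x\<^sub>1\<^sub>:\<^sub>t\<close>, a law for the coordinate \<open>t + 1\<close>.  For \<open>t = 0\<close>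
  the conditioning is on a constant, and \<open>\<kappa> 0\<close> at that constant is the first marginal.
\<close>

definition disintegration ::
  "nat \<Rightarrow> (nat \<Rightarrow> real) measure \<Rightarrow> (nat \<Rightarrow> (nat \<Rightarrow> real) \<Rightarrow> real measure) \<Rightarrow> bool"
where
  "disintegration N \<mu> \<kappa> \<longleftrightarrow>
     (\<forall>t<N. is_cond_law \<mu> (\<lambda>x. restrict x {1..t}) (coords {1..t}) (\<lambda>x. x (Suc t)) borel (\<kappa> t))"

definition step_law :: "(nat \<Rightarrow> real) measure \<Rightarrow> nat \<Rightarrow> (nat \<Rightarrow> real) \<Rightarrow> real measure" where
  "step_law \<mu> t = cond_law \<mu> (\<lambda>x. restrict x {1..t}) (coords {1..t}) (\<lambda>x. x (Suc t)) borel"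

type_synonym path_pair = "(nat \<Rightarrow> real) \<times> (nat \<Rightarrow> real)"

definition pair_step_law :: "path_pair measure \<Rightarrow> nat \<Rightarrow> path_pair \<Rightarrow> (real \<times> real) measure" where
  "pair_step_law \<gamma> t =
     cond_law \<gamma> (\<lambda>(x, y). (restrict x {1..t}, restrict y {1..t}))
       (coords {1..t} \<Otimes>\<^sub>M coords {1..t})
       (\<lambda>(x, y). (x (Suc t), y (Suc t))) (borel \<Otimes>\<^sub>M borel)"

definition couplings :: "'a measure \<Rightarrow> 'b measure \<Rightarrow> ('a \<times> 'b) measure set" where
  "couplings \<mu> \<nu> = {\<pi> \<in> space (prob_algebra (\<mu> \<Otimes>\<^sub>M \<nu>)). distr \<pi> \<mu> fst = \<mu> \<and> distr \<pi> \<nu> snd = \<nu>}"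

text \<open>The case \<open>t = 0\<close> is the condition that the law of \<open>(x\<^sub>1, y\<^sub>1)\<close> couples the first marginals.\<close>

definition bicausal ::
  "nat \<Rightarrow> (nat \<Rightarrow> real) measure \<Rightarrow> (nat \<Rightarrow> real) measure \<Rightarrow> path_pair measure set"
where
  "bicausal N \<mu> \<nu> = {\<gamma> \<in> couplings \<mu> \<nu>. \<forall>t<N. AE (x, y) in \<gamma>.
     pair_step_law \<gamma> t (restrict x {1..t}, restrict y {1..t}) \<in>
       couplings (step_law \<mu> t (restrict x {1..t})) (step_law \<nu> t (restrict y {1..t}))}"

definition cost :: "real \<Rightarrow> (real \<times> real) measure \<Rightarrow> ennreal" where
  "cost p \<pi> = (let c = \<integral>\<^sup>+ (x, y). ennreal (\<bar>x - y\<bar> powr p) \<partial>\<pi>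
     in if c = \<infinity> then \<infinity> else ennreal (enn2real c powr (1 / p)))"

definition couplings_within ::
  "real \<Rightarrow> real \<Rightarrow> real measure \<Rightarrow> (real \<times> real) measure set"
where
  "couplings_within p \<delta> \<eta> =
     {\<pi> \<in> space (prob_algebra (borel \<Otimes>\<^sub>M borel)). distr \<pi> borel fst = \<eta> \<and> cost p \<pi> < ennreal \<delta>}"

text \<open>
  For measurable \<open>g\<close> this is \<open>esssup M g\<close>; unlike the latter it does not jump to \<open>\<infinity>\<close> for
  functions whose measurability has not been established.
\<close>

definition Linf_norm :: "'a measure \<Rightarrow> ('a \<Rightarrow> ennreal) \<Rightarrow> ennreal" where
  "Linf_norm M g = Inf {c. AE z in M. g z \<le> c}"

text \<open>
  The functional at level \<open>t\<close>.  Its last argument is a measure on the pairs of blocks with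
  coordinates \<open>t + 1, \<dots>, N\<close>, that is, on \<open>\<real>\<^sup>N\<^sup>-\<^sup>t \<times> \<real>\<^sup>N\<^sup>-\<^sup>t\<close>; the first coordinate pair has label
  \<open>t + 1\<close> and the remaining ones have labels \<open>t + 2, \<dots>, N\<close>.
\<close>

definition first_law :: "nat \<Rightarrow> path_pair measure \<Rightarrow> (real \<times> real) measure" where
  "first_law t \<gamma> = distr \<gamma> (borel \<Otimes>\<^sub>M borel) (\<lambda>(x, y). (x (Suc t), y (Suc t)))"

definition rest_law ::
  "nat \<Rightarrow> nat \<Rightarrow> path_pair measure \<Rightarrow> real \<times> real \<Rightarrow> path_pair measure"
where
  "rest_law N t \<gamma> =
     cond_law \<gamma> (\<lambda>(x, y). (x (Suc t), y (Suc t))) (borel \<Otimes>\<^sub>M borel)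
       (\<lambda>(x, y). (restrict x {t + 2..N}, restrict y {t + 2..N}))
       (coords {t + 2..N} \<Otimes>\<^sub>M coords {t + 2..N})"

function F_functional :: "real \<Rightarrow> nat \<Rightarrow> nat \<Rightarrow> path_pair measure \<Rightarrow> ennreal" where
  "F_functional p N t \<gamma> =
     (if N \<le> t then 0
      else max (cost p (first_law t \<gamma>))
             (Linf_norm (first_law t \<gamma>) (\<lambda>z. F_functional p N (Suc t) (rest_law N t \<gamma> z))))"
  by auto
termination by (relation "Wellfounded.measure (\<lambda>(p, N, t, \<gamma>). N - t)") auto
declare F_functional.simps [simp del]

definition AW_inf :: "real \<Rightarrow> nat \<Rightarrow> (nat \<Rightarrow> real) measure \<Rightarrow> (nat \<Rightarrow> real) measure \<Rightarrow> ennreal" where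
  "AW_inf p N \<mu> \<nu> = (INF \<gamma> \<in> bicausal N \<mu> \<nu>. F_functional p N 0 \<gamma>)"

definition AW_ball :: "real \<Rightarrow> nat \<Rightarrow> real \<Rightarrow> (nat \<Rightarrow> real) measure \<Rightarrow> (nat \<Rightarrow> real) measure set" where
  "AW_ball p N \<delta> \<mu> = {\<nu> \<in> P_p p N. AW_inf p N \<mu> \<nu> < ennreal \<delta>}"

definition robust_value ::
  "real \<Rightarrow> nat \<Rightarrow> (nat \<Rightarrow> real) measure \<Rightarrow> ((nat \<Rightarrow> real) \<Rightarrow> real) \<Rightarrow> real \<Rightarrow> ereal"
where
  "robust_value p N \<mu> f \<delta> = (SUP \<nu> \<in> AW_ball p N \<delta> \<mu>. ext_integral \<nu> (\<lambda>y. ereal (f y)))"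

text \<open>
  \<open>dp_value p N \<kappa> f \<delta> t x y\<close> is the value function at time \<open>t\<close> for \<open>x = x\<^sub>1\<^sub>:\<^sub>t\<close>, \<open>y = y\<^sub>1\<^sub>:\<^sub>t\<close>,
  where \<open>\<kappa>\<close> is a disintegration of \<open>\<mu>\<close>.
\<close>

function dp_value ::
  "real \<Rightarrow> nat \<Rightarrow> (nat \<Rightarrow> (nat \<Rightarrow> real) \<Rightarrow> real measure) \<Rightarrow> ((nat \<Rightarrow> real) \<Rightarrow> real) \<Rightarrow> real \<Rightarrow>
   nat \<Rightarrow> (nat \<Rightarrow> real) \<Rightarrow> (nat \<Rightarrow> real) \<Rightarrow> ereal"
where
  "dp_value p N \<kappa> f \<delta> t x y =
     (if N \<le> t then ereal (f y)
      else SUP \<gamma> \<in> couplings_within p \<delta> (\<kappa> t x).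
        ext_integral \<gamma> (\<lambda>(a, b). dp_value p N \<kappa> f \<delta> (Suc t) (x(Suc t := a)) (y(Suc t := b))))"
  by auto
termination by (relation "Wellfounded.measure (\<lambda>(p, N, \<kappa>, f, \<delta>, t, x, y). N - t)") auto
declare dp_value.simps [simp del]

end

theory Submission
  imports Defs
begin

text \<open>
  The value functions are Borel and no measurable selection theorem is needed. A measure on \<open>\<real>\<^sup>2\<close> with
  first marginal \<open>\<eta>\<close> is the law of \<open>(a, g (a, u))\<close> for \<open>a\<close> of law \<open>\<eta>\<close> and an independent uniform \<open>u\<close>, and
  by lower semicontinuity the supremum over \<open>g\<close> may be restricted to a fixed countable family of
  transports \<open>G i\<close> that does not depend on \<open>\<eta>\<close>. Restricting it further to \<open>i \<le> k\<close> and to costs at most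
  \<open>r k < \<delta>\<close> gives Borel functions that attain their supremum and increase to the value function.

  For \<open>V(\<delta>) \<le> V\<^sub>0\<close>, the functional \<open>\<F>\<^sub>0\<close> bounds the costs of all conditional laws of a bicausal
  coupling by some \<open>r < \<delta>\<close>, and the dynamic programming inequality is integrated along the path. For the
  converse, the maximisers at level \<open>k\<close> are kernels whose composition couples \<open>\<mu>\<close> with some \<open>\<nu>\<close>. Such a
  coupling is not bicausal in general, because its kernels depend on both paths. The transports \<open>G i\<close> are
  therefore chosen such that \<open>a\<close> can be recovered from \<open>G i (a, u)\<close>: rounding leaves room to encode \<open>a\<close>.
  Then the past of \<open>y\<close> determines the past of \<open>x\<close>.
\<close>

section \<open>Extended integrals of functions bounded below\<close>

text \<open>Every change of transport keeps the first coordinate and moves only the second, so lower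
  semicontinuity in y suffices and the kernels may depend on x in a merely measurable way. The value
  functions have no upper bound and only an integrable lower one; each passage to the limit
  therefore rests on a minorant that is integrable under the couplings in question. It is built from
  p-th moments of the future of x, which are finite because \<mu> has finite p-th moment, and a cost
  below \<delta> carries them over to y. These moments are finite for almost every past only,
  whereas the recursion evaluates the kernels at every past; the given disintegration is changed on
  a null set, and this leaves the value at time 0 as it is. The bounds \<open>r k\<close> strictly
  below \<delta> answer to the open ball: costs below \<delta> at each single past do not keep their
  essential supremum below \<delta>.\<close>

lemma ext_integral_eq:
  "ext_integral M g =
     enn2ereal (\<integral>\<^sup>+ x. e2ennreal (g x) \<partial>M) - enn2ereal (\<integral>\<^sup>+ x. e2ennreal (- g x) \<partial>M)"
  \<comment> \<open>The completion disappears for every integrand, measurable or not: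
    \<open>nn_integral\<close> is a supremum over simple functions, and changing those on null sets
    has no effect.\<close>
  unfolding ext_integral_def nn_integral_completion ..

lemma ext_integral_cong_AE:
  assumes "AE x in M. g x = h x"
  shows "ext_integral M g = ext_integral M h"
proof -
  have "(\<integral>\<^sup>+ x. e2ennreal (g x) \<partial>M) = (\<integral>\<^sup>+ x. e2ennreal (h x) \<partial>M)"
    "(\<integral>\<^sup>+ x. e2ennreal (- g x) \<partial>M) = (\<integral>\<^sup>+ x. e2ennreal (- h x) \<partial>M)"
    using assms by (auto intro!: nn_integral_cong_AE)
  then show ?thesis by (simp add: ext_integral_eq)
qed

lemma ext_integral_mono_AE:
  assumes "AE x in M. g x \<le> h x"
  shows "ext_integral M g \<le> ext_integral M h"
  unfolding ext_integral_eq using assms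
  by (intro ereal_minus_mono)
    (auto simp flip: less_eq_ennreal.rep_eq intro!: nn_integral_mono_AE e2ennreal_mono elim!: eventually_mono)

lemma ext_integral_distr:
  assumes "T \<in> M \<rightarrow>\<^sub>M N" "g \<in> borel_measurable N"
  shows "ext_integral (distr M N T) g = ext_integral M (\<lambda>x. g (T x))"
  unfolding ext_integral_eq using assms by (simp add: nn_integral_distr)

text \<open>The pointwise identity (P - Q)^+ + Q = P + (P - Q)^- survives integration. Since (P -
  Q)^- is dominated by Q, both of these have finite integral and can be moved to the other side,
  even when P has infinite integral.\<close>

lemma ext_integral_diff:
  assumes [measurable]: "P \<in> borel_measurable M" "Q \<in> borel_measurable M"
    and fin: "(\<integral>\<^sup>+ x. Q x \<partial>M) < \<infinity>"
  shows "ext_integral M (\<lambda>x. enn2ereal (P x) - enn2ereal (Q x)) =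
    enn2ereal (\<integral>\<^sup>+ x. P x \<partial>M) - enn2ereal (\<integral>\<^sup>+ x. Q x \<partial>M)"
proof -
  let ?d = "\<lambda>x. enn2ereal (P x) - enn2ereal (Q x)"
  have ae: "AE x in M. Q x \<noteq> \<infinity>"
    using fin by (intro nn_integral_PInf_AE) auto
  have pw: "e2ennreal (enn2ereal a - enn2ereal b) + b = a + e2ennreal (- (enn2ereal a - enn2ereal b))"
    "e2ennreal (- (enn2ereal a - enn2ereal b)) \<le> b" if b: "b \<noteq> \<infinity>" for a b :: ennreal
  proof -
    obtain b' where b': "b = ennreal b'" "b' \<ge> 0"
      using b by (cases b) auto
    have *: "e2ennreal (enn2ereal a - enn2ereal b) + b = a + e2ennreal (- (enn2ereal a - enn2ereal b)) \<and>
      e2ennreal (- (enn2ereal a - enn2ereal b)) \<le> b"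
    proof (cases a)
      case (real a')
      have [simp]: "e2ennreal (ereal r) = ennreal r" for r
        by (simp add: ennreal.abs_eq ennreal_def e2ennreal_def) 
      show ?thesis using b' real
        by (cases "a' \<le> b'") (auto simp: enn2ereal_ennreal ennreal_neg simp flip: ennreal_plus)
    qed (use b' in \<open>auto simp: enn2ereal_ennreal e2ennreal_neg\<close>)
    then show "e2ennreal (enn2ereal a - enn2ereal b) + b = a + e2ennreal (- (enn2ereal a - enn2ereal b))"
      "e2ennreal (- (enn2ereal a - enn2ereal b)) \<le> b" by auto
  qed
  have "(\<integral>\<^sup>+ x. e2ennreal (?d x) \<partial>M) + (\<integral>\<^sup>+ x. Q x \<partial>M) = (\<integral>\<^sup>+ x. e2ennreal (?d x) + Q x \<partial>M)"
    by (subst nn_integral_add) auto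
  also have "\<dots> = (\<integral>\<^sup>+ x. P x + e2ennreal (- ?d x) \<partial>M)"
    using ae pw(1) by (intro nn_integral_cong_AE) auto
  also have "\<dots> = (\<integral>\<^sup>+ x. P x \<partial>M) + (\<integral>\<^sup>+ x. e2ennreal (- ?d x) \<partial>M)"
    by (subst nn_integral_add) auto
  finally have eq: "(\<integral>\<^sup>+ x. e2ennreal (?d x) \<partial>M) + (\<integral>\<^sup>+ x. Q x \<partial>M) =
    (\<integral>\<^sup>+ x. P x \<partial>M) + (\<integral>\<^sup>+ x. e2ennreal (- ?d x) \<partial>M)" .
  have "(\<integral>\<^sup>+ x. e2ennreal (- ?d x) \<partial>M) \<le> (\<integral>\<^sup>+ x. Q x \<partial>M)"
    using ae pw(2) by (intro nn_integral_mono_AE) auto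
  with fin have fin2: "(\<integral>\<^sup>+ x. e2ennreal (- ?d x) \<partial>M) < \<infinity>" by (rule le_less_trans[rotated])
  have arith: "enn2ereal a - enn2ereal n = enn2ereal p - enn2ereal q"
    if e: "a + q = p + n" and q': "q < \<infinity>" and n': "n < \<infinity>" for a q p n :: ennreal
  proof -
    obtain q' where q: "q = ennreal q'" "q' \<ge> 0" using q' by (cases q) auto
    obtain n' where n: "n = ennreal n'" "n' \<ge> 0" using n' by (cases n) auto
    show ?thesis
      using e q n by (cases a; cases p) (auto simp: enn2ereal_ennreal simp flip: ennreal_plus)
  qed
  show ?thesis
    unfolding ext_integral_eq by (rule arith[OF eq fin fin2])
qed

lemma e2ennreal_shift:
  assumes "- enn2ereal l \<le> a" "l \<noteq> \<infinity>"
  shows "a = enn2ereal (e2ennreal (a + enn2ereal l)) - enn2ereal l"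
proof -
  obtain l' where l': "l = ennreal l'" "l' \<ge> 0"
    using assms(2) by (cases l) auto
  have "0 \<le> a + enn2ereal l"
    using assms(1) l' by (cases a) (auto simp: enn2ereal_ennreal)
  then show ?thesis
    using l' by (cases a) (auto simp: enn2ereal_e2ennreal enn2ereal_ennreal)
qed

text \<open>Adding an integrable minorant makes the integrand nonnegative; this is how limit
  theorems for \<open>nn_integral\<close> reach extended integrals.\<close>

lemma ext_integral_shift:
  assumes [measurable]: "g \<in> borel_measurable M" "L \<in> borel_measurable M"
    and fin: "(\<integral>\<^sup>+ x. L x \<partial>M) < \<infinity>"
    and lb: "AE x in M. - enn2ereal (L x) \<le> g x"
  shows "ext_integral M g =
    enn2ereal (\<integral>\<^sup>+ x. e2ennreal (g x + enn2ereal (L x)) \<partial>M) - enn2ereal (\<integral>\<^sup>+ x. L x \<partial>M)"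
proof -
  have ae: "AE x in M. L x \<noteq> \<infinity>"
    using fin by (intro nn_integral_PInf_AE) auto
  have "ext_integral M g =
    ext_integral M (\<lambda>x. enn2ereal (e2ennreal (g x + enn2ereal (L x))) - enn2ereal (L x))"
    using ae lb by (intro ext_integral_cong_AE, eventually_elim) (rule e2ennreal_shift)
  also have "\<dots> = enn2ereal (\<integral>\<^sup>+ x. e2ennreal (g x + enn2ereal (L x)) \<partial>M) - enn2ereal (\<integral>\<^sup>+ x. L x \<partial>M)"
    by (intro ext_integral_diff fin) auto
  finally show ?thesis .
qed

lemma ext_integral_lower_bound:
  assumes [measurable]: "L \<in> borel_measurable M"
    and fin: "(\<integral>\<^sup>+ x. L x \<partial>M) < \<infinity>"
    and lb: "AE x in M. - enn2ereal (L x) \<le> g x"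
  shows "- enn2ereal (\<integral>\<^sup>+ x. L x \<partial>M) \<le> ext_integral M g"
proof -
  have "- enn2ereal (\<integral>\<^sup>+ x. L x \<partial>M) = ext_integral M (\<lambda>x. enn2ereal 0 - enn2ereal (L x))"
    by (subst ext_integral_diff) (use fin in \<open>auto simp: zero_ennreal.rep_eq\<close>)
  also have "\<dots> \<le> ext_integral M g"
    using lb by (intro ext_integral_mono_AE) (auto simp: zero_ennreal.rep_eq)
  finally show ?thesis .
qed

text \<open>Fatou's lemma for the shifted functions. It is stated with a threshold \<alpha> because
  it serves to find indices at which a strict gain survives an approximation.\<close>

lemma ext_integral_Fatou:
  fixes w :: "'a \<Rightarrow> ereal" and wn :: "nat \<Rightarrow> 'a \<Rightarrow> ereal"
  assumes [measurable]: "w \<in> borel_measurable M" "\<And>n. wn n \<in> borel_measurable M"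
      "L \<in> borel_measurable M"
    and fin: "(\<integral>\<^sup>+ x. L x \<partial>M) < \<infinity>"
    and lb: "AE x in M. \<forall>n. - enn2ereal (L x) \<le> wn n x"
    and lbw: "AE x in M. - enn2ereal (L x) \<le> w x"
    and lim: "AE x in M. w x \<le> liminf (\<lambda>n. wn n x)"
    and \<alpha>: "\<alpha> < ext_integral M w"
  shows "eventually (\<lambda>n. \<alpha> < ext_integral M (wn n)) sequentially"
proof -
  have ae: "AE x in M. L x \<noteq> \<infinity>"
    using fin by (intro nn_integral_PInf_AE) auto
  obtain c where c: "(\<integral>\<^sup>+ x. L x \<partial>M) = ennreal c" "c \<ge> 0"
    using fin by (cases "\<integral>\<^sup>+ x. L x \<partial>M") auto
  have "AE x in M. e2ennreal (w x + enn2ereal (L x)) \<le> liminf (\<lambda>n. e2ennreal (wn n x + enn2ereal (L x)))"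
    using ae lim
  proof (eventually_elim, unfold le_Liminf_iff, intro allI impI)
    fix x y
    assume "L x \<noteq> \<infinity>" and l: "\<forall>y<w x. \<forall>\<^sub>F n in sequentially. y < wn n x"
      and y: "y < e2ennreal (w x + enn2ereal (L x))"
    then obtain l where l': "L x = ennreal l" "l \<ge> 0" by (cases "L x") auto
    have "enn2ereal y < w x + enn2ereal (L x)"
      using y by (metis e2ennreal_enn2ereal e2ennreal_mono not_le)
    then have "enn2ereal y - ereal l < w x"
      using l' by (cases "w x"; cases "enn2ereal y") (auto simp: enn2ereal_ennreal)
    then have "\<forall>\<^sub>F n in sequentially. enn2ereal y - ereal l < wn n x" using l by auto
    then show "\<forall>\<^sub>F n in sequentially. y < e2ennreal (wn n x + enn2ereal (L x))"
    proof eventually_elim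
      case (elim n)
      then have "enn2ereal y < wn n x + enn2ereal (L x)"
        using l' by (cases "wn n x"; cases "enn2ereal y") (auto simp: enn2ereal_ennreal)
      then show ?case
        by (metis enn2ereal_e2ennreal enn2ereal_nonneg less_ennreal.rep_eq less_imp_le order_trans)
    qed
  qed
  then have "(\<integral>\<^sup>+ x. e2ennreal (w x + enn2ereal (L x)) \<partial>M) \<le>
      (\<integral>\<^sup>+ x. liminf (\<lambda>n. e2ennreal (wn n x + enn2ereal (L x))) \<partial>M)"
    by (rule nn_integral_mono_AE)
  also have "\<dots> \<le> liminf (\<lambda>n. \<integral>\<^sup>+ x. e2ennreal (wn n x + enn2ereal (L x)) \<partial>M)"
    by (intro nn_integral_liminf) auto
  finally have le: "(\<integral>\<^sup>+ x. e2ennreal (w x + enn2ereal (L x)) \<partial>M) \<le> \<dots>" .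
  have W: "ext_integral M w = enn2ereal (\<integral>\<^sup>+ x. e2ennreal (w x + enn2ereal (L x)) \<partial>M) - ereal c"
    using c by (subst ext_integral_shift[OF _ _ fin lbw]) (auto simp: enn2ereal_ennreal)
  have Wn: "ext_integral M (wn n) = enn2ereal (\<integral>\<^sup>+ x. e2ennreal (wn n x + enn2ereal (L x)) \<partial>M) - ereal c" for n
    using c lb by (subst ext_integral_shift[OF _ _ fin]) (auto simp: enn2ereal_ennreal)
  \<comment> \<open>\<open>e2ennreal\<close> truncates negative numbers to 0, so a negative shifted
    threshold is treated separately; there nonnegativity of the shifted integrals is enough.\<close>
  show ?thesis
  proof (cases "\<alpha> + ereal c < 0")
    case True
    then have "\<alpha> < ext_integral M (wn n)" for n
      unfolding Wn using enn2ereal_nonneg[of "\<integral>\<^sup>+ x. e2ennreal (wn n x + enn2ereal (L x)) \<partial>M"]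
      by (cases \<alpha>; cases "enn2ereal (\<integral>\<^sup>+ x. e2ennreal (wn n x + enn2ereal (L x)) \<partial>M)") auto
    then show ?thesis by simp
  next
    case False
    have "\<alpha> + ereal c < enn2ereal (\<integral>\<^sup>+ x. e2ennreal (w x + enn2ereal (L x)) \<partial>M)"
      using \<alpha> unfolding W
      by (cases \<alpha>; cases "enn2ereal (\<integral>\<^sup>+ x. e2ennreal (w x + enn2ereal (L x)) \<partial>M)") auto
    then have "e2ennreal (\<alpha> + ereal c) < (\<integral>\<^sup>+ x. e2ennreal (w x + enn2ereal (L x)) \<partial>M)"
      using False by (simp add: less_ennreal.rep_eq enn2ereal_e2ennreal)
    also note le
    finally have "\<forall>\<^sub>F n in sequentially. e2ennreal (\<alpha> + ereal c) < (\<integral>\<^sup>+ x. e2ennreal (wn n x + enn2ereal (L x)) \<partial>M)"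
      by (rule less_LiminfD)
    then show ?thesis
    proof eventually_elim
      case (elim n)
      then have "\<alpha> + ereal c < enn2ereal (\<integral>\<^sup>+ x. e2ennreal (wn n x + enn2ereal (L x)) \<partial>M)"
        using False by (simp add: less_ennreal.rep_eq enn2ereal_e2ennreal)
      then show ?case unfolding Wn
        by (cases \<alpha>; cases "enn2ereal (\<integral>\<^sup>+ x. e2ennreal (wn n x + enn2ereal (L x)) \<partial>M)") auto
    qed
  qed
qed

text \<open>Along an increasing sequence the supremum is the limit inferior, so the claim is an
  instance of Fatou's lemma with the right-hand side as threshold.\<close>

lemma ext_integral_SUP_le:
  fixes wn :: "nat \<Rightarrow> 'a \<Rightarrow> ereal"
  assumes [measurable]: "\<And>n. wn n \<in> borel_measurable M" "L \<in> borel_measurable M"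
    and fin: "(\<integral>\<^sup>+ x. L x \<partial>M) < \<infinity>"
    and lb: "AE x in M. \<forall>n. - enn2ereal (L x) \<le> wn n x"
    and mono: "AE x in M. incseq (\<lambda>n. wn n x)"
  shows "ext_integral M (\<lambda>x. SUP n. wn n x) \<le> (SUP n. ext_integral M (wn n))"
proof (rule ccontr)
  assume "\<not> ?thesis"
  then have "(SUP n. ext_integral M (wn n)) < ext_integral M (\<lambda>x. SUP n. wn n x)" by simp
  moreover have "AE x in M. - enn2ereal (L x) \<le> (SUP n. wn n x)"
    using lb by eventually_elim (auto intro: SUP_upper2)
  moreover have "AE x in M. (SUP n. wn n x) \<le> liminf (\<lambda>n. wn n x)"
    using mono by eventually_elim (simp add: lim_imp_Liminf[OF sequentially_bot LIMSEQ_SUP])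
  ultimately have "eventually (\<lambda>n. (SUP n. ext_integral M (wn n)) < ext_integral M (wn n)) sequentially"
    by (intro ext_integral_Fatou[OF _ _ _ fin lb]) auto
  then obtain n where "(SUP n. ext_integral M (wn n)) < ext_integral M (wn n)"
    by (auto simp: eventually_sequentially)
  then show False
    using SUP_upper[of n UNIV "\<lambda>n. ext_integral M (wn n)"] by auto
qed

text \<open>The disintegration hypothesis speaks of nonnegative integrands. It is applied to the
  positive and the negative part separately, and integrability of the minorant lets
  \<open>ext_integral_diff\<close> recombine the two.\<close>

lemma ext_integral_tower:
  assumes [measurable]: "Z \<in> M \<rightarrow>\<^sub>M B" "K \<in> M \<rightarrow>\<^sub>M prob_algebra B" "g \<in> borel_measurable B"
      "L \<in> borel_measurable B"
    and disint: "\<And>h. h \<in> borel_measurable B \<Longrightarrow>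
      (\<integral>\<^sup>+ \<omega>. h (Z \<omega>) \<partial>M) = (\<integral>\<^sup>+ \<omega>. (\<integral>\<^sup>+ z. h z \<partial>K \<omega>) \<partial>M)"
    and fin: "(\<integral>\<^sup>+ \<omega>. L (Z \<omega>) \<partial>M) < \<infinity>"
    and lb: "\<And>z. z \<in> space B \<Longrightarrow> - enn2ereal (L z) \<le> g z"
  shows "ext_integral M (\<lambda>\<omega>. g (Z \<omega>)) = ext_integral M (\<lambda>\<omega>. ext_integral (K \<omega>) g)"
proof -
  have [measurable]: "K \<in> M \<rightarrow>\<^sub>M subprob_algebra B"
    by (rule measurable_prob_algebraD) fact
  have neg: "e2ennreal (- g z) \<le> L z" if "z \<in> space B" for z
  proof -
    have "- g z \<le> enn2ereal (L z)" using lb[OF that] by (simp add: ereal_uminus_le_reorder)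
    then show ?thesis by (metis e2ennreal_enn2ereal e2ennreal_mono)
  qed
  have fin2: "(\<integral>\<^sup>+ \<omega>. (\<integral>\<^sup>+ z. e2ennreal (- g z) \<partial>K \<omega>) \<partial>M) < \<infinity>"
  proof -
    have "(\<integral>\<^sup>+ \<omega>. (\<integral>\<^sup>+ z. e2ennreal (- g z) \<partial>K \<omega>) \<partial>M) = (\<integral>\<^sup>+ \<omega>. e2ennreal (- g (Z \<omega>)) \<partial>M)"
      by (rule disint[symmetric]) auto
    also have "\<dots> \<le> (\<integral>\<^sup>+ \<omega>. L (Z \<omega>) \<partial>M)"
      by (intro nn_integral_mono neg) (rule measurable_space[OF assms(1)])
    finally show ?thesis using fin by simp
  qed
  have "ext_integral M (\<lambda>\<omega>. ext_integral (K \<omega>) g) =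
     enn2ereal (\<integral>\<^sup>+ \<omega>. (\<integral>\<^sup>+ z. e2ennreal (g z) \<partial>K \<omega>) \<partial>M) - enn2ereal (\<integral>\<^sup>+ \<omega>. (\<integral>\<^sup>+ z. e2ennreal (- g z) \<partial>K \<omega>) \<partial>M)"
    unfolding ext_integral_eq[of "K _"]
    by (intro ext_integral_diff fin2) (auto intro!: nn_integral_measurable_subprob_algebra2[where N=B])
  also have "\<dots> = ext_integral M (\<lambda>\<omega>. g (Z \<omega>))"
    unfolding ext_integral_eq[of M] by (simp flip: disint)
  finally show ?thesis by simp
qed

lemma measurable_ext_integral_kernel:
  assumes "K \<in> M \<rightarrow>\<^sub>M prob_algebra B"
    and [measurable]: "case_prod g \<in> borel_measurable (M \<Otimes>\<^sub>M B)"
  shows "(\<lambda>x. ext_integral (K x) (g x)) \<in> borel_measurable M"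
proof -
  have [measurable]: "K \<in> M \<rightarrow>\<^sub>M subprob_algebra B"
    using assms(1) by (rule measurable_prob_algebraD)
  have "(\<lambda>x. \<integral>\<^sup>+ z. e2ennreal (g x z) \<partial>K x) \<in> borel_measurable M"
    "(\<lambda>x. \<integral>\<^sup>+ z. e2ennreal (- g x z) \<partial>K x) \<in> borel_measurable M"
    by (auto intro!: nn_integral_measurable_subprob_algebra2[where N=B])
  then show ?thesis unfolding ext_integral_eq by measurable
qed

section \<open>Conditional laws\<close>

text \<open>The set \<open>?S\<close> on which the inequality fails is itself a test set. There f -
  g is positive, yet the hypothesis makes its integral zero; finiteness of the integral of f
  justifies the subtraction.\<close>

lemma AE_le_if_set_nn_integral_le:
  fixes f g :: "'a \<Rightarrow> ennreal"
  assumes [measurable]: "f \<in> borel_measurable M" "g \<in> borel_measurable M"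
    and fin: "(\<integral>\<^sup>+ x. f x \<partial>M) < \<infinity>"
    and le: "\<And>S. S \<in> sets M \<Longrightarrow> (\<integral>\<^sup>+ x\<in>S. f x \<partial>M) \<le> (\<integral>\<^sup>+ x\<in>S. g x \<partial>M)"
  shows "AE x in M. f x \<le> g x"
proof -
  let ?S = "{x \<in> space M. g x < f x}"
  have S: "?S \<in> sets M" by measurable
  have gf: "(\<integral>\<^sup>+ x\<in>?S. g x \<partial>M) \<le> (\<integral>\<^sup>+ x. f x \<partial>M)"
    by (intro nn_integral_mono) (auto simp: indicator_def)
  have "(\<integral>\<^sup>+ x\<in>?S. f x \<partial>M) \<le> (\<integral>\<^sup>+ x. f x \<partial>M)"
    by (intro nn_integral_mono) (auto simp: indicator_def)
  then have ff: "(\<integral>\<^sup>+ x\<in>?S. f x \<partial>M) < \<infinity>"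
    using fin by (rule le_less_trans)
  have "(\<integral>\<^sup>+ x. f x * indicator ?S x - g x * indicator ?S x \<partial>M) =
    (\<integral>\<^sup>+ x\<in>?S. f x \<partial>M) - (\<integral>\<^sup>+ x\<in>?S. g x \<partial>M)"
    using gf fin by (intro nn_integral_diff) (auto simp: indicator_def)
  also have "\<dots> = 0"
    using le[OF S] ff by (simp add: diff_eq_0_iff_ennreal)
  finally have "AE x in M. f x * indicator ?S x - g x * indicator ?S x = 0"
    by (subst (asm) nn_integral_0_iff_AE) auto
  moreover have "AE x in M. f x \<noteq> \<infinity>"
    using fin by (intro nn_integral_PInf_AE) auto
  ultimately show ?thesis
    using AE_space
  proof eventually_elim
    case (elim x)
    then show ?case
      by (cases "g x < f x") (auto simp: diff_eq_0_iff_ennreal not_less)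
  qed
qed

lemma AE_eq_if_set_nn_integral_eq:
  fixes f g :: "'a \<Rightarrow> ennreal"
  assumes "f \<in> borel_measurable M" "g \<in> borel_measurable M"
    and "(\<integral>\<^sup>+ x. f x \<partial>M) < \<infinity>" "(\<integral>\<^sup>+ x. g x \<partial>M) < \<infinity>"
    and "\<And>S. S \<in> sets M \<Longrightarrow> (\<integral>\<^sup>+ x\<in>S. f x \<partial>M) = (\<integral>\<^sup>+ x\<in>S. g x \<partial>M)"
  shows "AE x in M. f x = g x"
  using AE_le_if_set_nn_integral_le[of f M g] AE_le_if_set_nn_integral_le[of g M f] assms
  by (auto elim!: eventually_elim2 intro: antisym)

lemma is_cond_lawD:
  assumes "is_cond_law P X A Y B K"
  shows "K \<in> A \<rightarrow>\<^sub>M prob_algebra B" "K \<in> A \<rightarrow>\<^sub>M subprob_algebra B"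
    "S \<in> sets A \<Longrightarrow> T \<in> sets B \<Longrightarrow> emeasure P {\<omega> \<in> space P. X \<omega> \<in> S \<and> Y \<omega> \<in> T} =
        (\<integral>\<^sup>+ x\<in>S. emeasure (K x) T \<partial>distr P A X)"
  using assms by (auto simp: is_cond_law_def intro: measurable_prob_algebraD)

lemma prob_space_kernel:
  assumes "K \<in> A \<rightarrow>\<^sub>M prob_algebra B" "x \<in> space A"
  shows "prob_space (K x)" "sets (K x) = sets B" "space (K x) = space B"
  using measurable_space[OF assms] by (auto simp: space_prob_algebra dest: sets_eq_imp_space_eq)

lemma is_cond_lawI:
  assumes [measurable]: "X \<in> P \<rightarrow>\<^sub>M A" "Y \<in> P \<rightarrow>\<^sub>M B"
    and K: "K \<in> A \<rightarrow>\<^sub>M prob_algebra B"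
    and eq: "\<And>S T. S \<in> sets A \<Longrightarrow> T \<in> sets B \<Longrightarrow>
      (\<integral>\<^sup>+ \<omega>. indicator S (X \<omega>) * indicator T (Y \<omega>) \<partial>P) =
      (\<integral>\<^sup>+ \<omega>. indicator S (X \<omega>) * emeasure (K (X \<omega>)) T \<partial>P)"
  shows "is_cond_law P X A Y B K"
  unfolding is_cond_law_def
proof safe
  note [measurable] = measurable_prob_algebraD[OF K]
  fix S T assume [measurable]: "S \<in> sets A" "T \<in> sets B"
  have "emeasure P {\<omega> \<in> space P. X \<omega> \<in> S \<and> Y \<omega> \<in> T} =
      (\<integral>\<^sup>+ \<omega>. indicator {\<omega> \<in> space P. X \<omega> \<in> S \<and> Y \<omega> \<in> T} \<omega> \<partial>P)"
    by simp
  also have "\<dots> = (\<integral>\<^sup>+ \<omega>. indicator S (X \<omega>) * indicator T (Y \<omega>) \<partial>P)"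
    by (intro nn_integral_cong) (auto simp: indicator_def)
  also have "\<dots> = (\<integral>\<^sup>+ \<omega>. emeasure (K (X \<omega>)) T * indicator S (X \<omega>) \<partial>P)"
    by (subst eq) (auto simp: mult.commute)
  also have "\<dots> = (\<integral>\<^sup>+ x\<in>S. emeasure (K x) T \<partial>distr P A X)"
    by (subst nn_integral_distr) auto
  finally show "emeasure P {\<omega> \<in> space P. X \<omega> \<in> S \<and> Y \<omega> \<in> T} =
        (\<integral>\<^sup>+ x\<in>S. emeasure (K x) T \<partial>distr P A X)" .
qed fact

text \<open>\<open>is_cond_law\<close> prescribes the joint law on measurable rectangles, which are
  stable under intersection and generate the product sigma-algebra. The integral formulas for
  conditional laws follow from this identity of measures.\<close>

lemma is_cond_law_distr_bind:
  assumes "prob_space P" and [measurable]: "X \<in> P \<rightarrow>\<^sub>M A" "Y \<in> P \<rightarrow>\<^sub>M B"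
    and K: "is_cond_law P X A Y B K"
  shows "distr P (A \<Otimes>\<^sub>M B) (\<lambda>\<omega>. (X \<omega>, Y \<omega>)) =
    distr P A X \<bind> (\<lambda>x. distr (K x) (A \<Otimes>\<^sub>M B) (Pair x))" (is "?L = ?R")
proof (rule measure_eqI_generator_eq[OF Int_stable_pair_measure_generator[of A B]])
  interpret prob_space P by fact
  note [measurable] = is_cond_lawD(1,2)[OF K]
  have P': "distr P A X \<in> space (prob_algebra A)"
    by (auto simp: space_prob_algebra intro!: prob_space_distr)
  have K': "(\<lambda>x. distr (K x) (A \<Otimes>\<^sub>M B) (Pair x)) \<in> A \<rightarrow>\<^sub>M prob_algebra (A \<Otimes>\<^sub>M B)"
    by measurable
  show "{a \<times> b | a b. a \<in> sets A \<and> b \<in> sets B} \<subseteq> Pow (space A \<times> space B)"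
    by (rule pair_measure_closed)
  show "sets ?L = sigma_sets (space A \<times> space B) {a \<times> b | a b. a \<in> sets A \<and> b \<in> sets B}"
    by (simp add: sets_pair_measure)
  have sR: "sets ?R = sets (A \<Otimes>\<^sub>M B)"
    by (rule sets_bind'[OF P' K'])
  then show "sets ?R = sigma_sets (space A \<times> space B) {a \<times> b | a b. a \<in> sets A \<and> b \<in> sets B}"
    by (simp add: sets_pair_measure)
  show "range (\<lambda>_::nat. space A \<times> space B) \<subseteq> {a \<times> b | a b. a \<in> sets A \<and> b \<in> sets B}"
    "(\<Union>i::nat. space A \<times> space B) = space A \<times> space B"
    by auto
  show "emeasure ?L (space A \<times> space B) \<noteq> \<infinity>" for i :: nat
    by (simp add: emeasure_distr)
  fix Z assume "Z \<in> {a \<times> b | a b. a \<in> sets A \<and> b \<in> sets B}"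
  then obtain S T where Z: "Z = S \<times> T" and [measurable]: "S \<in> sets A" "T \<in> sets B" by auto
  have "emeasure ?R Z = (\<integral>\<^sup>+ x. emeasure (distr (K x) (A \<Otimes>\<^sub>M B) (Pair x)) Z \<partial>distr P A X)"
    unfolding Z by (rule emeasure_bind_prob_algebra[OF P' K']) measurable
  also have "\<dots> = (\<integral>\<^sup>+ x\<in>S. emeasure (K x) T \<partial>distr P A X)"
  proof (intro nn_integral_cong)
    fix x assume "x \<in> space (distr P A X)"
    then have x: "x \<in> space A" by simp
    have [measurable_cong]: "sets (K x) = sets B" using prob_space_kernel[OF is_cond_lawD(1)[OF K] x] by simp
    have "Pair x -` Z \<inter> space (K x) = (if x \<in> S then T else {})"
      unfolding Z using sets.sets_into_space[OF \<open>T \<in> sets B\<close>] prob_space_kernel(3)[OF is_cond_lawD(1)[OF K] x] by auto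
    then show "emeasure (distr (K x) (A \<Otimes>\<^sub>M B) (Pair x)) Z = emeasure (K x) T * indicator S x"
      using x by (subst emeasure_distr) (auto simp: Z)
  qed
  also have "\<dots> = emeasure P {\<omega> \<in> space P. X \<omega> \<in> S \<and> Y \<omega> \<in> T}"
    by (rule is_cond_lawD(3)[OF K, symmetric]) auto
  also have "\<dots> = emeasure ?L Z"
    unfolding Z by (subst emeasure_distr) (auto intro!: arg_cong[where f="emeasure P"])
  finally show "emeasure ?L Z = emeasure ?R Z" ..
qed

lemma is_cond_law_nn_integral:
  assumes "prob_space P" and [measurable]: "X \<in> P \<rightarrow>\<^sub>M A" "Y \<in> P \<rightarrow>\<^sub>M B"
    and K: "is_cond_law P X A Y B K"
    and [measurable]: "h \<in> borel_measurable (A \<Otimes>\<^sub>M B)"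
  shows "(\<integral>\<^sup>+ \<omega>. h (X \<omega>, Y \<omega>) \<partial>P) = (\<integral>\<^sup>+ \<omega>. (\<integral>\<^sup>+ b. h (X \<omega>, b) \<partial>K (X \<omega>)) \<partial>P)"
proof -
  interpret prob_space P by fact
  note [measurable] = is_cond_lawD(1,2)[OF K]
  have "(\<integral>\<^sup>+ \<omega>. h (X \<omega>, Y \<omega>) \<partial>P) = (\<integral>\<^sup>+ z. h z \<partial>distr P (A \<Otimes>\<^sub>M B) (\<lambda>\<omega>. (X \<omega>, Y \<omega>)))"
    by (subst nn_integral_distr) auto
  also have "\<dots> = (\<integral>\<^sup>+ x. (\<integral>\<^sup>+ z. h z \<partial>distr (K x) (A \<Otimes>\<^sub>M B) (Pair x)) \<partial>distr P A X)"
    unfolding is_cond_law_distr_bind[OF assms(1-4)]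
    by (rule nn_integral_bind[where B="A \<Otimes>\<^sub>M B"]) (auto intro!: measurable_prob_algebraD)
  also have "\<dots> = (\<integral>\<^sup>+ \<omega>. (\<integral>\<^sup>+ z. h z \<partial>distr (K (X \<omega>)) (A \<Otimes>\<^sub>M B) (Pair (X \<omega>))) \<partial>P)"
    by (subst nn_integral_distr) (auto intro!: nn_integral_measurable_subprob_algebra2[where N="A \<Otimes>\<^sub>M B"] measurable_prob_algebraD)
  also have "\<dots> = (\<integral>\<^sup>+ \<omega>. (\<integral>\<^sup>+ b. h (X \<omega>, b) \<partial>K (X \<omega>)) \<partial>P)"
  proof (intro nn_integral_cong)
    fix \<omega> assume "\<omega> \<in> space P"
    then have x: "X \<omega> \<in> space A" by (rule measurable_space[OF assms(2)])
    have [measurable_cong]: "sets (K (X \<omega>)) = sets B" using prob_space_kernel[OF is_cond_lawD(1)[OF K] x] by simp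
    show "(\<integral>\<^sup>+ z. h z \<partial>distr (K (X \<omega>)) (A \<Otimes>\<^sub>M B) (Pair (X \<omega>))) = (\<integral>\<^sup>+ b. h (X \<omega>, b) \<partial>K (X \<omega>))"
      using x by (subst nn_integral_distr) auto
  qed
  finally show ?thesis .
qed

text \<open>The probability of the exceptional event is the integral of its conditional
  probabilities, so it vanishes exactly if almost all of these do.\<close>

lemma is_cond_law_AE_iff:
  assumes "prob_space P" and [measurable]: "X \<in> P \<rightarrow>\<^sub>M A" "Y \<in> P \<rightarrow>\<^sub>M B"
    and K: "is_cond_law P X A Y B K"
    and [measurable]: "Measurable.pred (A \<Otimes>\<^sub>M B) Q"
  shows "(AE \<omega> in P. Q (X \<omega>, Y \<omega>)) \<longleftrightarrow> (AE \<omega> in P. AE b in K (X \<omega>). Q (X \<omega>, b))"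
proof -
  note [measurable] = is_cond_lawD(1,2)[OF K]
  let ?h = "\<lambda>z. indicator {z. \<not> Q z} z :: ennreal"
  have "(AE \<omega> in P. Q (X \<omega>, Y \<omega>)) \<longleftrightarrow> (\<integral>\<^sup>+ \<omega>. ?h (X \<omega>, Y \<omega>) \<partial>P) = 0"
    by (subst nn_integral_0_iff_AE) (auto simp: indicator_def)
  also have "\<dots> \<longleftrightarrow> (\<integral>\<^sup>+ \<omega>. (\<integral>\<^sup>+ b. ?h (X \<omega>, b) \<partial>K (X \<omega>)) \<partial>P) = 0"
    by (subst is_cond_law_nn_integral[OF assms(1-4)]) auto
  also have "\<dots> \<longleftrightarrow> (AE \<omega> in P. (\<integral>\<^sup>+ b. ?h (X \<omega>, b) \<partial>K (X \<omega>)) = 0)"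
    by (subst nn_integral_0_iff_AE) (auto intro!: nn_integral_measurable_subprob_algebra2[where N=B])
  also have "\<dots> \<longleftrightarrow> (AE \<omega> in P. AE b in K (X \<omega>). Q (X \<omega>, b))"
  proof (intro AE_cong)
    fix \<omega> assume "\<omega> \<in> space P"
    then have x: "X \<omega> \<in> space A" by (rule measurable_space[OF assms(2)])
    have [measurable_cong]: "sets (K (X \<omega>)) = sets B" using prob_space_kernel[OF is_cond_lawD(1)[OF K] x] by simp
    show "((\<integral>\<^sup>+ b. ?h (X \<omega>, b) \<partial>K (X \<omega>)) = 0) = (AE b in K (X \<omega>). Q (X \<omega>, b))"
      using x by (subst nn_integral_0_iff_AE) (auto simp: indicator_def)
  qed
  finally show ?thesis .
qed

lemma is_cond_law_ext_integral:
  assumes "prob_space P" and [measurable]: "X \<in> P \<rightarrow>\<^sub>M A" "Y \<in> P \<rightarrow>\<^sub>M B"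
    and K: "is_cond_law P X A Y B K"
    and [measurable]: "g \<in> borel_measurable (A \<Otimes>\<^sub>M B)" "L \<in> borel_measurable (A \<Otimes>\<^sub>M B)"
    and fin: "(\<integral>\<^sup>+ \<omega>. L (X \<omega>, Y \<omega>) \<partial>P) < \<infinity>"
    and lb: "\<And>x b. x \<in> space A \<Longrightarrow> b \<in> space B \<Longrightarrow> - enn2ereal (L (x, b)) \<le> g (x, b)"
  shows "ext_integral P (\<lambda>\<omega>. g (X \<omega>, Y \<omega>)) =
    ext_integral P (\<lambda>\<omega>. ext_integral (K (X \<omega>)) (\<lambda>b. g (X \<omega>, b)))"
proof -
  note [measurable] = is_cond_lawD(1,2)[OF K]
  let ?K = "\<lambda>\<omega>. distr (K (X \<omega>)) (A \<Otimes>\<^sub>M B) (Pair (X \<omega>))"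
  have eq1: "(\<integral>\<^sup>+ z. h z \<partial>?K \<omega>) = (\<integral>\<^sup>+ b. h (X \<omega>, b) \<partial>K (X \<omega>))"
    if "\<omega> \<in> space P" and [measurable]: "h \<in> borel_measurable (A \<Otimes>\<^sub>M B)" for \<omega> and h :: "_ \<Rightarrow> ennreal"
  proof -
    have x: "X \<omega> \<in> space A" using that(1) by (rule measurable_space[OF assms(2)])
    have [measurable_cong]: "sets (K (X \<omega>)) = sets B" using prob_space_kernel[OF is_cond_lawD(1)[OF K] x] by simp
    show ?thesis using x by (subst nn_integral_distr) auto
  qed
  have eq2: "ext_integral (?K \<omega>) g = ext_integral (K (X \<omega>)) (\<lambda>b. g (X \<omega>, b))"
    if "\<omega> \<in> space P" for \<omega>
  proof -
    have x: "X \<omega> \<in> space A" using that(1) by (rule measurable_space[OF assms(2)])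
    have [measurable_cong]: "sets (K (X \<omega>)) = sets B" using prob_space_kernel[OF is_cond_lawD(1)[OF K] x] by simp
    show ?thesis using x by (subst ext_integral_distr) auto
  qed
  have "ext_integral P (\<lambda>\<omega>. g (X \<omega>, Y \<omega>)) = ext_integral P (\<lambda>\<omega>. ext_integral (?K \<omega>) g)"
  proof (rule ext_integral_tower[where B="A \<Otimes>\<^sub>M B" and L=L])
    show "?K \<in> P \<rightarrow>\<^sub>M prob_algebra (A \<Otimes>\<^sub>M B)" by measurable
    fix h :: "_ \<Rightarrow> ennreal" assume [measurable]: "h \<in> borel_measurable (A \<Otimes>\<^sub>M B)"
    have "(\<integral>\<^sup>+ \<omega>. h (X \<omega>, Y \<omega>) \<partial>P) = (\<integral>\<^sup>+ \<omega>. (\<integral>\<^sup>+ b. h (X \<omega>, b) \<partial>K (X \<omega>)) \<partial>P)"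
      by (rule is_cond_law_nn_integral[OF assms(1-4)]) measurable
    also have "\<dots> = (\<integral>\<^sup>+ \<omega>. (\<integral>\<^sup>+ z. h z \<partial>?K \<omega>) \<partial>P)"
      by (intro nn_integral_cong eq1[symmetric]) auto
    finally show "(\<integral>\<^sup>+ \<omega>. h (X \<omega>, Y \<omega>) \<partial>P) = (\<integral>\<^sup>+ \<omega>. (\<integral>\<^sup>+ z. h z \<partial>?K \<omega>) \<partial>P)" .
  qed (use fin lb in \<open>auto simp: space_pair_measure\<close>)
  also have "\<dots> = ext_integral P (\<lambda>\<omega>. ext_integral (K (X \<omega>)) (\<lambda>b. g (X \<omega>, b)))"
    by (intro ext_integral_cong_AE AE_I2 eq2) auto
  finally show ?thesis .
qed

lemma is_cond_law_pushforward:
  assumes "prob_space P" and [measurable]: "X \<in> P \<rightarrow>\<^sub>M A" "Y \<in> P \<rightarrow>\<^sub>M B" "T \<in> B \<rightarrow>\<^sub>M B'"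
    and K: "is_cond_law P X A Y B K"
  shows "is_cond_law P X A (\<lambda>\<omega>. T (Y \<omega>)) B' (\<lambda>x. distr (K x) B' T)"
proof (rule is_cond_lawI)
  note [measurable] = is_cond_lawD(1,2)[OF K]
  show "(\<lambda>x. distr (K x) B' T) \<in> A \<rightarrow>\<^sub>M prob_algebra B'" by measurable
  fix S U assume [measurable]: "S \<in> sets A" "U \<in> sets B'"
  have "(\<integral>\<^sup>+ \<omega>. indicator S (X \<omega>) * indicator U (T (Y \<omega>)) \<partial>P) =
      (\<integral>\<^sup>+ \<omega>. (\<integral>\<^sup>+ b. indicator S (X \<omega>) * indicator U (T b) \<partial>K (X \<omega>)) \<partial>P)"
    using is_cond_law_nn_integral[OF assms(1-3) K, of "\<lambda>(x, b). indicator S x * indicator U (T b)"]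
    by simp
  also have "\<dots> = (\<integral>\<^sup>+ \<omega>. indicator S (X \<omega>) * emeasure (distr (K (X \<omega>)) B' T) U \<partial>P)"
  proof (intro nn_integral_cong)
    fix \<omega> assume "\<omega> \<in> space P"
    then have x: "X \<omega> \<in> space A" by (rule measurable_space[OF assms(2)])
    have [measurable_cong]: "sets (K (X \<omega>)) = sets B" using prob_space_kernel[OF is_cond_lawD(1)[OF K] x] by simp
    have T: "T \<in> K (X \<omega>) \<rightarrow>\<^sub>M B'"
      unfolding measurable_cong_sets[OF prob_space_kernel(2)[OF is_cond_lawD(1)[OF K] x] refl] by measurable
    have "emeasure (distr (K (X \<omega>)) B' T) U = (\<integral>\<^sup>+ b. indicator U (T b) \<partial>K (X \<omega>))"
      by (subst nn_integral_indicator[symmetric]) (simp, subst nn_integral_distr[OF T], auto)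
    then show "(\<integral>\<^sup>+ b. indicator S (X \<omega>) * indicator U (T b) \<partial>K (X \<omega>)) =
        indicator S (X \<omega>) * emeasure (distr (K (X \<omega>)) B' T) U"
      by (cases "X \<omega> \<in> S") simp_all
  qed
  finally show "(\<integral>\<^sup>+ \<omega>. indicator S (X \<omega>) * indicator U (T (Y \<omega>)) \<partial>P) =
      (\<integral>\<^sup>+ \<omega>. indicator S (X \<omega>) * emeasure (distr (K (X \<omega>)) B' T) U \<partial>P)" .
qed auto

text \<open>Composition of two kernels. Conditional laws of blocks of coordinates are assembled from
  one-dimensional ones in this way.\<close>

lemma is_cond_law_chain:
  assumes "prob_space P" and [measurable]: "X \<in> P \<rightarrow>\<^sub>M A" "Y \<in> P \<rightarrow>\<^sub>M B" "Z \<in> P \<rightarrow>\<^sub>M C"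
    and K: "is_cond_law P X A Y B K"
    and K': "is_cond_law P (\<lambda>\<omega>. (X \<omega>, Y \<omega>)) (A \<Otimes>\<^sub>M B) Z C K'"
  shows "is_cond_law P X A (\<lambda>\<omega>. (Y \<omega>, Z \<omega>)) (B \<Otimes>\<^sub>M C)
    (\<lambda>x. K x \<bind> (\<lambda>b. distr (K' (x, b)) (B \<Otimes>\<^sub>M C) (Pair b)))"
proof (rule is_cond_lawI)
  note [measurable] = is_cond_lawD(1,2)[OF K] is_cond_lawD(1,2)[OF K']
  show "(\<lambda>x. K x \<bind> (\<lambda>b. distr (K' (x, b)) (B \<Otimes>\<^sub>M C) (Pair b))) \<in> A \<rightarrow>\<^sub>M prob_algebra (B \<Otimes>\<^sub>M C)"
    by measurable
  fix S U assume [measurable]: "S \<in> sets A" "U \<in> sets (B \<Otimes>\<^sub>M C)"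
  have "(\<integral>\<^sup>+ \<omega>. indicator S (X \<omega>) * indicator U (Y \<omega>, Z \<omega>) \<partial>P) =
      (\<integral>\<^sup>+ \<omega>. (\<integral>\<^sup>+ c. indicator S (X \<omega>) * indicator U (Y \<omega>, c) \<partial>K' (X \<omega>, Y \<omega>)) \<partial>P)"
    using is_cond_law_nn_integral[OF assms(1) _ _ K', of "\<lambda>z. indicator S (fst (fst z)) * indicator U (snd (fst z), snd z)"]
    by simp
  also have "\<dots> = (\<integral>\<^sup>+ \<omega>. (\<integral>\<^sup>+ b. (\<integral>\<^sup>+ c. indicator S (X \<omega>) * indicator U (b, c) \<partial>K' (X \<omega>, b)) \<partial>K (X \<omega>)) \<partial>P)"
    using is_cond_law_nn_integral[OF assms(1) _ _ K, of "\<lambda>z. \<integral>\<^sup>+ c. indicator S (fst z) * indicator U (snd z, c) \<partial>K' z"]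
    by (simp add: nn_integral_measurable_subprob_algebra2[where N=C])
  also have "\<dots> = (\<integral>\<^sup>+ \<omega>. indicator S (X \<omega>) * emeasure (K (X \<omega>) \<bind> (\<lambda>b. distr (K' (X \<omega>, b)) (B \<Otimes>\<^sub>M C) (Pair b))) U \<partial>P)"
  proof (intro nn_integral_cong)
    fix \<omega> assume "\<omega> \<in> space P"
    then have x: "X \<omega> \<in> space A" by (rule measurable_space[OF assms(2)])
    note [measurable_cong] = prob_space_kernel(2)[OF is_cond_lawD(1)[OF K] x]
    have k': "b \<in> space B \<Longrightarrow> sets (K' (X \<omega>, b)) = sets C" for b
      using x by (intro prob_space_kernel(2)[OF is_cond_lawD(1)[OF K']]) (auto simp: space_pair_measure)
    have "emeasure (K (X \<omega>) \<bind> (\<lambda>b. distr (K' (X \<omega>, b)) (B \<Otimes>\<^sub>M C) (Pair b))) U =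
       (\<integral>\<^sup>+ b. emeasure (distr (K' (X \<omega>, b)) (B \<Otimes>\<^sub>M C) (Pair b)) U \<partial>K (X \<omega>))"
      using x measurable_space[OF is_cond_lawD(1)[OF K] x]
      by (intro emeasure_bind_prob_algebra) measurable
    also have "\<dots> = (\<integral>\<^sup>+ b. (\<integral>\<^sup>+ c. indicator U (b, c) \<partial>K' (X \<omega>, b)) \<partial>K (X \<omega>))"
    proof (intro nn_integral_cong)
      fix b assume "b \<in> space (K (X \<omega>))"
      then have b: "b \<in> space B" using prob_space_kernel(3)[OF is_cond_lawD(1)[OF K] x] by simp
      note [measurable_cong] = k'[OF b]
      show "emeasure (distr (K' (X \<omega>, b)) (B \<Otimes>\<^sub>M C) (Pair b)) U = (\<integral>\<^sup>+ c. indicator U (b, c) \<partial>K' (X \<omega>, b))"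
      proof -
        have P: "Pair b \<in> K' (X \<omega>, b) \<rightarrow>\<^sub>M B \<Otimes>\<^sub>M C"
          unfolding measurable_cong_sets[OF k'[OF b] refl] using b by measurable
        show ?thesis
          by (subst nn_integral_indicator[symmetric]) (simp, subst nn_integral_distr[OF P], auto)
      qed
    qed
    finally have e: "emeasure (K (X \<omega>) \<bind> (\<lambda>b. distr (K' (X \<omega>, b)) (B \<Otimes>\<^sub>M C) (Pair b))) U = \<dots>" .
    show "(\<integral>\<^sup>+ b. (\<integral>\<^sup>+ c. indicator S (X \<omega>) * indicator U (b, c) \<partial>K' (X \<omega>, b)) \<partial>K (X \<omega>)) =
        indicator S (X \<omega>) * emeasure (K (X \<omega>) \<bind> (\<lambda>b. distr (K' (X \<omega>, b)) (B \<Otimes>\<^sub>M C) (Pair b))) U"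
      unfolding e by (cases "X \<omega> \<in> S") auto
  qed
  finally show "(\<integral>\<^sup>+ \<omega>. indicator S (X \<omega>) * indicator U (Y \<omega>, Z \<omega>) \<partial>P) =
      (\<integral>\<^sup>+ \<omega>. indicator S (X \<omega>) * emeasure (K (X \<omega>) \<bind> (\<lambda>b. distr (K' (X \<omega>, b)) (B \<Otimes>\<^sub>M C) (Pair b))) U \<partial>P)" .
qed auto

lemma is_cond_law_distr:
  assumes [measurable]: "\<phi> \<in> P \<rightarrow>\<^sub>M Q" "X \<in> Q \<rightarrow>\<^sub>M A" "Y \<in> Q \<rightarrow>\<^sub>M B"
  shows "is_cond_law (distr P Q \<phi>) X A Y B K \<longleftrightarrow>
    is_cond_law P (\<lambda>\<omega>. X (\<phi> \<omega>)) A (\<lambda>\<omega>. Y (\<phi> \<omega>)) B K"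
proof -
  have "emeasure (distr P Q \<phi>) {\<omega> \<in> space (distr P Q \<phi>). X \<omega> \<in> S \<and> Y \<omega> \<in> T} =
      emeasure P {\<omega> \<in> space P. X (\<phi> \<omega>) \<in> S \<and> Y (\<phi> \<omega>) \<in> T}"
    if [measurable]: "S \<in> sets A" "T \<in> sets B" for S T
    by (subst emeasure_distr) (auto intro!: arg_cong[where f="emeasure P"] dest: measurable_space[OF assms(1)])
  moreover have "distr (distr P Q \<phi>) A X = distr P A (\<lambda>\<omega>. X (\<phi> \<omega>))"
    by (subst distr_distr) (auto simp: comp_def)
  ultimately show ?thesis
    by (auto simp: is_cond_law_def)
qed

section \<open>Uniqueness and existence of regular conditional laws\<close>

lemma countable_Int_stable_generator:
  obtains E :: "'a::second_countable_topology set set"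
  where "countable E" "Int_stable E" "sets borel = sigma_sets UNIV E" "UNIV \<in> E"
proof -
  obtain B :: "'a set set" where B: "countable B" "topological_basis B"
    using ex_countable_basis by blast
  let ?E = "{\<Inter>F | F. finite F \<and> F \<subseteq> B}"
  have "countable ?E"
  proof -
    have "?E = (\<lambda>F. \<Inter>F) ` {F. finite F \<and> F \<subseteq> B}" by auto
    then show ?thesis using countable_Collect_finite_subset[OF B(1)] by (metis countable_image)
  qed
  moreover have "Int_stable ?E"
  proof (rule Int_stableI)
    fix a b assume "a \<in> ?E" "b \<in> ?E"
    then obtain F G where "a = \<Inter>F" "b = \<Inter>G" "finite (F \<union> G)" "F \<union> G \<subseteq> B" by auto
    then show "a \<inter> b \<in> ?E" by (intro CollectI exI[of _ "F \<union> G"]) auto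
  qed
  moreover have "sets (borel :: 'a measure) = sigma_sets UNIV ?E"
  proof -
    have "sets (borel :: 'a measure) = sigma_sets UNIV B"
      by (subst borel_eq_countable_basis[OF B]) (simp add: B(2))
    also have "\<dots> = sigma_sets UNIV ?E"
    proof (rule sigma_sets_eqI)
      show "a \<in> sigma_sets UNIV ?E" if "a \<in> B" for a
        using that by (intro sigma_sets.Basic CollectI exI[of _ "{a}"]) auto
      show "b \<in> sigma_sets UNIV B" if b: "b \<in> ?E" for b
      proof -
        obtain F where F: "b = \<Inter>F" "finite F" "F \<subseteq> B" using b by auto
        have "F \<subseteq> sigma_sets UNIV B" using F(3) by (auto intro: sigma_sets.Basic)
        with F(2) have "\<Inter>F \<in> sigma_sets UNIV B"
        proof (induction F)
          case empty
          then show ?case by (simp add: sigma_sets_top)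
        next
          case (insert x F)
          interpret sigma_algebra UNIV "sigma_sets UNIV B"
            by (rule sigma_algebra_sigma_sets) auto
          show ?case using insert by auto
        qed
        then show ?thesis using F(1) by simp
      qed
    qed
    finally show ?thesis .
  qed
  moreover have "UNIV \<in> ?E" by (intro CollectI exI[of _ "{}"]) auto
  ultimately show ?thesis using that by blast
qed

lemma distr_id_cong:
  assumes "sets N = sets M" "\<And>x. x \<in> space M \<Longrightarrow> f x = x"
  shows "distr M N f = M"
proof -
  have "distr M N f = distr M M (\<lambda>x. x)" using assms by (intro distr_cong) auto
  then show ?thesis by simp
qed

text \<open>For a fixed set the two kernels agree almost everywhere; a countable generator stable
  under intersections makes the exceptional null set independent of the set. The maps e and d embed
  B into a second countable space, which has such a generator. In this way the products over finite
  index sets are covered, which are not the Borel sigma-algebra of a type.\<close>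

lemma is_cond_law_unique:
  fixes e :: "'c \<Rightarrow> 'd::second_countable_topology"
  assumes "prob_space P" and [measurable]: "X \<in> P \<rightarrow>\<^sub>M A" "Y \<in> P \<rightarrow>\<^sub>M B"
    and K: "is_cond_law P X A Y B K" and K': "is_cond_law P X A Y B K'"
    and [measurable]: "e \<in> B \<rightarrow>\<^sub>M borel" "d \<in> borel \<rightarrow>\<^sub>M B" and de: "\<And>b. b \<in> space B \<Longrightarrow> d (e b) = b"
  shows "AE x in distr P A X. K x = K' x"
proof -
  interpret prob_space P by fact
  interpret D: prob_space "distr P A X" by (rule prob_space_distr) measurable
  note [measurable] = is_cond_lawD(1,2)[OF K] is_cond_lawD(1,2)[OF K']
  obtain E :: "'d set set" where E: "countable E" "Int_stable E" "sets borel = sigma_sets UNIV E" "UNIV \<in> E"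
    by (rule countable_Int_stable_generator)
  have fin: "(\<integral>\<^sup>+ x. emeasure (L x) T \<partial>distr P A X) < \<infinity>"
    if L: "L \<in> A \<rightarrow>\<^sub>M prob_algebra B" for L T
  proof -
    have "(\<integral>\<^sup>+ x. emeasure (L x) T \<partial>distr P A X) \<le> (\<integral>\<^sup>+ x. 1 \<partial>distr P A X)"
      using prob_space.emeasure_le_1[OF prob_space_kernel(1)[OF L]] by (intro nn_integral_mono) auto
    also have "\<dots> < \<infinity>" using D.emeasure_space_1 by simp
    finally show ?thesis .
  qed
  have "AE x in distr P A X. emeasure (K x) T = emeasure (K' x) T" if [measurable]: "T \<in> sets B" for T
    using is_cond_lawD(3)[OF K _ that] is_cond_lawD(3)[OF K' _ that]
    by (intro AE_eq_if_set_nn_integral_eq fin is_cond_lawD(1)[OF K] is_cond_lawD(1)[OF K']) auto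
  moreover have "e -` T \<inter> space B \<in> sets B" if "T \<in> E" for T
    using that by (intro measurable_sets[OF assms(6)]) (auto simp: E(3))
  ultimately have "AE x in distr P A X. \<forall>T\<in>E. emeasure (K x) (e -` T \<inter> space B) = emeasure (K' x) (e -` T \<inter> space B)"
    using E(1) by (intro AE_ball_countable'[rotated]) auto
  then show ?thesis
    using AE_space
  proof eventually_elim
    case (elim x)
    then have x: "x \<in> space A" by simp
    note k = prob_space_kernel[OF is_cond_lawD(1)[OF K] x] prob_space_kernel[OF is_cond_lawD(1)[OF K'] x]
    interpret K1: prob_space "K x" by (rule k)
    interpret K2: prob_space "K' x" by (rule k)
    have e: "e \<in> K x \<rightarrow>\<^sub>M borel" "e \<in> K' x \<rightarrow>\<^sub>M borel"
      unfolding measurable_cong_sets[OF k(2) refl] measurable_cong_sets[OF k(5) refl] by measurable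
    have "distr (K x) borel e = distr (K' x) borel e"
    proof (rule measure_eqI_generator_eq[OF E(2), where \<Omega>=UNIV and A="\<lambda>_. UNIV"])
      fix T assume "T \<in> E"
      then have "T \<in> sets borel" by (simp add: E(3))
      then show "emeasure (distr (K x) borel e) T = emeasure (distr (K' x) borel e) T"
        using elim(1) \<open>T \<in> E\<close> e k by (simp add: emeasure_distr)
    qed (use E(3,4) in \<open>auto simp: emeasure_distr e K1.emeasure_eq_measure\<close>)
    then have "distr (distr (K x) borel e) B d = distr (distr (K' x) borel e) B d" by simp
    moreover have "distr (distr (K x) borel e) B d = K x"
      using k de by (subst distr_distr[OF _ e(1)]) (auto intro!: distr_id_cong simp: comp_def)
    moreover have "distr (distr (K' x) borel e) B d = K' x"
      using k de by (subst distr_distr[OF _ e(2)]) (auto intro!: distr_id_cong simp: comp_def)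
    ultimately show ?case by simp
  qed
qed

lemma is_cond_law_cond_law:
  "is_cond_law P X A Y B K \<Longrightarrow> is_cond_law P X A Y B (cond_law P X A Y B)"
  unfolding cond_law_def by (rule someI[where P="is_cond_law P X A Y B"])

text \<open>The classical construction: Radon-Nikodym densities give the conditional probability of
  Y being at most r for each single r, the values at rational r are regularised to a distribution
  function, and its Stieltjes measure is the kernel.\<close>

lemma ex_cond_law_real:
  fixes Y :: "'a \<Rightarrow> real"
  assumes "prob_space P" and [measurable]: "X \<in> P \<rightarrow>\<^sub>M A" "Y \<in> borel_measurable P"
  shows "\<exists>K. is_cond_law P X A Y borel K"
proof -
  interpret prob_space P by fact
  define M where "M = distr P A X"
  interpret M: prob_space M unfolding M_def by (rule prob_space_distr) measurable
  have [measurable_cong, simp]: "sets M = sets A" "space M = space A" by (auto simp: M_def)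
  \<comment> \<open>The law of Y on the event that X lies in S, without normalisation;
    \<open>J (space A)\<close> is the law of Y.\<close>
  define J where "J S = distr (density P (\<lambda>\<omega>. indicator S (X \<omega>))) borel Y" for S
  have emJ: "emeasure (J S) T = emeasure P {\<omega> \<in> space P. X \<omega> \<in> S \<and> Y \<omega> \<in> T}"
    if [measurable]: "S \<in> sets A" "T \<in> sets borel" for S T
    unfolding J_def
    by (subst emeasure_distr, simp, simp, subst emeasure_density)
      (auto simp: nn_integral_indicator[symmetric] indicator_def simp del: nn_integral_indicator intro!: nn_integral_cong)
  have J: "finite_borel_measure (J S)" if "S \<in> sets A" for S
  proof (intro finite_borel_measure.intro finite_measureI finite_borel_measure_axioms.intro)
    show "emeasure (J S) (space (J S)) \<noteq> \<infinity>"
      using emJ[OF that, of UNIV] by (simp add: J_def emeasure_eq_measure)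
  qed (simp add: J_def)
  have J1: "real_distribution (J (space A))"
  proof (intro real_distribution.intro prob_spaceI real_distribution_axioms.intro)
    have "{\<omega> \<in> space P. X \<omega> \<in> space A} = space P" using measurable_space[OF assms(2)] by auto
    then show "emeasure (J (space A)) (space (J (space A))) = 1"
      using emJ[of "space A" UNIV] emeasure_space_1 by (simp add: J_def)
  qed (simp_all add: J_def)
  \<comment> \<open>With r fixed and S varying, the mass of \<open>J S\<close> on the half-line is a
    measure in S dominated by the law of X, so it has a density.\<close>
  have "\<exists>F\<in>borel_measurable M. \<forall>S\<in>sets A. (\<integral>\<^sup>+ x\<in>S. F x \<partial>M) = emeasure (J S) {..r}" for r
  proof -
    define N where "N = distr (density P (\<lambda>\<omega>. indicator {..r} (Y \<omega>))) A X"
    have N: "emeasure N S = emeasure (J S) {..r}" if [measurable]: "S \<in> sets A" for S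
      unfolding N_def
      by (subst emeasure_distr, simp, simp, subst emeasure_density)
        (auto simp: emJ nn_integral_indicator[symmetric] indicator_def simp del: nn_integral_indicator intro!: nn_integral_cong)
    have "absolutely_continuous M N"
    proof (unfold absolutely_continuous_def, safe)
      fix S assume "S \<in> null_sets M"
      then have S[measurable]: "S \<in> sets A" and z: "emeasure P {\<omega> \<in> space P. X \<omega> \<in> S} = 0"
        by (auto simp: null_sets_def M_def emeasure_distr vimage_def Int_def conj_commute)
      have "emeasure N S \<le> emeasure P {\<omega> \<in> space P. X \<omega> \<in> S}"
        unfolding N[OF S] by (subst emJ) (auto intro!: emeasure_mono)
      then show "S \<in> null_sets N" using z by (auto simp: null_sets_def N_def)
    qed
    then have "density M (RN_deriv M N) = N"
      by (intro M.density_RN_deriv) (auto simp: N_def)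
    then have "(\<integral>\<^sup>+ x\<in>S. RN_deriv M N x \<partial>M) = emeasure (J S) {..r}" if S: "S \<in> sets A" for S
      using N[OF S] S emeasure_density[of "RN_deriv M N" M S] by simp
    then show ?thesis by (intro bexI[of _ "RN_deriv M N"]) auto
  qed
  then obtain F where [measurable]: "\<And>r. F r \<in> borel_measurable M"
    and F: "\<And>r S. S \<in> sets A \<Longrightarrow> (\<integral>\<^sup>+ x\<in>S. F r x \<partial>M) = emeasure (J S) {..r}"
    by metis
  have le1: "emeasure (J S) T \<le> emeasure M S" if [measurable]: "S \<in> sets A" "T \<in> sets borel" for S T
    by (subst emJ) (auto simp: M_def emeasure_distr intro!: emeasure_mono)
  have Fint: "(\<integral>\<^sup>+ x. F r x \<partial>M) = emeasure (J (space A)) {..r}" for r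
  proof -
    have "(\<integral>\<^sup>+ x. F r x \<partial>M) = (\<integral>\<^sup>+ x\<in>space A. F r x \<partial>M)"
      by (intro nn_integral_cong) auto
    then show ?thesis using F[of "space A" r] by simp
  qed
  have Ffin: "(\<integral>\<^sup>+ x. F r x \<partial>M) < \<infinity>" for r
    using le1[of "space A" "{..r}"] M.emeasure_space_1 by (auto simp: Fint le_less_trans)
  have Fmono: "AE x in M. F r x \<le> F s x" if "r \<le> s" for r s
  proof (rule AE_le_if_set_nn_integral_le)
    fix S assume "S \<in> sets M"
    then show "(\<integral>\<^sup>+ x\<in>S. F r x \<partial>M) \<le> (\<integral>\<^sup>+ x\<in>S. F s x \<partial>M)"
      using that by (auto simp: F intro!: emeasure_mono) (auto simp: J_def)
  qed (auto simp: Ffin[simplified])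
  have F1: "AE x in M. F r x \<le> 1" for r
  proof (rule AE_le_if_set_nn_integral_le)
    fix S assume "S \<in> sets M"
    then show "(\<integral>\<^sup>+ x\<in>S. F r x \<partial>M) \<le> (\<integral>\<^sup>+ x\<in>S. 1 \<partial>M)"
      using le1[of S "{..r}"] by (auto simp: F)
  qed (auto simp: Ffin[simplified])
  \<comment> \<open>Each density is determined up to a null set only, so just countably many
    relations can hold simultaneously: monotonicity along the rationals and the limits along the
    integers.\<close>
  define good where "good x \<longleftrightarrow> (\<forall>q r::rat. q \<le> r \<longrightarrow> F (of_rat q) x \<le> F (of_rat r) x) \<and>
    (\<forall>q::rat. F (of_rat q) x \<le> 1) \<and> (SUP n. F (real n) x) = 1 \<and> (INF n. F (- real n) x) = 0" for x
  have good: "AE x in M. good x"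
  proof -
    interpret J1: real_distribution "J (space A)" by (rule J1)
    have "AE x in M. (SUP n. F (real n) x) = 1"
    proof -
      have le: "AE x in M. (SUP n. F (real n) x) \<le> 1"
        using F1 by (auto simp: AE_all_countable SUP_le_iff)
      have "(\<lambda>n. measure (J (space A)) {..real n}) \<longlonglongrightarrow> 1"
        using J1.cdf_lim_infty_prob by (simp add: cdf_def)
      then have "(\<lambda>n. emeasure (J (space A)) {..real n}) \<longlonglongrightarrow> 1"
        by (subst J1.emeasure_eq_measure) (simp flip: ennreal_1)
      then have "1 \<le> (\<integral>\<^sup>+ x. (SUP n. F (real n) x) \<partial>M)"
        by (rule LIMSEQ_le_const2) (auto simp flip: Fint intro!: exI[of _ 0] nn_integral_mono SUP_upper)
      have "(\<integral>\<^sup>+ x. 1 - (SUP n. F (real n) x) \<partial>M) = (\<integral>\<^sup>+ x. 1 \<partial>M) - (\<integral>\<^sup>+ x. (SUP n. F (real n) x) \<partial>M)"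
      proof (rule nn_integral_diff)
        have "(\<integral>\<^sup>+ x. (SUP n. F (real n) x) \<partial>M) \<le> (\<integral>\<^sup>+ x. 1 \<partial>M)" using le by (rule nn_integral_mono_AE)
        then show "(\<integral>\<^sup>+ x. (SUP n. F (real n) x) \<partial>M) \<noteq> \<infinity>" using M.emeasure_space_1 by (auto simp: top_unique)
      qed (use le in auto)
      also have "\<dots> = 0" using \<open>1 \<le> _\<close> M.emeasure_space_1 by (simp add: diff_eq_0_iff_ennreal)
      finally have "AE x in M. 1 - (SUP n. F (real n) x) = 0"
        by (subst (asm) nn_integral_0_iff_AE) auto
      with le show ?thesis by eventually_elim (auto simp: diff_eq_0_iff_ennreal intro: antisym)
    qed
    moreover have "AE x in M. (INF n. F (- real n) x) = 0"
    proof -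
      have "(\<lambda>n. measure (J (space A)) {..- real n}) \<longlonglongrightarrow> 0"
        using J1.cdf_lim_neg_infty by (simp add: cdf_def)
      then have "(\<lambda>n. emeasure (J (space A)) {..- real n}) \<longlonglongrightarrow> 0"
        by (subst J1.emeasure_eq_measure) (simp flip: ennreal_0)
      then have "(\<integral>\<^sup>+ x. (INF n. F (- real n) x) \<partial>M) \<le> 0"
        by (rule LIMSEQ_le_const) (auto simp flip: Fint intro!: exI[of _ 0] nn_integral_mono INF_lower)
      then show ?thesis by (simp add: nn_integral_0_iff_AE)
    qed
    ultimately show ?thesis
      unfolding good_def using Fmono F1 by (auto simp: AE_all_countable of_rat_less_eq)
  qed
  \<comment> \<open>Taking the infimum over rationals strictly above t produces right
    continuity.\<close>
  define D where "D x (t::real) = (INF q\<in>{q::rat. t < of_rat q}. F (of_rat q) x)" for x t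
  define C where "C x t = enn2real (D x t)" for x t
  have [measurable]: "(\<lambda>x. D x t) \<in> borel_measurable M" for t unfolding D_def by measurable
  have [measurable]: "Measurable.pred M good" unfolding good_def by measurable
  have D1: "D x t \<le> 1" if "good x" for x t
  proof -
    obtain q :: rat where "t < of_rat q" using reals_Archimedean2[of t] by (metis of_rat_of_nat_eq)
    then show ?thesis using that unfolding D_def good_def by (intro INF_lower2[of q]) auto
  qed
  have CD: "ennreal (C x t) = D x t" if "good x" for x t
    using D1[OF that, of t] unfolding C_def by (intro ennreal_enn2real) (auto simp: le_less_trans)
  have Dle: "D x t \<le> F (of_rat q) x" if "t < of_rat q" for x and t :: real and q
    unfolding D_def using that by (intro INF_lower) auto
  have leD: "F (of_rat q) x \<le> D x t" if "of_rat q \<le> t" "good x" for x and t :: real and q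
    unfolding D_def
  proof (intro INF_greatest)
    fix r :: rat assume "r \<in> {q. t < of_rat q}"
    then have "q \<le> r" using that(1) by (metis less_imp_le mem_Collect_eq of_rat_less le_less_trans)
    then show "F (of_rat q) x \<le> F (of_rat r) x" using that(2) by (auto simp: good_def)
  qed
  have Cmono: "C x s \<le> C x t" if "good x" "s \<le> t" for x s t
  proof -
    have "D x s \<le> D x t" unfolding D_def using that(2) by (intro INF_superset_mono) auto
    then show ?thesis unfolding C_def using D1[OF that(1), of t] by (intro enn2real_mono) (auto simp: le_less_trans)
  qed
  have C: "continuous (at_right a) (C x)" "(C x \<longlongrightarrow> 0) at_bot" "(C x \<longlongrightarrow> 1) at_top" if x: "good x" for x a
  proof -
    have C0: "0 \<le> C x t" "C x t \<le> 1" for t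
      using D1[OF x, of t] by (auto simp: C_def intro!: enn2real_leI)
    show "continuous (at_right a) (C x)"
      unfolding continuous_within
    proof (rule order_tendstoI)
      fix y assume "y < C x a"
      then have "y < C x t" if "a < t" for t using Cmono[OF x, of a t] that by simp
      then show "\<forall>\<^sub>F t in at_right a. y < C x t" by (auto simp: eventually_at_filter)
    next
      fix y assume y: "C x a < y"
      then have "D x a < ennreal y" using C0[of a] by (simp add: ennreal_less_iff flip: CD[OF x])
      then obtain q :: rat where q: "a < of_rat q" "F (of_rat q) x < ennreal y"
        by (auto simp: D_def INF_less_iff)
      have "C x t < y" if "t < of_rat q" for t
      proof -
        have "ennreal (C x t) < ennreal y" using Dle[OF that, of x] q(2) by (simp add: CD[OF x])
        then show ?thesis using C0 by (simp add: ennreal_less_iff)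
      qed
      then show "\<forall>\<^sub>F t in at_right a. C x t < y"
        using q(1) by (auto simp: eventually_at_right)
    qed
    show "(C x \<longlongrightarrow> 0) at_bot"
    proof (rule order_tendstoI)
      show "\<forall>\<^sub>F t in at_bot. y < C x t" if "y < 0" for y using that C0 by (auto intro!: always_eventually intro: less_le_trans)
      fix y :: real assume y: "0 < y"
      have "(INF n. F (- real n) x) < ennreal y" using x y by (auto simp: good_def)
      then obtain n where n: "F (- real n) x < ennreal y" by (auto simp: INF_less_iff)
      have "C x t < y" if "t < - real n" for t
      proof -
        have "ennreal (C x t) < ennreal y" using Dle[of t "- of_nat n" x] that n
          by (simp add: CD[OF x] of_rat_minus)
        then show ?thesis using C0 by (simp add: ennreal_less_iff)
      qed
      then show "\<forall>\<^sub>F t in at_bot. C x t < y" by (auto simp: eventually_at_bot_dense)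
    qed
    show "(C x \<longlongrightarrow> 1) at_top"
    proof (rule order_tendstoI)
      show "\<forall>\<^sub>F t in at_top. C x t < y" if "1 < y" for y using that C0 by (auto intro!: always_eventually intro: le_less_trans)
      fix y :: real assume y: "y < 1"
      have "ennreal y < (SUP n. F (real n) x)" using x y by (auto simp: good_def ennreal_less_one_iff)
      then obtain n where n: "ennreal y < F (real n) x" by (auto simp: less_SUP_iff)
      have "y < C x t" if "real n < t" for t
      proof -
        have "ennreal y < ennreal (C x t)" using leD[of "of_nat n" t x] that n x
          by (simp add: CD[OF x])
        then show ?thesis using C0 by (metis ennreal_leI not_less)
      qed
      then show "\<forall>\<^sub>F t in at_top. y < C x t" by (auto simp: eventually_at_top_dense)
    qed
  qed
  \<comment> \<open>On the null set of bad points a point mass keeps the kernel a probability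
    measure everywhere.\<close>
  define K where "K x = (if good x then interval_measure (C x) else return borel 0)" for x
  have Kd: "real_distribution (K x)" for x
  proof (cases "good x")
    case True
    then show ?thesis unfolding K_def using C[OF True] Cmono[OF True]
      by (simp add: real_distribution_interval_measure)
  next
    case False
    interpret R: prob_space "return borel (0::real)" by (rule prob_space_return) simp
    show ?thesis using False unfolding K_def
      by (intro real_distribution.intro real_distribution_axioms.intro) (simp_all add: R.prob_space_axioms)
  qed
  have KD: "emeasure (K x) {..t} = (if good x then D x t else indicator {..t} 0)" for x t
    using C[of x] Cmono[of x] CD[of x t] by (auto simp: K_def emeasure_interval_measure_Iic)
  have Kms[measurable]: "K \<in> A \<rightarrow>\<^sub>M prob_algebra borel"
  proof (rule measurable_prob_algebra_generated[where \<Omega>=UNIV and G="range atMost"])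
    show "sets borel = sigma_sets UNIV (range (atMost :: real \<Rightarrow> _))"
      by (simp add: borel_eq_atMost)
    show "Int_stable (range (atMost :: real \<Rightarrow> _))" by (auto simp: Int_stable_def)
    show "prob_space (K x)" for x using Kd[of x] by (rule real_distribution.axioms)
    show "sets (K x) = sets borel" for x using Kd[of x] by (simp add: real_distribution.events_eq_borel)
    show "(\<lambda>x. emeasure (K x) T) \<in> borel_measurable A" if T: "T \<in> range atMost" for T
    proof -
      obtain t where "T = {..t}" using T by auto
      moreover have "(\<lambda>x. emeasure (K x) {..t}) \<in> borel_measurable M" unfolding KD by measurable
      ultimately show ?thesis by (simp add: measurable_cong_sets[OF \<open>sets M = sets A\<close> refl])
    qed
  qed auto
  have [measurable]: "K \<in> M \<rightarrow>\<^sub>M subprob_algebra borel"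
    using measurable_prob_algebraD[OF Kms] by (simp add: measurable_cong_sets[OF \<open>sets M = sets A\<close> refl])
  have main: "(\<integral>\<^sup>+ x\<in>S. emeasure (K x) {..t} \<partial>M) = emeasure (J S) {..t}" if S[measurable]: "S \<in> sets A" for S t
  proof (rule antisym)
    interpret J: finite_borel_measure "J S" by (rule J) fact
    \<comment> \<open>For one real t, comparison with all rationals above t costs countably many
      null sets.\<close>
    have AE: "AE x in M. F t x \<le> D x t \<and> emeasure (K x) {..t} = D x t"
    proof -
      have "AE x in M. \<forall>q. t < of_rat q \<longrightarrow> F t x \<le> F (of_rat q) x"
        using Fmono[of t] by (auto simp: AE_all_countable)
      with good show ?thesis
        by eventually_elim (auto simp: D_def KD intro!: INF_greatest)
    qed
    have "emeasure (J S) {..t} = (\<integral>\<^sup>+ x\<in>S. F t x \<partial>M)" using F[OF S] by simp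
    also have "\<dots> \<le> (\<integral>\<^sup>+ x\<in>S. emeasure (K x) {..t} \<partial>M)"
      using AE by (intro nn_integral_mono_AE, eventually_elim) (auto intro: mult_right_mono)
    finally show "emeasure (J S) {..t} \<le> (\<integral>\<^sup>+ x\<in>S. emeasure (K x) {..t} \<partial>M)" .
    \<comment> \<open>Each rational above t gives an upper bound; right continuity of the
      distribution function of \<open>J S\<close> then closes the gap down to t.\<close>
    have up: "(\<integral>\<^sup>+ x\<in>S. emeasure (K x) {..t} \<partial>M) \<le> ennreal (cdf (J S) (of_rat q))" if "t < of_rat q" for q
    proof -
      have "(\<integral>\<^sup>+ x\<in>S. emeasure (K x) {..t} \<partial>M) \<le> (\<integral>\<^sup>+ x\<in>S. F (of_rat q) x \<partial>M)"
        using AE by (intro nn_integral_mono_AE, eventually_elim) (auto intro!: mult_right_mono Dle that)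
      then show ?thesis by (simp add: F[OF S] cdf_def J.emeasure_eq_measure)
    qed
    have "(\<integral>\<^sup>+ x\<in>S. emeasure (K x) {..t} \<partial>M) \<le> ennreal (cdf (J S) t)"
    proof (rule ennreal_le_epsilon)
      fix e :: real assume "0 < e"
      then have "\<forall>\<^sub>F r in at_right t. cdf (J S) r < cdf (J S) t + e"
        using J.cdf_is_right_cont[of t] unfolding continuous_within by (intro order_tendstoD) auto
      then obtain b where b: "t < b" "\<And>r. t < r \<Longrightarrow> r < b \<Longrightarrow> cdf (J S) r < cdf (J S) t + e"
        by (auto simp: eventually_at_right[OF less_add_one])
      obtain q where q: "t < of_rat q" "of_rat q < b" using of_rat_dense[OF b(1)] by auto
      have "(\<integral>\<^sup>+ x\<in>S. emeasure (K x) {..t} \<partial>M) \<le> ennreal (cdf (J S) (of_rat q))" by (rule up) fact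
      also have "\<dots> \<le> ennreal (cdf (J S) t + e)" using b(2)[OF q] by (intro ennreal_leI) simp
      also have "\<dots> = ennreal (cdf (J S) t) + ennreal e"
        using \<open>0 < e\<close> by (intro ennreal_plus) (auto simp: cdf_def)
      finally show "(\<integral>\<^sup>+ x\<in>S. emeasure (K x) {..t} \<partial>M) \<le> ennreal (cdf (J S) t) + ennreal e" .
    qed
    then show "(\<integral>\<^sup>+ x\<in>S. emeasure (K x) {..t} \<partial>M) \<le> emeasure (J S) {..t}"
      by (simp add: cdf_def J.emeasure_eq_measure)
  qed
  have "(\<integral>\<^sup>+ x\<in>S. emeasure (K x) T \<partial>M) = emeasure (J S) T"
    if S[measurable]: "S \<in> sets A" and T: "T \<in> sets borel" for S T
  proof -
    interpret J: finite_borel_measure "J S" by (rule J) fact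
    have KS: "space (K x) = UNIV" "emeasure (K x) UNIV = 1" for x
    proof -
      interpret R: real_distribution "K x" by (rule Kd)
      show "space (K x) = UNIV" by simp
      then show "emeasure (K x) UNIV = 1" using R.emeasure_space_1 by simp
    qed
    have KUNIV: "(\<integral>\<^sup>+ x\<in>S. emeasure (K x) UNIV \<partial>M) = emeasure (J S) UNIV"
      unfolding KS by (subst emJ) (auto simp: M_def emeasure_distr intro!: arg_cong[where f="emeasure P"])
    \<comment> \<open>Half-lines generate the Borel sets and are stable under intersection, so the
      identity extends from them by Dynkin's argument; the total masses are finite, which the
      passage to complements uses.\<close>
    have "T \<in> sigma_sets UNIV (range (atMost :: real \<Rightarrow> _))"
      using T by (simp add: borel_eq_atMost)
    have "Int_stable (range (atMost :: real \<Rightarrow> _))" "range (atMost :: real \<Rightarrow> _) \<subseteq> Pow UNIV"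
      by (auto simp: Int_stable_def)
    then show ?thesis using \<open>T \<in> sigma_sets _ _\<close>
    proof (induction T rule: sigma_sets_induct_disjoint)
      case (basic T)
      then show ?case using main[OF S] by auto
    next
      case (compl T)
      have [measurable]: "T \<in> sets borel" using compl by (simp add: borel_eq_atMost)
      have "(\<integral>\<^sup>+ x\<in>S. emeasure (K x) (UNIV - T) \<partial>M) =
        (\<integral>\<^sup>+ x. emeasure (K x) UNIV * indicator S x - emeasure (K x) T * indicator S x \<partial>M)"
      proof (intro nn_integral_cong)
        fix x assume "x \<in> space M"
        interpret R: real_distribution "K x" by (rule Kd)
        have "emeasure (K x) (UNIV - T) = emeasure (K x) UNIV - emeasure (K x) T"
          by (rule emeasure_Diff) auto
        then show "emeasure (K x) (UNIV - T) * indicator S x =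
            emeasure (K x) UNIV * indicator S x - emeasure (K x) T * indicator S x"
          by (auto simp: indicator_def)
      qed
      also have "\<dots> = (\<integral>\<^sup>+ x\<in>S. emeasure (K x) UNIV \<partial>M) - (\<integral>\<^sup>+ x\<in>S. emeasure (K x) T \<partial>M)"
      proof (intro nn_integral_diff)
        show "AE x in M. emeasure (K x) T * indicator S x \<le> emeasure (K x) UNIV * indicator S x"
        proof (intro AE_I2 mult_right_mono emeasure_mono)
          fix x interpret R: real_distribution "K x" by (rule Kd)
          show "UNIV \<in> sets (K x)" by simp
        qed auto
      qed (auto simp: compl)
      also have "\<dots> = emeasure (J S) (UNIV - T)"
        unfolding KUNIV compl by (subst emeasure_Diff) (use J.emeasure_finite[of T] in \<open>auto simp: J_def\<close>)
      finally show ?case .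
    next
      case (union T)
      have T[measurable]: "T i \<in> sets borel" for i using union(2) by (auto simp: borel_eq_atMost)
      have "(\<integral>\<^sup>+ x\<in>S. emeasure (K x) (\<Union>i. T i) \<partial>M) = (\<integral>\<^sup>+ x. (\<Sum>i. emeasure (K x) (T i) * indicator S x) \<partial>M)"
      proof (intro nn_integral_cong)
        fix x interpret R: real_distribution "K x" by (rule Kd)
        have "(\<Sum>i. emeasure (K x) (T i)) = emeasure (K x) (\<Union>i. T i)"
          using union(1) by (intro suminf_emeasure) auto
        then show "emeasure (K x) (\<Union>i. T i) * indicator S x = (\<Sum>i. emeasure (K x) (T i) * indicator S x)"
          by (simp add: ennreal_suminf_multc)
      qed
      also have "\<dots> = (\<Sum>i. \<integral>\<^sup>+ x\<in>S. emeasure (K x) (T i) \<partial>M)"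
        by (rule nn_integral_suminf) measurable
      also have "\<dots> = emeasure (J S) (\<Union>i. T i)"
        unfolding union(3) using union(1) by (intro suminf_emeasure) (auto simp: J_def)
      finally show ?case .
    qed auto
  qed
  then have "is_cond_law P X A Y borel K"
    unfolding is_cond_law_def using Kms by (auto simp: emJ M_def)
  then show ?thesis by blast
qed

lemma is_cond_law_cong:
  assumes "\<And>\<omega>. \<omega> \<in> space P \<Longrightarrow> X \<omega> = X' \<omega>" "\<And>\<omega>. \<omega> \<in> space P \<Longrightarrow> Y \<omega> = Y' \<omega>"
  shows "is_cond_law P X A Y B K \<longleftrightarrow> is_cond_law P X' A Y' B K"
proof -
  have "{\<omega> \<in> space P. X \<omega> \<in> S \<and> Y \<omega> \<in> T} = {\<omega> \<in> space P. X' \<omega> \<in> S \<and> Y' \<omega> \<in> T}" for S T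
    using assms by auto
  moreover have "distr P A X = distr P A X'" using assms by (intro distr_cong) auto
  ultimately show ?thesis by (simp add: is_cond_law_def)
qed

text \<open>Converse of \<open>is_cond_law_distr_bind\<close>. It turns an equality of joint laws,
  as obtained from uniqueness of kernels, back into a statement about conditional laws.\<close>

lemma is_cond_law_if_distr_bind:
  assumes "prob_space P" and [measurable]: "X \<in> P \<rightarrow>\<^sub>M A" "Y \<in> P \<rightarrow>\<^sub>M B"
    and K: "K \<in> A \<rightarrow>\<^sub>M prob_algebra B"
    and eq: "distr P (A \<Otimes>\<^sub>M B) (\<lambda>\<omega>. (X \<omega>, Y \<omega>)) =
      distr P A X \<bind> (\<lambda>x. distr (K x) (A \<Otimes>\<^sub>M B) (Pair x))"
  shows "is_cond_law P X A Y B K"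
  unfolding is_cond_law_def
proof (intro conjI ballI K)
  interpret prob_space P by fact
  note [measurable] = K measurable_prob_algebraD[OF K]
  have P': "distr P A X \<in> space (prob_algebra A)"
    by (auto simp: space_prob_algebra intro!: prob_space_distr)
  have K': "(\<lambda>x. distr (K x) (A \<Otimes>\<^sub>M B) (Pair x)) \<in> A \<rightarrow>\<^sub>M prob_algebra (A \<Otimes>\<^sub>M B)"
    by measurable
  fix S T assume [measurable]: "S \<in> sets A" "T \<in> sets B"
  have "emeasure P {\<omega> \<in> space P. X \<omega> \<in> S \<and> Y \<omega> \<in> T} =
      emeasure (distr P (A \<Otimes>\<^sub>M B) (\<lambda>\<omega>. (X \<omega>, Y \<omega>))) (S \<times> T)"
    by (subst emeasure_distr) (auto intro!: arg_cong[where f="emeasure P"])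
  also have "\<dots> = (\<integral>\<^sup>+ x. emeasure (distr (K x) (A \<Otimes>\<^sub>M B) (Pair x)) (S \<times> T) \<partial>distr P A X)"
    unfolding eq by (rule emeasure_bind_prob_algebra[OF P' K']) measurable
  also have "\<dots> = (\<integral>\<^sup>+ x\<in>S. emeasure (K x) T \<partial>distr P A X)"
  proof (intro nn_integral_cong)
    fix x assume "x \<in> space (distr P A X)"
    then have x: "x \<in> space A" by simp
    have [measurable_cong]: "sets (K x) = sets B" using prob_space_kernel[OF K x] by simp
    have "Pair x -` (S \<times> T) \<inter> space (K x) = (if x \<in> S then T else {})"
      using sets.sets_into_space[OF \<open>T \<in> sets B\<close>] prob_space_kernel(3)[OF K x] by auto
    then show "emeasure (distr (K x) (A \<Otimes>\<^sub>M B) (Pair x)) (S \<times> T) = emeasure (K x) T * indicator S x"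
      using x by (subst emeasure_distr) auto
  qed
  finally show "emeasure P {\<omega> \<in> space P. X \<omega> \<in> S \<and> Y \<omega> \<in> T} = \<dots>" .
qed

text \<open>X and \<phi>(X) carry the same information because \<psi> recovers the former from the
  latter. It serves to regroup the coordinates on which one conditions.\<close>

lemma is_cond_law_retract:
  assumes [measurable]: "X \<in> P \<rightarrow>\<^sub>M A" "Y \<in> P \<rightarrow>\<^sub>M B"
    and [measurable]: "\<phi> \<in> A \<rightarrow>\<^sub>M A'" "\<psi> \<in> A' \<rightarrow>\<^sub>M A"
    and inv: "\<And>x. x \<in> space A \<Longrightarrow> \<psi> (\<phi> x) = x"
    and K: "is_cond_law P (\<lambda>\<omega>. \<phi> (X \<omega>)) A' Y B K"
  shows "is_cond_law P X A Y B (\<lambda>x. K (\<phi> x))"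
  unfolding is_cond_law_def
proof (intro conjI ballI)
  note [measurable] = is_cond_lawD(1,2)[OF K]
  show "(\<lambda>x. K (\<phi> x)) \<in> A \<rightarrow>\<^sub>M prob_algebra B" by measurable
  fix S T assume S[measurable]: "S \<in> sets A" and T[measurable]: "T \<in> sets B"
  have S': "\<psi> -` S \<inter> space A' \<in> sets A'" by measurable
  have "{\<omega> \<in> space P. X \<omega> \<in> S \<and> Y \<omega> \<in> T} = {\<omega> \<in> space P. \<phi> (X \<omega>) \<in> \<psi> -` S \<inter> space A' \<and> Y \<omega> \<in> T}"
    using inv measurable_space[OF assms(1)] measurable_space[OF assms(3)] by auto
  then have "emeasure P {\<omega> \<in> space P. X \<omega> \<in> S \<and> Y \<omega> \<in> T} =
      (\<integral>\<^sup>+ x\<in>\<psi> -` S \<inter> space A'. emeasure (K x) T \<partial>distr P A' (\<lambda>\<omega>. \<phi> (X \<omega>)))"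
    using is_cond_lawD(3)[OF K S' T] by simp
  also have "\<dots> = (\<integral>\<^sup>+ x\<in>S. emeasure (K (\<phi> x)) T \<partial>distr P A X)"
    using inv measurable_space[OF assms(1)] measurable_space[OF assms(3)]
    by (subst (1 2) nn_integral_distr) (auto intro!: nn_integral_cong simp: indicator_def)
  finally show "emeasure P {\<omega> \<in> space P. X \<omega> \<in> S \<and> Y \<omega> \<in> T} = \<dots>" .
qed

text \<open>Conditioning on a constant is no conditioning. This is the case of an empty block of
  coordinates, whose only value is the undefined function.\<close>

lemma is_cond_law_const:
  assumes "prob_space P" and [measurable]: "X \<in> P \<rightarrow>\<^sub>M A" "Y \<in> P \<rightarrow>\<^sub>M B"
    and K: "is_cond_law P X A Y B K"
    and c: "\<And>\<omega>. \<omega> \<in> space P \<Longrightarrow> X \<omega> = c"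
  shows "K c = distr P B Y"
proof -
  interpret prob_space P by fact
  note [measurable] = is_cond_lawD(1,2)[OF K]
  have cA: "c \<in> space A"
    using not_empty c measurable_space[OF assms(2)] by fastforce
  show ?thesis
  proof (rule measure_eqI)
    show "sets (K c) = sets (distr P B Y)"
      using prob_space_kernel(2)[OF is_cond_lawD(1)[OF K] cA] by simp
    fix T assume "T \<in> sets (K c)"
    then have [measurable]: "T \<in> sets B"
      using prob_space_kernel(2)[OF is_cond_lawD(1)[OF K] cA] by simp
    have "emeasure (distr P B Y) T = emeasure P {\<omega> \<in> space P. X \<omega> \<in> space A \<and> Y \<omega> \<in> T}"
      using c cA by (subst emeasure_distr) (auto intro!: arg_cong[where f="emeasure P"])
    also have "\<dots> = (\<integral>\<^sup>+ x\<in>space A. emeasure (K x) T \<partial>distr P A X)"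
      by (rule is_cond_lawD(3)[OF K]) auto
    also have "\<dots> = (\<integral>\<^sup>+ \<omega>. emeasure (K (X \<omega>)) T \<partial>P)"
      using measurable_space[OF assms(2)] by (subst nn_integral_distr) (auto intro!: nn_integral_cong)
    also have "\<dots> = (\<integral>\<^sup>+ \<omega>. emeasure (K c) T \<partial>P)"
      using c by (intro nn_integral_cong) simp
    also have "\<dots> = emeasure (K c) T"
      by (simp add: emeasure_space_1)
    finally show "emeasure (K c) T = emeasure (distr P B Y) T" ..
  qed
qed

lemma measurable_restrict_coords: "J \<subseteq> I \<Longrightarrow> (\<lambda>x. restrict x J) \<in> coords I \<rightarrow>\<^sub>M coords J"
  by (rule measurable_restrict_subset)

text \<open>Induction on the index set: the empty product is a single point, and each further
  coordinate is real-valued, conditioned on X together with the coordinates already treated.\<close>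

lemma ex_cond_law_coords:
  assumes P: "prob_space P" and "finite I"
    and [measurable]: "X \<in> P \<rightarrow>\<^sub>M A"
    and "Y \<in> P \<rightarrow>\<^sub>M coords I"
  shows "\<exists>K. is_cond_law P X A Y (coords I) K"
  using assms(2,4)
proof (induction I arbitrary: Y)
  case empty
  note [measurable] = empty
  have Y: "Y \<omega> = (\<lambda>_. undefined)" if "\<omega> \<in> space P" for \<omega>
    using measurable_space[OF empty that] by (simp add: space_PiM)
  have "is_cond_law P X A Y (coords {}) (\<lambda>_. return (coords {}) (\<lambda>_. undefined))"
  proof (rule is_cond_lawI)
    show "(\<lambda>_. return (coords {}) (\<lambda>_. undefined)) \<in> A \<rightarrow>\<^sub>M prob_algebra (coords {})"
      by (rule measurable_const) (auto simp: space_prob_algebra space_PiM intro!: prob_space_return)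
  qed (auto intro!: nn_integral_cong simp: Y)
  then show ?case by blast
next
  case (insert i I)
  note [measurable] = insert.prems
  let ?Y = "\<lambda>\<omega>. restrict (Y \<omega>) I"
  have Y[measurable]: "?Y \<in> P \<rightarrow>\<^sub>M coords I"
    by (rule measurable_compose[OF insert.prems measurable_restrict_coords]) auto
  have [measurable]: "(\<lambda>\<omega>. Y \<omega> i) \<in> P \<rightarrow>\<^sub>M borel"
    by (rule measurable_compose[OF insert.prems measurable_component_singleton]) auto
  obtain K1 where K1: "is_cond_law P X A ?Y (coords I) K1"
    using insert.IH[OF Y] by blast
  obtain K2 where K2: "is_cond_law P (\<lambda>\<omega>. (X \<omega>, ?Y \<omega>)) (A \<Otimes>\<^sub>M coords I) (\<lambda>\<omega>. Y \<omega> i) borel K2"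
    using ex_cond_law_real[OF P, of "\<lambda>\<omega>. (X \<omega>, ?Y \<omega>)" "A \<Otimes>\<^sub>M coords I" "\<lambda>\<omega>. Y \<omega> i"] by auto
  let ?T = "\<lambda>(f, y). f(i := y)"
  have T: "?T \<in> coords I \<Otimes>\<^sub>M borel \<rightarrow>\<^sub>M coords (insert i I)" by (rule measurable_add_dim)
  have "is_cond_law P X A (\<lambda>\<omega>. ?T (?Y \<omega>, Y \<omega> i)) (coords (insert i I))
    (\<lambda>x. distr (K1 x \<bind> (\<lambda>b. distr (K2 (x, b)) (coords I \<Otimes>\<^sub>M borel) (Pair b))) (coords (insert i I)) ?T)"
    by (rule is_cond_law_pushforward[OF P _ _ T is_cond_law_chain[OF P _ _ _ K1 K2]]) measurable
  moreover have "?T (?Y \<omega>, Y \<omega> i) = Y \<omega>" if "\<omega> \<in> space P" for \<omega>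
    using measurable_space[OF insert.prems that]
    by (auto simp: space_PiM PiE_def extensional_def fun_eq_iff)
  ultimately show ?case
    by (subst (asm) is_cond_law_cong[where X'=X and Y'=Y]) auto
qed

lemma ex_cond_law_coords_pair:
  assumes P: "prob_space P" and I: "finite I" "finite J"
    and [measurable]: "X \<in> P \<rightarrow>\<^sub>M A" "Y \<in> P \<rightarrow>\<^sub>M coords I \<Otimes>\<^sub>M coords J"
  shows "\<exists>K. is_cond_law P X A Y (coords I \<Otimes>\<^sub>M coords J) K"
proof -
  have [measurable]: "(\<lambda>\<omega>. fst (Y \<omega>)) \<in> P \<rightarrow>\<^sub>M coords I" "(\<lambda>\<omega>. snd (Y \<omega>)) \<in> P \<rightarrow>\<^sub>M coords J"
    by measurable
  obtain K1 where K1: "is_cond_law P X A (\<lambda>\<omega>. fst (Y \<omega>)) (coords I) K1"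
    using ex_cond_law_coords[OF P I(1), of X A "\<lambda>\<omega>. fst (Y \<omega>)"] by auto
  obtain K2 where K2: "is_cond_law P (\<lambda>\<omega>. (X \<omega>, fst (Y \<omega>))) (A \<Otimes>\<^sub>M coords I) (\<lambda>\<omega>. snd (Y \<omega>)) (coords J) K2"
    using ex_cond_law_coords[OF P I(2), of "\<lambda>\<omega>. (X \<omega>, fst (Y \<omega>))" "A \<Otimes>\<^sub>M coords I" "\<lambda>\<omega>. snd (Y \<omega>)"] by auto
  show ?thesis using is_cond_law_chain[OF P _ _ _ K1 K2] by auto
qed

lemma ex_cond_law_real_pair:
  fixes Y :: "'a \<Rightarrow> real \<times> real"
  assumes P: "prob_space P"
    and [measurable]: "X \<in> P \<rightarrow>\<^sub>M A" "Y \<in> P \<rightarrow>\<^sub>M borel \<Otimes>\<^sub>M borel"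
  shows "\<exists>K. is_cond_law P X A Y (borel \<Otimes>\<^sub>M borel) K"
proof -
  have [measurable]: "(\<lambda>\<omega>. fst (Y \<omega>)) \<in> P \<rightarrow>\<^sub>M borel" "(\<lambda>\<omega>. snd (Y \<omega>)) \<in> P \<rightarrow>\<^sub>M borel"
    by measurable
  obtain K1 where K1: "is_cond_law P X A (\<lambda>\<omega>. fst (Y \<omega>)) borel K1"
    using ex_cond_law_real[OF P, of X A "\<lambda>\<omega>. fst (Y \<omega>)"] by auto
  obtain K2 where K2: "is_cond_law P (\<lambda>\<omega>. (X \<omega>, fst (Y \<omega>))) (A \<Otimes>\<^sub>M borel) (\<lambda>\<omega>. snd (Y \<omega>)) borel K2"
    using ex_cond_law_real[OF P, of "\<lambda>\<omega>. (X \<omega>, fst (Y \<omega>))" "A \<Otimes>\<^sub>M borel" "\<lambda>\<omega>. snd (Y \<omega>)"] by auto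
  show ?thesis using is_cond_law_chain[OF P _ _ _ K1 K2] by auto
qed

section \<open>Restriction, evaluation and update for pairs of paths\<close>

abbreviation pcoords :: "nat set \<Rightarrow> path_pair measure" where
  "pcoords I \<equiv> coords I \<Otimes>\<^sub>M coords I"

definition prestrict :: "path_pair \<Rightarrow> nat set \<Rightarrow> path_pair" where
  "prestrict \<omega> I = (restrict (fst \<omega>) I, restrict (snd \<omega>) I)"

definition pstep :: "path_pair \<Rightarrow> nat \<Rightarrow> real \<times> real" where
  "pstep \<omega> t = (fst \<omega> t, snd \<omega> t)"

definition pupd :: "path_pair \<Rightarrow> nat \<Rightarrow> real \<times> real \<Rightarrow> path_pair" where
  "pupd \<omega> t z = ((fst \<omega>)(t := fst z), (snd \<omega>)(t := snd z))"

lemma measurable_prestrict: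
  assumes "J \<subseteq> I"
  shows "(\<lambda>\<omega>. prestrict \<omega> J) \<in> pcoords I \<rightarrow>\<^sub>M pcoords J"
proof -
  note [measurable] = measurable_restrict_coords[OF assms]
  show ?thesis unfolding prestrict_def by measurable
qed

lemma measurable_pstep:
  assumes "t \<in> I"
  shows "(\<lambda>\<omega>. pstep \<omega> t) \<in> pcoords I \<rightarrow>\<^sub>M borel \<Otimes>\<^sub>M borel"
proof -
  note [measurable] = measurable_component_singleton[OF assms, of "\<lambda>_. borel :: real measure"]
  show ?thesis unfolding pstep_def by measurable
qed

lemma measurable_coords_upd:
  assumes "insert t I = J" "f \<in> M \<rightarrow>\<^sub>M coords I" "g \<in> M \<rightarrow>\<^sub>M borel"
  shows "(\<lambda>\<omega>. (f \<omega>)(t := g \<omega>)) \<in> M \<rightarrow>\<^sub>M coords J"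
proof -
  note [measurable] = assms(2,3)
  have "(\<lambda>\<omega>. case (f \<omega>, g \<omega>) of (f, y) \<Rightarrow> f(t := y)) \<in> M \<rightarrow>\<^sub>M coords (insert t I)"
    by (rule measurable_compose[OF _ measurable_add_dim]) measurable
  then show ?thesis using assms(1) by simp
qed

lemma measurable_pupd:
  assumes "insert t I = J" "f \<in> M \<rightarrow>\<^sub>M pcoords I" "g \<in> M \<rightarrow>\<^sub>M borel \<Otimes>\<^sub>M borel"
  shows "(\<lambda>\<omega>. pupd (f \<omega>) t (g \<omega>)) \<in> M \<rightarrow>\<^sub>M pcoords J"
proof -
  note [measurable] = assms(2,3)
  show ?thesis unfolding pupd_def
    by (intro measurable_Pair measurable_coords_upd[OF assms(1)]) measurable
qed

text \<open>Outside I all points of the product take the same value \<open>undefined\<close>, so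
  every coordinate map is measurable. Together with restriction as left inverse this gives the
  embeddings that \<open>is_cond_law_unique\<close> asks for.\<close>

lemma measurable_id_coords_borel: "(\<lambda>x. x) \<in> coords I \<rightarrow>\<^sub>M (borel :: (nat \<Rightarrow> real) measure)"
proof (rule measurable_coordinatewise_then_product)
  fix i
  show "(\<lambda>x. x i) \<in> borel_measurable (coords I)"
  proof (cases "i \<in> I")
    case False
    then have "(\<lambda>x. x i) \<in> borel_measurable (coords I) \<longleftrightarrow> (\<lambda>x. undefined :: real) \<in> borel_measurable (coords I)"
      by (intro measurable_cong) (auto simp: space_PiM PiE_def extensional_def)
    then show ?thesis by simp
  qed (rule measurable_component_singleton)
qed

lemma measurable_restrict_borel_coords: "(\<lambda>x :: nat \<Rightarrow> real. restrict x I) \<in> borel \<rightarrow>\<^sub>M coords I"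
  by (rule measurable_restrict) simp

lemma prestrict_id: "\<omega> \<in> space (pcoords I) \<Longrightarrow> prestrict \<omega> I = \<omega>"
  by (cases \<omega>) (auto simp: prestrict_def space_pair_measure space_PiM)

lemma measurable_id_pcoords_borel: "(\<lambda>\<omega>. \<omega>) \<in> pcoords I \<rightarrow>\<^sub>M borel"
proof -
  note [measurable] = measurable_id_coords_borel[of I]
  have "(\<lambda>\<omega>. (fst \<omega>, snd \<omega>)) \<in> pcoords I \<rightarrow>\<^sub>M borel \<Otimes>\<^sub>M borel"
    by (intro measurable_Pair measurable_compose[OF measurable_fst measurable_id_coords_borel]
        measurable_compose[OF measurable_snd measurable_id_coords_borel])
  then show ?thesis by (simp add: borel_prod)
qed

lemma measurable_prestrict_borel: "(\<lambda>\<omega>. prestrict \<omega> I) \<in> borel \<rightarrow>\<^sub>M pcoords I"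
proof -
  have "(\<lambda>\<omega>. prestrict \<omega> I) \<in> borel \<Otimes>\<^sub>M borel \<rightarrow>\<^sub>M pcoords I"
    unfolding prestrict_def
    by (intro measurable_Pair measurable_compose[OF measurable_fst measurable_restrict_borel_coords]
        measurable_compose[OF measurable_snd measurable_restrict_borel_coords])
  then show ?thesis by (simp add: borel_prod)
qed

section \<open>The nested functional and conditional laws\<close>

lemma pair_step_law_eq:
  "pair_step_law \<gamma> t = cond_law \<gamma> (\<lambda>\<omega>. prestrict \<omega> {1..t}) (pcoords {1..t})
     (\<lambda>\<omega>. pstep \<omega> (Suc t)) (borel \<Otimes>\<^sub>M borel)"
  unfolding pair_step_law_def prestrict_def pstep_def by (simp add: split_beta')

lemma first_law_eq: "first_law t \<gamma> = distr \<gamma> (borel \<Otimes>\<^sub>M borel) (\<lambda>\<omega>. pstep \<omega> (Suc t))"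
  unfolding first_law_def pstep_def by (simp add: split_beta')

lemma rest_law_eq:
  "rest_law N t \<gamma> = cond_law \<gamma> (\<lambda>\<omega>. pstep \<omega> (Suc t)) (borel \<Otimes>\<^sub>M borel)
     (\<lambda>\<omega>. prestrict \<omega> {Suc (Suc t)..N}) (pcoords {Suc (Suc t)..N})"
  unfolding rest_law_def prestrict_def pstep_def by (simp add: split_beta')

lemma measurable_cost [measurable]: "cost p \<in> borel_measurable (subprob_algebra (borel \<Otimes>\<^sub>M borel))"
proof -
  have [measurable]: "(\<lambda>\<pi>. \<integral>\<^sup>+ z. ennreal (\<bar>fst z - snd z\<bar> powr p) \<partial>\<pi>) \<in> borel_measurable (subprob_algebra (borel \<Otimes>\<^sub>M borel))"
    by (rule nn_integral_measurable_subprob_algebra) measurable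
  show ?thesis unfolding cost_def Let_def split_beta' by measurable
qed

lemma cost_le_iff:
  assumes "1 \<le> p" "0 \<le> r"
  shows "cost p \<pi> \<le> ennreal r \<longleftrightarrow> (\<integral>\<^sup>+ z. ennreal (\<bar>fst z - snd z\<bar> powr p) \<partial>\<pi>) \<le> ennreal (r powr p)"
proof (cases "\<integral>\<^sup>+ z. ennreal (\<bar>fst z - snd z\<bar> powr p) \<partial>\<pi>")
  case (real c)
  have "c powr (1 / p) \<le> r \<longleftrightarrow> c \<le> r powr p"
  proof
    assume "c powr (1 / p) \<le> r"
    then have "(c powr (1 / p)) powr p \<le> r powr p" using assms by (intro powr_mono2) auto
    then show "c \<le> r powr p" using assms real by (simp add: powr_powr)
  next
    assume "c \<le> r powr p"
    then have "c powr (1 / p) \<le> (r powr p) powr (1 / p)" using assms real by (intro powr_mono2) auto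
    then show "c powr (1 / p) \<le> r" using assms by (simp add: powr_powr)
  qed
  then show ?thesis using assms real by (simp add: cost_def split_beta')
next
  case top
  then show ?thesis using assms by (simp add: cost_def split_beta' top_unique)
qed

lemma cost_less_iff:
  assumes "1 \<le> p" "0 < \<delta>"
  shows "cost p \<pi> < ennreal \<delta> \<longleftrightarrow> (\<integral>\<^sup>+ z. ennreal (\<bar>fst z - snd z\<bar> powr p) \<partial>\<pi>) < ennreal (\<delta> powr p)"
proof (cases "\<integral>\<^sup>+ z. ennreal (\<bar>fst z - snd z\<bar> powr p) \<partial>\<pi>")
  case (real c)
  have "c powr (1 / p) < \<delta> \<longleftrightarrow> c < \<delta> powr p"
  proof
    assume "c powr (1 / p) < \<delta>"
    then have "(c powr (1 / p)) powr p < \<delta> powr p" using assms by (intro powr_less_mono2) auto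
    then show "c < \<delta> powr p" using assms real by (simp add: powr_powr)
  next
    assume "c < \<delta> powr p"
    then have "c powr (1 / p) < (\<delta> powr p) powr (1 / p)" using assms real by (intro powr_less_mono2) auto
    then show "c powr (1 / p) < \<delta>" using assms by (simp add: powr_powr)
  qed
  then show ?thesis using assms real by (simp add: cost_def split_beta' ennreal_less_iff)
next
  case top
  then show ?thesis using assms by (simp add: cost_def split_beta')
qed

text \<open>The infimum in \<open>Linf_norm\<close> is attained: along a sequence of essential
  bounds converging to it only countably many null sets occur.\<close>

lemma Linf_norm_le_iff: "Linf_norm M g \<le> r \<longleftrightarrow> (AE z in M. g z \<le> r)"
proof
  assume "AE z in M. g z \<le> r"
  then show "Linf_norm M g \<le> r" unfolding Linf_norm_def by (intro Inf_lower) simp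
next
  let ?C = "{c. AE z in M. g z \<le> c}"
  assume le: "Linf_norm M g \<le> r"
  have "\<top> \<in> ?C" by simp
  then obtain c where c: "\<And>n::nat. c n \<in> ?C" "c \<longlonglongrightarrow> Inf ?C"
    using Inf_as_limit[of ?C] by blast
  then have "AE z in M. \<forall>n. g z \<le> c n" by (auto simp: AE_all_countable)
  then show "AE z in M. g z \<le> r"
  proof eventually_elim
    case (elim z)
    then have "g z \<le> Inf ?C" by (intro LIMSEQ_le_const[OF c(2)]) auto
    then show ?case using le by (simp add: Linf_norm_def)
  qed
qed

text \<open>By uniqueness of conditional laws, the nested conditional laws in the recursive definition
  of \<open>F_functional\<close> agree with the conditional laws \<open>k s\<close> of the whole measure.\<close>

lemma F_functional_le_iff:
  fixes k :: "nat \<Rightarrow> path_pair \<Rightarrow> (real \<times> real) measure"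
  assumes "prob_space \<gamma>" "sets \<gamma> = sets (pcoords {Suc t..N})" "t \<le> N"
    and "\<And>s. t \<le> s \<Longrightarrow> s < N \<Longrightarrow>
      is_cond_law \<gamma> (\<lambda>\<omega>. prestrict \<omega> {Suc t..s}) (pcoords {Suc t..s})
        (\<lambda>\<omega>. pstep \<omega> (Suc s)) (borel \<Otimes>\<^sub>M borel) (k s)"
  shows "F_functional p N t \<gamma> \<le> r \<longleftrightarrow>
    (\<forall>s\<in>{t..<N}. AE \<omega> in \<gamma>. cost p (k s (prestrict \<omega> {Suc t..s})) \<le> r)"
  using assms
proof (induction "N - t" arbitrary: t \<gamma> k)
  case 0
  then show ?case by (simp add: F_functional.simps)
next
  case (Suc n)
  then have tN: "t < N" by simp
  note P = Suc.prems(1) and sets[measurable_cong] = Suc.prems(2) and k = Suc.prems(4)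
  interpret prob_space \<gamma> by (rule P)
  let ?R = "rest_law N t \<gamma>" and ?B = "borel \<Otimes>\<^sub>M borel :: (real \<times> real) measure"
  let ?I = "\<lambda>s. {Suc (Suc t)..s}"
  let ?Y = "\<lambda>\<omega>. pstep \<omega> (Suc t)"
  let ?Z = "\<lambda>\<omega>. prestrict \<omega> (?I N)"
  \<comment> \<open>Writing the pair z in front of the block w restores a block that starts at label
    t + 1, so \<open>k' z s\<close> is \<open>k s\<close> with its first pair frozen at z.\<close>
  define k' where "k' z s w = k s (pupd w (Suc t) z)" for z s w
  have mr: "(\<lambda>\<omega>. prestrict \<omega> J) \<in> \<gamma> \<rightarrow>\<^sub>M pcoords J" if "J \<subseteq> {Suc t..N}" for J
    unfolding measurable_cong_sets[OF sets refl] by (rule measurable_prestrict[OF that])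
  have ms: "(\<lambda>\<omega>. pstep \<omega> s) \<in> \<gamma> \<rightarrow>\<^sub>M ?B" if "s \<in> {Suc t..N}" for s
    unfolding measurable_cong_sets[OF sets refl] by (rule measurable_pstep[OF that])
  have Y[measurable]: "?Y \<in> \<gamma> \<rightarrow>\<^sub>M ?B" using tN by (intro ms) auto
  have Z[measurable]: "?Z \<in> \<gamma> \<rightarrow>\<^sub>M pcoords (?I N)" by (intro mr) auto
  have R: "is_cond_law \<gamma> ?Y ?B ?Z (pcoords (?I N)) ?R"
    unfolding rest_law_eq using ex_cond_law_coords_pair[OF P _ _ Y Z] is_cond_law_cond_law by auto
  note [measurable] = is_cond_lawD(1,2)[OF R]
  have Rk: "prob_space (?R z)" "sets (?R z) = sets (pcoords (?I N))" "space (?R z) = space (pcoords (?I N))" for z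
    using prob_space_kernel[OF is_cond_lawD(1)[OF R], of z] by (auto simp: space_pair_measure)
  have km[measurable]: "k s \<in> pcoords {Suc t..s} \<rightarrow>\<^sub>M prob_algebra ?B" if "t \<le> s" "s < N" for s
    by (rule is_cond_lawD(1)[OF k[OF that]])
  have cond: "AE z in distr \<gamma> ?B ?Y. \<forall>s. Suc t \<le> s \<longrightarrow> s < N \<longrightarrow>
      is_cond_law (?R z) (\<lambda>w. prestrict w (?I s)) (pcoords (?I s)) (\<lambda>w. pstep w (Suc s)) ?B (k' z s)"
  proof (subst AE_all_countable, intro allI)
    fix s
    show "AE z in distr \<gamma> ?B ?Y. Suc t \<le> s \<longrightarrow> s < N \<longrightarrow>
      is_cond_law (?R z) (\<lambda>w. prestrict w (?I s)) (pcoords (?I s)) (\<lambda>w. pstep w (Suc s)) ?B (k' z s)"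
    proof (cases "Suc t \<le> s \<and> s < N")
      case False
      then show ?thesis by (intro AE_I2) auto
    next
      case True
      then have s: "Suc t \<le> s" "s < N" by auto
      let ?A = "pcoords (?I s)"
      have X[measurable]: "(\<lambda>w. prestrict w (?I s)) \<in> pcoords (?I N) \<rightarrow>\<^sub>M ?A"
        using s by (intro measurable_prestrict) auto
      have S[measurable]: "(\<lambda>w. pstep w (Suc s)) \<in> pcoords (?I N) \<rightarrow>\<^sub>M ?B"
        using s by (intro measurable_pstep) auto
      have X\<gamma>[measurable]: "(\<lambda>w. prestrict w (?I s)) \<in> \<gamma> \<rightarrow>\<^sub>M ?A" using s by (intro mr) auto
      have S\<gamma>[measurable]: "(\<lambda>w. pstep w (Suc s)) \<in> \<gamma> \<rightarrow>\<^sub>M ?B" using s by (intro ms) auto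
      have XZ: "prestrict (?Z \<omega>) (?I s) = prestrict \<omega> (?I s)" and SZ: "pstep (?Z \<omega>) (Suc s) = pstep \<omega> (Suc s)" for \<omega>
        using s by (auto simp: prestrict_def pstep_def fun_eq_iff)
      have "is_cond_law \<gamma> ?Y ?B (\<lambda>\<omega>. prestrict (?Z \<omega>) (?I s)) ?A (\<lambda>z. distr (?R z) ?A (\<lambda>w. prestrict w (?I s)))"
        by (rule is_cond_law_pushforward[OF P Y Z X R])
      then have 1: "is_cond_law \<gamma> ?Y ?B (\<lambda>\<omega>. prestrict \<omega> (?I s)) ?A (\<lambda>z. distr (?R z) ?A (\<lambda>w. prestrict w (?I s)))"
        unfolding XZ .
      \<comment> \<open>The past up to s is regrouped into its first pair and the remaining
        block.\<close>
      have 2: "is_cond_law \<gamma> (\<lambda>\<omega>. (?Y \<omega>, prestrict \<omega> (?I s))) (?B \<Otimes>\<^sub>M ?A) (\<lambda>\<omega>. pstep \<omega> (Suc s)) ?B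
          (\<lambda>x. k s ((\<lambda>(z, w). pupd w (Suc t) z) x))"
      proof (rule is_cond_law_retract[where A'="pcoords {Suc t..s}" and \<psi>="\<lambda>w. (pstep w (Suc t), prestrict w (?I s))"])
        show "(\<lambda>(z, w). pupd w (Suc t) z) \<in> ?B \<Otimes>\<^sub>M ?A \<rightarrow>\<^sub>M pcoords {Suc t..s}"
          unfolding split_beta' using s by (intro measurable_pupd[of _ "?I s"]) auto
        show "(\<lambda>w. (pstep w (Suc t), prestrict w (?I s))) \<in> pcoords {Suc t..s} \<rightarrow>\<^sub>M ?B \<Otimes>\<^sub>M ?A"
          using s by (intro measurable_Pair measurable_pstep measurable_prestrict) auto
        show "(pstep (case x of (z, w) \<Rightarrow> pupd w (Suc t) z) (Suc t), prestrict (case x of (z, w) \<Rightarrow> pupd w (Suc t) z) (?I s)) = x"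
          if "x \<in> space (?B \<Otimes>\<^sub>M ?A)" for x
        proof -
          obtain a b u v where x: "x = ((a, b), (u, v))" by (metis surj_pair)
          have "u \<in> space (coords (?I s))" "v \<in> space (coords (?I s))" using that by (auto simp: x space_pair_measure)
          then have "restrict (u(Suc t := a)) (?I s) = u" "restrict (v(Suc t := b)) (?I s) = v"
            by (auto simp: space_PiM PiE_def extensional_def fun_eq_iff)
          then show ?thesis by (simp add: x pstep_def pupd_def prestrict_def)
        qed
        have "pupd (prestrict \<omega> (?I s)) (Suc t) (?Y \<omega>) = prestrict \<omega> {Suc t..s}" for \<omega>
          using s by (auto simp: pstep_def pupd_def prestrict_def fun_eq_iff)
        then show "is_cond_law \<gamma> (\<lambda>\<omega>. case (?Y \<omega>, prestrict \<omega> (?I s)) of (z, w) \<Rightarrow> pupd w (Suc t) z)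
          (pcoords {Suc t..s}) (\<lambda>\<omega>. pstep \<omega> (Suc s)) ?B (k s)"
          using k[of s] s by simp
      qed measurable
      \<comment> \<open>A second expression for the same conditional law given the first pair, now
        read off from the rest law. Comparing it with the chain of the two preceding kernels
        identifies the conditional laws inside \<open>?R z\<close>.\<close>
      have 3: "is_cond_law \<gamma> ?Y ?B (\<lambda>\<omega>. (prestrict \<omega> (?I s), pstep \<omega> (Suc s))) (?A \<Otimes>\<^sub>M ?B)
          (\<lambda>z. distr (?R z) (?A \<Otimes>\<^sub>M ?B) (\<lambda>w. (prestrict w (?I s), pstep w (Suc s))))"
        using is_cond_law_pushforward[OF P Y Z _ R, of "\<lambda>w. (prestrict w (?I s), pstep w (Suc s))" "?A \<Otimes>\<^sub>M ?B"]
        by (simp add: XZ SZ)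
      have e: "(\<lambda>x. x) \<in> ?A \<Otimes>\<^sub>M ?B \<rightarrow>\<^sub>M (borel :: (path_pair \<times> (real \<times> real)) measure)"
      proof -
        have "(\<lambda>x. (fst x, snd x)) \<in> ?A \<Otimes>\<^sub>M ?B \<rightarrow>\<^sub>M (borel :: path_pair measure) \<Otimes>\<^sub>M (borel :: (real \<times> real) measure)"
          by (intro measurable_Pair measurable_compose[OF measurable_fst measurable_id_pcoords_borel]
              measurable_compose[OF measurable_snd]) (simp add: borel_prod)
        then show ?thesis by (simp add: borel_prod)
      qed
      have d: "(\<lambda>x. (prestrict (fst x) (?I s), snd x)) \<in> (borel :: (path_pair \<times> (real \<times> real)) measure) \<rightarrow>\<^sub>M ?A \<Otimes>\<^sub>M ?B"
      proof -
        have "(\<lambda>x. (prestrict (fst x) (?I s), snd x)) \<in> (borel :: path_pair measure) \<Otimes>\<^sub>M (borel :: (real \<times> real) measure) \<rightarrow>\<^sub>M ?A \<Otimes>\<^sub>M ?B"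
          by (intro measurable_Pair measurable_compose[OF measurable_fst measurable_prestrict_borel]
              measurable_compose[OF measurable_snd]) (simp add: borel_prod)
        then show ?thesis by (simp add: borel_prod)
      qed
      have "AE z in distr \<gamma> ?B ?Y. distr (?R z) (?A \<Otimes>\<^sub>M ?B) (\<lambda>w. (prestrict w (?I s), pstep w (Suc s))) =
        distr (?R z) ?A (\<lambda>w. prestrict w (?I s)) \<bind>
          (\<lambda>b. distr (k s ((\<lambda>(z, w). pupd w (Suc t) z) (z, b))) (?A \<Otimes>\<^sub>M ?B) (Pair b))"
        by (rule is_cond_law_unique[OF P Y _ 3 is_cond_law_chain[OF P Y X\<gamma> S\<gamma> 1 2] e d])
          (auto simp: space_pair_measure prestrict_id)
      then show ?thesis
      proof eventually_elim
        case (elim z)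
        show ?case
        proof (intro impI is_cond_law_if_distr_bind Rk)
          show "k' z s \<in> ?A \<rightarrow>\<^sub>M prob_algebra ?B"
            unfolding k'_def using s
            by (intro measurable_compose[OF _ km] measurable_pupd[of _ "?I s"] measurable_const)
              (auto simp: space_pair_measure)
        qed (use elim in \<open>auto simp: k'_def measurable_cong_sets[OF Rk(2) refl]\<close>)
      qed
    qed
  qed
  have mQ: "Measurable.pred (?B \<Otimes>\<^sub>M pcoords (?I N)) (\<lambda>(z, w). cost p (k' z s (prestrict w (?I s))) \<le> r)"
    if "Suc t \<le> s" "s < N" for s
  proof -
    have "(\<lambda>x. k s (pupd (prestrict (snd x) (?I s)) (Suc t) (fst x))) \<in> ?B \<Otimes>\<^sub>M pcoords (?I N) \<rightarrow>\<^sub>M prob_algebra ?B"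
      using that
      by (intro measurable_compose[OF _ km] measurable_pupd[of _ "?I s"]
          measurable_compose[OF measurable_snd measurable_prestrict]) auto
    note [measurable] = measurable_prob_algebraD[OF this]
    show ?thesis unfolding k'_def split_beta' by measurable
  qed
  have IH: "AE z in distr \<gamma> ?B ?Y. F_functional p N (Suc t) (?R z) \<le> r \<longleftrightarrow>
      (\<forall>s\<in>{Suc t..<N}. AE w in ?R z. cost p (k' z s (prestrict w (?I s))) \<le> r)"
    using cond
  proof eventually_elim
    case (elim z)
    show ?case
      using Suc.hyps(2) tN elim by (intro Suc.hyps(1) Rk) auto
  qed
  have "F_functional p N t \<gamma> \<le> r \<longleftrightarrow>
      cost p (first_law t \<gamma>) \<le> r \<and> (AE z in distr \<gamma> ?B ?Y. F_functional p N (Suc t) (?R z) \<le> r)"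
    using tN by (subst F_functional.simps) (simp add: Linf_norm_le_iff first_law_eq)
  also have "(AE z in distr \<gamma> ?B ?Y. F_functional p N (Suc t) (?R z) \<le> r) \<longleftrightarrow>
      (AE z in distr \<gamma> ?B ?Y. \<forall>s\<in>{Suc t..<N}. AE w in ?R z. cost p (k' z s (prestrict w (?I s))) \<le> r)"
    using IH by (auto elim: eventually_elim2)
  also have "\<dots> \<longleftrightarrow> (\<forall>s\<in>{Suc t..<N}. AE z in distr \<gamma> ?B ?Y. AE w in ?R z. cost p (k' z s (prestrict w (?I s))) \<le> r)"
    by (rule AE_ball_countable) auto
  \<comment> \<open>Almost every z, and then almost every w under the rest law of z, amounts to
    almost every path under \<gamma>.\<close>
  also have "\<dots> \<longleftrightarrow> (\<forall>s\<in>{Suc t..<N}. AE \<omega> in \<gamma>. cost p (k s (prestrict \<omega> {Suc t..s})) \<le> r)"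
  proof (intro ball_cong refl)
    fix s assume "s \<in> {Suc t..<N}"
    then have s: "Suc t \<le> s" "s < N" by auto
    note [measurable] = mQ[OF s]
    have [measurable]: "Measurable.pred ?B (\<lambda>z. AE w in ?R z. cost p (k' z s (prestrict w (?I s))) \<le> r)"
    proof -
      have "(AE w in ?R z. cost p (k' z s (prestrict w (?I s))) \<le> r) \<longleftrightarrow>
          (\<integral>\<^sup>+ w. indicator {x. \<not> (case x of (z, w) \<Rightarrow> cost p (k' z s (prestrict w (?I s))) \<le> r)} (z, w) \<partial>?R z) = 0" for z
      proof -
        have "(\<lambda>x. indicator {x. \<not> (case x of (z, w) \<Rightarrow> cost p (k' z s (prestrict w (?I s))) \<le> r)} x :: ennreal)
            \<in> borel_measurable (?B \<Otimes>\<^sub>M pcoords (?I N))"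
          by measurable
        from measurable_compose[OF measurable_Pair1' this, of z]
        have "(\<lambda>w. indicator {x. \<not> (case x of (z, w) \<Rightarrow> cost p (k' z s (prestrict w (?I s))) \<le> r)} (z, w) :: ennreal)
            \<in> borel_measurable (?R z)"
          unfolding measurable_cong_sets[OF Rk(2) refl] by (simp add: space_pair_measure)
        then show ?thesis by (subst nn_integral_0_iff_AE) (auto simp: indicator_def)
      qed
      moreover have "(\<lambda>z. \<integral>\<^sup>+ w. indicator {x. \<not> (case x of (z, w) \<Rightarrow> cost p (k' z s (prestrict w (?I s))) \<le> r)} (z, w) \<partial>?R z)
          \<in> borel_measurable ?B"
        by (rule nn_integral_measurable_subprob_algebra2[where N="pcoords (?I N)"]) measurable
      ultimately show ?thesis by simp
    qed
    have "(AE z in distr \<gamma> ?B ?Y. AE w in ?R z. cost p (k' z s (prestrict w (?I s))) \<le> r) \<longleftrightarrow>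
        (AE \<omega> in \<gamma>. AE w in ?R (?Y \<omega>). cost p (k' (?Y \<omega>) s (prestrict w (?I s))) \<le> r)"
      by (rule AE_distr_iff) measurable
    also have "\<dots> \<longleftrightarrow> (AE \<omega> in \<gamma>. cost p (k' (?Y \<omega>) s (prestrict (?Z \<omega>) (?I s))) \<le> r)"
      using is_cond_law_AE_iff[OF P Y Z R mQ[OF s]] by simp
    also have "\<dots> \<longleftrightarrow> (AE \<omega> in \<gamma>. cost p (k s (prestrict \<omega> {Suc t..s})) \<le> r)"
    proof -
      have "pupd (prestrict (?Z \<omega>) (?I s)) (Suc t) (?Y \<omega>) = prestrict \<omega> {Suc t..s}" for \<omega>
        using s by (auto simp: pstep_def pupd_def prestrict_def fun_eq_iff)
      then show ?thesis by (simp add: k'_def)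
    qed
    finally show "(AE z in distr \<gamma> ?B ?Y. AE w in ?R z. cost p (k' z s (prestrict w (?I s))) \<le> r) \<longleftrightarrow> \<dots>" .
  qed
  \<comment> \<open>The block of labels from t + 1 to t is empty, so at s = t the kernel is
    evaluated at a constant and equals the law of the first pair.\<close>
  also have "cost p (first_law t \<gamma>) \<le> r \<longleftrightarrow> (AE \<omega> in \<gamma>. cost p (k t (prestrict \<omega> {Suc t..t})) \<le> r)"
  proof -
    have c: "prestrict \<omega> {Suc t..t} = (\<lambda>_. undefined, \<lambda>_. undefined)" for \<omega>
      by (auto simp: prestrict_def)
    have "k t (\<lambda>_. undefined, \<lambda>_. undefined) = first_law t \<gamma>"
      unfolding first_law_eq
      by (rule is_cond_law_const[OF P mr Y k[OF order_refl tN]]) (use tN c in auto)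
    then show ?thesis unfolding c by simp
  qed
  moreover have "(\<forall>s\<in>{t..<N}. Q s) \<longleftrightarrow> Q t \<and> (\<forall>s\<in>{Suc t..<N}. Q s)" for Q :: "nat \<Rightarrow> bool"
  proof -
    have S: "{t..<N} = insert t {Suc t..<N}" using tN by auto
    show ?thesis unfolding S by blast
  qed
  ultimately show ?case by (simp only:)
qed

section \<open>A countable family of transports\<close>

text \<open>Rational step functions on finite unions of basic open sets: outer regularity replaces a
  measurable set by an open one, and continuity from below replaces that by a finite union. The
  family is fixed before the measure Q is given, which is what allows one family of transports for
  all kernels.\<close>

lemma ex_countable_L1_dense:
  obtains d :: "nat \<Rightarrow> 'a::polish_space \<Rightarrow> real"
  where "\<And>i. d i \<in> borel_measurable borel"
    and "\<And>Q h e. finite_measure Q \<Longrightarrow> sets Q = sets borel \<Longrightarrow> integrable Q h \<Longrightarrow> 0 < e \<Longrightarrow>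
      \<exists>i. (\<integral>\<^sup>+ x. ennreal \<bar>h x - d i x\<bar> \<partial>Q) < ennreal e"
proof -
  obtain B :: "'a set set" where B: "countable B" "topological_basis B"
    using ex_countable_basis by blast
  have Bopen: "open b" if "b \<in> B" for b using B(2) that by (rule topological_basis_open)
  have Bne: "B \<noteq> {}"
  proof
    assume "B = {}"
    then show False using topological_basisE[OF B(2) open_UNIV UNIV_I] by blast
  qed
  let ?b = "from_nat_into B"
  have bopen: "open (?b k)" for k using Bopen from_nat_into[OF Bne] by auto
  define U where "U ns = (\<Union>k\<in>set ns. ?b k)" for ns
  have [measurable]: "U ns \<in> sets borel" for ns unfolding U_def using bopen by auto
  \<comment> \<open>Coding by lists makes the family countable, and appending lists adds the
    functions.\<close>
  define D :: "(rat \<times> nat list) list \<Rightarrow> 'a \<Rightarrow> real"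
    where "D l x = (\<Sum>(q, ns)\<leftarrow>l. of_rat q * indicator (U ns) x)" for l x
  have D_meas[measurable]: "D l \<in> borel_measurable borel" for l
  proof (induction l)
    case (Cons z l)
    have "D (z # l) = (\<lambda>x. of_rat (fst z) * indicator (U (snd z)) x + D l x)"
      by (auto simp: D_def split: prod.splits)
    then show ?case using Cons by simp
  qed (simp add: D_def[abs_def])
  have D_append: "D (l @ l') x = D l x + D l' x" for l l' x
    by (simp add: D_def)
  show thesis
  proof
    show "D (from_nat i) \<in> borel_measurable borel" for i by measurable
    fix Q :: "'a measure" and h :: "'a \<Rightarrow> real" and e :: real
    assume Q: "finite_measure Q" and sQ[measurable_cong]: "sets Q = sets borel"
      and h: "integrable Q h" and e: "0 < e"
    interpret finite_measure Q by fact
    have sp: "space Q = UNIV" using sets_eq_imp_space_eq[OF sQ] by simp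
    from h e have "\<exists>l. (\<integral>\<^sup>+ x. ennreal \<bar>h x - D l x\<bar> \<partial>Q) < ennreal e"
    proof (induction arbitrary: e rule: integrable_induct)
      case (base A c)
      have A[measurable]: "A \<in> sets borel" using base sQ by simp
      define m where "m = measure Q (space Q)"
      have m: "emeasure Q A \<le> ennreal m" for A
        unfolding m_def by (simp add: emeasure_eq_measure bounded_measure)
      have m0: "0 \<le> m" by (simp add: m_def)
      \<comment> \<open>On a space of mass m the error from replacing c by a rational integrates to
        at most e / 2.\<close>
      obtain q :: rat where q': "c < of_rat q" "of_rat q < c + e / (2 * (m + 1))"
        using of_rat_dense[of c "c + e / (2 * (m + 1))"] base.prems m0 by auto
      define c' where "c' = real_of_rat q"
      have q: "c < c'" "c' < c + e / (2 * (m + 1))" using q' by (auto simp: c'_def)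
      \<comment> \<open>Two set differences of measure below e', weighted by the rational
        coefficient, contribute at most e / 4 together.\<close>
      define e' where "e' = e / (8 * (\<bar>c'\<bar> + 1))"
      have e': "0 < e'" using base.prems unfolding e'_def by (intro divide_pos_pos mult_pos_pos add_nonneg_pos) auto
      have "emeasure Q A = (INF U\<in>{U. A \<subseteq> U \<and> open U}. emeasure Q U)"
        by (rule outer_regular[OF sQ]) (auto simp: emeasure_finite)
      moreover have "emeasure Q A < emeasure Q A + ennreal e'"
        using e' by (simp add: emeasure_eq_measure ennreal_less_iff flip: ennreal_plus)
      ultimately obtain W where W: "A \<subseteq> W" "open W" "emeasure Q W < emeasure Q A + ennreal e'"
        by (auto simp: INF_less_iff)
      have [measurable]: "W \<in> sets borel" using W by auto
      \<comment> \<open>The basic open sets contained in W exhaust W; the unions over the first n of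
        them belong to the family.\<close>
      define V where "V n = (\<Union>k\<in>{k. k < n \<and> ?b k \<subseteq> W}. ?b k)" for n
      have V_U: "V n = U (filter (\<lambda>k. ?b k \<subseteq> W) [0..<n])" for n
        by (auto simp: V_def U_def)
      have Vm[measurable]: "V n \<in> sets borel" for n unfolding V_U by measurable
      have "range V \<subseteq> sets Q" unfolding sQ using Vm by blast
      moreover have "(\<Union>n. V n) = W"
      proof (intro antisym subsetI)
        fix x assume "x \<in> W"
        then obtain B' where B': "B' \<in> B" "x \<in> B'" "B' \<subseteq> W"
          using topological_basisE[OF B(2) W(2)] by blast
        then obtain k where "B' = ?b k" using from_nat_into_surj[OF B(1)] by metis
        then have "x \<in> V (Suc k)" using B' by (auto simp: V_def)
        then show "x \<in> (\<Union>n. V n)" by blast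
      qed (auto simp: V_def)
      moreover have "incseq V" unfolding V_def by (intro incseq_SucI UN_mono) auto
      ultimately have "(\<lambda>n. emeasure Q (V n)) \<longlonglongrightarrow> emeasure Q W"
        using Lim_emeasure_incseq[of V Q] by metis
      then have "(\<lambda>n. measure Q (V n)) \<longlonglongrightarrow> measure Q W"
        by (simp add: emeasure_eq_measure)
      then have "\<forall>\<^sub>F n in sequentially. measure Q W - e' < measure Q (V n)"
        using e' by (intro order_tendstoD) auto
      then obtain n where n: "measure Q W - e' < measure Q (V n)"
        by (auto simp: eventually_sequentially)
      have VW: "V n \<subseteq> W" by (auto simp: V_def)
      have d1: "measure Q (W - A) < e'"
      proof -
        have "measure Q W < measure Q A + e'"
          using W(3) e' by (simp add: emeasure_eq_measure ennreal_less_iff flip: ennreal_plus)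
        then show ?thesis using W(1) by (subst finite_measure_Diff) auto
      qed
      have d2: "measure Q (W - V n) < e'" using n VW by (subst finite_measure_Diff) auto
      let ?l = "[(q, filter (\<lambda>k. ?b k \<subseteq> W) [0..<n])]"
      have Dl: "D ?l x = c' * indicator (V n) x" for x by (simp add: D_def V_U c'_def)
      have "(\<integral>\<^sup>+ x. ennreal \<bar>indicat_real A x *\<^sub>R c - D ?l x\<bar> \<partial>Q) \<le>
        (\<integral>\<^sup>+ x. ennreal (e / (2 * (m + 1))) + ennreal \<bar>c'\<bar> * (indicator (W - A) x + indicator (W - V n) x) \<partial>Q)"
      proof (intro nn_integral_mono)
        fix x
        have "\<bar>indicat_real A x *\<^sub>R c - D ?l x\<bar> \<le> \<bar>c - c'\<bar> + \<bar>c'\<bar> * \<bar>indicat_real A x - indicator (V n) x\<bar>"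
          unfolding Dl by (auto simp: indicator_def)
        also have "\<dots> \<le> e / (2 * (m + 1)) + \<bar>c'\<bar> * (indicator (W - A) x + indicator (W - V n) x)"
          using q VW W(1) by (intro add_mono mult_left_mono) (auto simp: indicator_def)
        finally have "ennreal \<bar>indicat_real A x *\<^sub>R c - D ?l x\<bar> \<le>
          ennreal (e / (2 * (m + 1)) + \<bar>c'\<bar> * (indicator (W - A) x + indicator (W - V n) x))"
          by (rule ennreal_leI)
        also have "\<dots> = ennreal (e / (2 * (m + 1))) + ennreal \<bar>c'\<bar> * (indicator (W - A) x + indicator (W - V n) x)"
          using base.prems m0
          by (subst ennreal_plus) (auto simp: ennreal_mult' ennreal_plus ennreal_indicator[symmetric] simp del: ennreal_indicator)
        finally show "ennreal \<bar>indicat_real A x *\<^sub>R c - D ?l x\<bar> \<le> \<dots>" .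
      qed
      also have "\<dots> = ennreal (e / (2 * (m + 1))) * ennreal m + ennreal \<bar>c'\<bar> * (ennreal (measure Q (W - A)) + ennreal (measure Q (W - V n)))"
        by (simp add: nn_integral_add nn_integral_cmult emeasure_eq_measure m_def)
      also have "\<dots> = ennreal (e / (2 * (m + 1)) * m + \<bar>c'\<bar> * (measure Q (W - A) + measure Q (W - V n)))"
      proof -
        have 1: "ennreal (e / (2 * (m + 1))) * ennreal m = ennreal (e / (2 * (m + 1)) * m)"
          using base.prems m0 by (intro ennreal_mult[symmetric]) auto
        have 2: "ennreal \<bar>c'\<bar> * (ennreal (measure Q (W - A)) + ennreal (measure Q (W - V n))) =
            ennreal (\<bar>c'\<bar> * (measure Q (W - A) + measure Q (W - V n)))"
          by (simp add: ennreal_mult flip: ennreal_plus)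
        show ?thesis unfolding 1 2 using base.prems m0 by (intro ennreal_plus[symmetric]) auto
      qed
      also have "\<dots> < ennreal e"
      proof (rule ennreal_lessI[OF base.prems])
        have "e / (2 * (m + 1)) * m \<le> e / 2"
          using base.prems m0 by (simp add: field_simps)
        moreover have "\<bar>c'\<bar> * (measure Q (W - A) + measure Q (W - V n)) \<le> \<bar>c'\<bar> * (2 * e')"
          using d1 d2 by (intro mult_left_mono) auto
        moreover have "\<bar>c'\<bar> * (2 * e') \<le> e / 4"
        proof -
          have "\<bar>c'\<bar> * (2 * e') \<le> (\<bar>c'\<bar> + 1) * (2 * e')" using e' by (intro mult_right_mono) auto
          also have "\<dots> = e / 4" unfolding e'_def by (simp add: field_simps add_nonneg_eq_0_iff)
          finally show ?thesis .
        qed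
        ultimately show "e / (2 * (m + 1)) * m + \<bar>c'\<bar> * (measure Q (W - A) + measure Q (W - V n)) < e"
          using base.prems by linarith
      qed
      finally show ?case by blast
    next
      case (add f g)
      obtain l1 where l1: "(\<integral>\<^sup>+ x. ennreal \<bar>f x - D l1 x\<bar> \<partial>Q) < ennreal (e / 2)" using add.IH(1)[of "e / 2"] add.prems by auto
      obtain l2 where l2: "(\<integral>\<^sup>+ x. ennreal \<bar>g x - D l2 x\<bar> \<partial>Q) < ennreal (e / 2)" using add.IH(2)[of "e / 2"] add.prems by auto
      have [measurable]: "f \<in> borel_measurable Q" "g \<in> borel_measurable Q" using add by auto
      have "(\<integral>\<^sup>+ x. ennreal \<bar>f x + g x - D (l1 @ l2) x\<bar> \<partial>Q) \<le> (\<integral>\<^sup>+ x. ennreal \<bar>f x - D l1 x\<bar> + ennreal \<bar>g x - D l2 x\<bar> \<partial>Q)"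
        by (intro nn_integral_mono) (auto simp: D_append simp flip: ennreal_plus)
      also have "\<dots> = (\<integral>\<^sup>+ x. ennreal \<bar>f x - D l1 x\<bar> \<partial>Q) + (\<integral>\<^sup>+ x. ennreal \<bar>g x - D l2 x\<bar> \<partial>Q)"
        by (subst nn_integral_add) auto
      also have "\<dots> < ennreal (e / 2) + ennreal (e / 2)" using l1 l2 by (rule add_strict_mono)
      also have "\<dots> = ennreal e" using add.prems by (simp flip: ennreal_plus)
      finally show ?case by blast
    next
      case (lim f s)
      have [measurable]: "f \<in> borel_measurable Q" "s i \<in> borel_measurable Q" for i using lim by auto
      have "(\<lambda>i. \<integral>\<^sup>+ x. norm (f x - s i x) \<partial>Q) \<longlonglongrightarrow> 0"
      proof (rule nn_integral_dominated_convergence_norm)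
        show "(\<integral>\<^sup>+ x. ennreal (2 * norm (f x)) \<partial>Q) < \<infinity>"
        proof -
          have "integrable Q (\<lambda>x. 2 * f x)" using \<open>integrable Q f\<close> by simp
          then have "(\<integral>\<^sup>+ x. ennreal (norm (2 * f x)) \<partial>Q) < \<infinity>" unfolding integrable_iff_bounded by blast
          then show ?thesis by (simp add: abs_mult)
        qed
      qed (use lim in auto)
      then have "\<forall>\<^sub>F i in sequentially. (\<integral>\<^sup>+ x. norm (f x - s i x) \<partial>Q) < ennreal (e / 2)"
        using lim.prems by (intro order_tendstoD) auto
      then obtain i where i: "(\<integral>\<^sup>+ x. norm (f x - s i x) \<partial>Q) < ennreal (e / 2)"
        by (auto simp: eventually_sequentially)
      obtain l where l: "(\<integral>\<^sup>+ x. ennreal \<bar>s i x - D l x\<bar> \<partial>Q) < ennreal (e / 2)" using lim.IH[of "e / 2" i] lim.prems by auto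
      have "(\<integral>\<^sup>+ x. ennreal \<bar>f x - D l x\<bar> \<partial>Q) \<le> (\<integral>\<^sup>+ x. ennreal (norm (f x - s i x)) + ennreal \<bar>s i x - D l x\<bar> \<partial>Q)"
        by (intro nn_integral_mono) (auto simp flip: ennreal_plus)
      also have "\<dots> = (\<integral>\<^sup>+ x. norm (f x - s i x) \<partial>Q) + (\<integral>\<^sup>+ x. ennreal \<bar>s i x - D l x\<bar> \<partial>Q)"
        by (subst nn_integral_add) auto
      also have "\<dots> < ennreal (e / 2) + ennreal (e / 2)" using i l by (rule add_strict_mono)
      also have "\<dots> = ennreal e" using lim.prems by (simp flip: ennreal_plus)
      finally show ?case by blast
    qed
    then obtain l where l: "(\<integral>\<^sup>+ x. ennreal \<bar>h x - D l x\<bar> \<partial>Q) < ennreal e" by auto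
    then show "\<exists>i. (\<integral>\<^sup>+ x. ennreal \<bar>h x - D (from_nat i) x\<bar> \<partial>Q) < ennreal e"
      by (intro exI[of _ "to_nat l"]) simp
  qed
qed

section \<open>Transports driven by an independent uniform variable, and encoding of the first
  coordinate\<close>

definition clip :: "real \<Rightarrow> real \<Rightarrow> real" where
  "clip M x = max (- M) (min M x)"

lemma clip_bound: "0 \<le> M \<Longrightarrow> \<bar>clip M x\<bar> \<le> M"
  by (auto simp: clip_def)

lemma clip_le: "0 \<le> M \<Longrightarrow> \<bar>clip M x\<bar> \<le> \<bar>x\<bar>"
  by (auto simp: clip_def)

lemma clip_id: "\<bar>x\<bar> \<le> M \<Longrightarrow> clip M x = x"
  by (auto simp: clip_def)

lemma measurable_clip [measurable]: "clip M \<in> borel_measurable borel"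
  unfolding clip_def by measurable

lemma tendsto_clip: "(f \<longlongrightarrow> x) F \<Longrightarrow> ((\<lambda>n. clip M (f n)) \<longlongrightarrow> clip M x) F"
  unfolding clip_def by (intro tendsto_intros)

definition unif :: "real measure" where
  "unif = density lborel (indicator {0<..<1})"

lemma sets_unif [simp, measurable_cong]: "sets unif = sets borel" by (simp add: unif_def)

lemma space_unif [simp]: "space unif = UNIV" by (simp add: unif_def)

lemma prob_space_unif: "prob_space unif"
  by (rule prob_spaceI) (simp add: unif_def emeasure_density)

definition law_of :: "(real \<times> real \<Rightarrow> real) \<Rightarrow> real measure \<Rightarrow> (real \<times> real) measure" where
  "law_of G \<eta> = distr (\<eta> \<Otimes>\<^sub>M unif) (borel \<Otimes>\<^sub>M borel) (\<lambda>z. (fst z, G z))"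

text \<open>Conditional quantile transform: g(a, .) is the generalised inverse of the conditional
  distribution function given a, so a uniform u is sent to a variable with the conditional
  law.\<close>

lemma quantile_coupling:
  assumes \<pi>: "\<pi> \<in> space (prob_algebra (borel \<Otimes>\<^sub>M borel))" and \<eta>: "distr \<pi> borel fst = \<eta>"
  obtains g :: "real \<times> real \<Rightarrow> real"
  where "g \<in> borel_measurable (borel \<Otimes>\<^sub>M borel)" "law_of g \<eta> = \<pi>"
proof -
  interpret \<pi>: prob_space \<pi> using \<pi> by (simp add: space_prob_algebra)
  have s[measurable_cong]: "sets \<pi> = sets (borel \<Otimes>\<^sub>M borel)" using \<pi> by (simp add: space_prob_algebra)
  have m[measurable]: "fst \<in> \<pi> \<rightarrow>\<^sub>M borel" "snd \<in> \<pi> \<rightarrow>\<^sub>M borel" by measurable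
  obtain K where K: "is_cond_law \<pi> fst borel snd borel K"
    using ex_cond_law_real[OF \<pi>.prob_space_axioms m] by blast
  note [measurable] = is_cond_lawD(1,2)[OF K]
  interpret \<eta>: prob_space \<eta> unfolding \<eta>[symmetric] by (rule \<pi>.prob_space_distr) measurable
  interpret U: prob_space unif by (rule prob_space_unif)
  have s\<eta>[measurable_cong, simp]: "sets \<eta> = sets borel" unfolding \<eta>[symmetric] by simp
  have Kd: "real_distribution (K a)" for a
    using prob_space_kernel[OF is_cond_lawD(1)[OF K], of a]
    by (auto intro!: real_distribution.intro real_distribution_axioms.intro)
  \<comment> \<open>The set whose infimum is taken can be empty or unbounded below for u outside the
    open unit interval; there the value 0 is a default on a null set of \<open>unif\<close>.\<close>
  define g :: "real \<times> real \<Rightarrow> real"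
    where "g z = (if 0 < snd z \<and> snd z < 1 then Inf {x. snd z \<le> cdf (K (fst z)) x} else 0)" for z
  \<comment> \<open>This description of sublevel sets through the masses of half-lines gives joint
    measurability in a and u, since those masses are measurable in a.\<close>
  have g_le: "g (a, u) \<le> x \<longleftrightarrow> (if 0 < u \<and> u < 1 then u \<le> measure (K a) {..x} else 0 \<le> x)" for a u x
  proof -
    interpret cdf_distribution "K a" by (rule cdf_distribution.intro[OF Kd])
    show ?thesis using pseudoinverse[of u x] by (auto simp: g_def cdf_def)
  qed
  have g[measurable]: "g \<in> borel_measurable (borel \<Otimes>\<^sub>M borel)"
    unfolding borel_measurable_iff_le
  proof
    fix x
    have [measurable]: "(\<lambda>a. measure (K a) {..x}) \<in> borel_measurable borel" by measurable
    have "{z \<in> space (borel \<Otimes>\<^sub>M borel). g z \<le> x} = {z \<in> space (borel \<Otimes>\<^sub>M borel).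
       (if 0 < snd z \<and> snd z < 1 then snd z \<le> measure (K (fst z)) {..x} else 0 \<le> x)}"
      using g_le by force
    also have "\<dots> \<in> sets (borel \<Otimes>\<^sub>M borel)" by measurable
    finally show "{z \<in> space (borel \<Otimes>\<^sub>M borel). g z \<le> x} \<in> sets (borel \<Otimes>\<^sub>M borel)" .
  qed
  have ga: "(\<integral>\<^sup>+ u. h (g (a, u)) \<partial>unif) = (\<integral>\<^sup>+ b. h b \<partial>K a)" if [measurable]: "h \<in> borel_measurable borel" for h a
  proof -
    interpret cdf_distribution "K a" by (rule cdf_distribution.intro[OF Kd])
    have CI: "(\<lambda>u. Inf {x. u \<le> cdf (K a) x}) \<in> restrict_space lborel {0<..<1} \<rightarrow>\<^sub>M borel"
      using measurable_CI
      unfolding measurable_cong_sets[OF sets_restrict_space_cong[OF sets_lborel] refl] .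
    have I: "Inf {x. u \<le> cdf (K a) x} = g (a, u)" if "u \<in> {0<..<1}" for u
      using that by (simp add: g_def)
    have "(\<integral>\<^sup>+ u. h (g (a, u)) \<partial>unif) = (\<integral>\<^sup>+ u. h (g (a, u)) * indicator {0<..<1} u \<partial>lborel)"
      unfolding unif_def by (subst nn_integral_density) (auto simp: mult.commute)
    also have "\<dots> = (\<integral>\<^sup>+ u. h (g (a, u)) \<partial>restrict_space lborel {0<..<1})"
      by (subst nn_integral_restrict_space) auto
    also have "\<dots> = (\<integral>\<^sup>+ u. h (Inf {x. u \<le> cdf (K a) x}) \<partial>restrict_space lborel {0<..<1})"
      by (intro nn_integral_cong) (auto simp: I space_restrict_space)
    also have "\<dots> = (\<integral>\<^sup>+ b. h b \<partial>distr (restrict_space lborel {0<..<1}) borel (\<lambda>u. Inf {x. u \<le> cdf (K a) x}))"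
      by (subst nn_integral_distr[OF CI]) simp_all
    also have "\<dots> = (\<integral>\<^sup>+ b. h b \<partial>K a)" by (simp add: distr_I_eq_M)
    finally show ?thesis .
  qed
  have "law_of g \<eta> = \<pi>"
  proof (rule measure_eqI)
    show "sets (law_of g \<eta>) = sets \<pi>" by (simp add: law_of_def s)
    fix T assume "T \<in> sets (law_of g \<eta>)"
    then have [measurable]: "T \<in> sets (borel \<Otimes>\<^sub>M borel)" by (simp add: law_of_def)
    have "emeasure (law_of g \<eta>) T = (\<integral>\<^sup>+ z. indicator T (fst z, g z) \<partial>(\<eta> \<Otimes>\<^sub>M unif))"
      unfolding law_of_def by (subst nn_integral_indicator[symmetric], simp, subst nn_integral_distr) auto
    also have "\<dots> = (\<integral>\<^sup>+ a. (\<integral>\<^sup>+ u. indicator T (a, g (a, u)) \<partial>unif) \<partial>\<eta>)"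
      by (subst U.nn_integral_fst[symmetric]) auto
    also have "\<dots> = (\<integral>\<^sup>+ a. (\<integral>\<^sup>+ b. indicator T (a, b) \<partial>K a) \<partial>\<eta>)"
      by (intro nn_integral_cong ga) measurable
    also have "\<dots> = (\<integral>\<^sup>+ z. (\<integral>\<^sup>+ b. indicator T (fst z, b) \<partial>K (fst z)) \<partial>\<pi>)"
      unfolding \<eta>[symmetric]
      by (subst nn_integral_distr) (auto intro!: nn_integral_measurable_subprob_algebra2[where N=borel])
    also have "\<dots> = (\<integral>\<^sup>+ z. indicator T (fst z, snd z) \<partial>\<pi>)"
      by (rule is_cond_law_nn_integral[OF \<pi>.prob_space_axioms m K, symmetric]) measurable
    also have "\<dots> = emeasure \<pi> T"
      by (simp add: s)
    finally show "emeasure (law_of g \<eta>) T = emeasure \<pi> T" .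
  qed
  with g that show thesis by blast
qed

text \<open>A measurable injection of the line into the open unit interval with an explicit inverse
  through the tangent. Because the values 0 and 1 are excluded, it can be stored as a fractional
  part.\<close>

definition squash :: "real \<Rightarrow> real" where
  "squash a = arctan a / pi + 1 / 2"

lemma squash_bounds: "0 < squash a" "squash a < 1"
proof -
  have "- (1 / 2) < arctan a / pi" "arctan a / pi < 1 / 2"
    using arctan_lbound[of a] arctan_ubound[of a] by (simp_all add: less_divide_eq divide_less_eq)
  then show "0 < squash a" "squash a < 1" unfolding squash_def by linarith+
qed

text \<open>Rounding to a grid of mesh \<open>1 / (n + 1)\<close> makes room to store the first coordinate in the
  fractional part.\<close>

definition encode :: "nat \<Rightarrow> (real \<times> real \<Rightarrow> real) \<Rightarrow> real \<times> real \<Rightarrow> real" where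
  "encode n d z = (of_int \<lfloor>real (Suc n) * (fst z + d z)\<rfloor> + squash (fst z)) / real (Suc n)"

definition decode :: "nat \<Rightarrow> real \<Rightarrow> real" where
  "decode n b = tan (pi * (frac (real (Suc n) * b) - 1 / 2))"

text \<open>After multiplication by n + 1 the code is an integer plus a number strictly between 0
  and 1, so its fractional part is exactly the squashed first coordinate, whatever d is.\<close>

lemma decode_encode: "decode n (encode n d z) = fst z"
proof -
  have "frac (real (Suc n) * encode n d z) = squash (fst z)"
    using squash_bounds[of "fst z"] by (simp add: encode_def frac_def floor_eq_iff del: of_nat_Suc)
  moreover have "pi * (squash (fst z) - 1 / 2) = arctan (fst z)"
    by (simp add: squash_def)
  ultimately show ?thesis by (simp add: decode_def tan_arctan)
qed

lemma encode_dist: "\<bar>encode n d z - (fst z + d z)\<bar> \<le> inverse (real (Suc n))"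
proof -
  let ?y = "real (Suc n) * (fst z + d z)"
  have "\<bar>of_int \<lfloor>?y\<rfloor> + squash (fst z) - ?y\<bar> \<le> 1"
    using squash_bounds[of "fst z"] by linarith
  then have "\<bar>of_int \<lfloor>?y\<rfloor> + squash (fst z) - ?y\<bar> / real (Suc n) \<le> 1 / real (Suc n)"
    by (intro divide_right_mono) auto
  moreover have "encode n d z - (fst z + d z) = (of_int \<lfloor>?y\<rfloor> + squash (fst z) - ?y) / real (Suc n)"
    unfolding encode_def by (simp add: diff_divide_distrib del: of_nat_Suc)
  ultimately show ?thesis by (simp add: abs_divide inverse_eq_divide del: of_nat_Suc)
qed

lemma measurable_encode [measurable]:
  assumes [measurable]: "d \<in> borel_measurable (borel \<Otimes>\<^sub>M borel)"
  shows "encode n d \<in> borel_measurable (borel \<Otimes>\<^sub>M borel)"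
proof -
  have [measurable]: "squash \<in> borel_measurable borel" unfolding squash_def by measurable
  show ?thesis unfolding encode_def by measurable
qed

lemma measurable_decode [measurable]: "decode n \<in> borel_measurable borel"
  unfolding decode_def tan_def frac_def by measurable

lemma law_of_in_prob_algebra:
  assumes "prob_space \<eta>" "sets \<eta> = sets borel" and [measurable]: "G \<in> borel_measurable (borel \<Otimes>\<^sub>M borel)"
  shows "law_of G \<eta> \<in> space (prob_algebra (borel \<Otimes>\<^sub>M borel))"
proof -
  interpret \<eta>: prob_space \<eta> by fact
  interpret U: prob_space unif by (rule prob_space_unif)
  interpret P: pair_prob_space \<eta> unif ..
  have [measurable_cong]: "sets \<eta> = sets borel" by fact
  show ?thesis unfolding law_of_def space_prob_algebra by (auto intro!: P.prob_space_distr)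
qed

lemma distr_law_of_fst:
  assumes "prob_space \<eta>" "sets \<eta> = sets borel" and [measurable]: "G \<in> borel_measurable (borel \<Otimes>\<^sub>M borel)"
  shows "distr (law_of G \<eta>) borel fst = \<eta>"
proof -
  interpret \<eta>: prob_space \<eta> by fact
  interpret U: prob_space unif by (rule prob_space_unif)
  have s[measurable_cong]: "sets \<eta> = sets borel" by fact
  have "distr (law_of G \<eta>) borel fst = distr (\<eta> \<Otimes>\<^sub>M unif) \<eta> fst"
    unfolding law_of_def by (subst distr_distr) (auto simp: comp_def s intro!: distr_cong)
  also have "\<dots> = \<eta>" by (rule U.distr_pair_fst)
  finally show ?thesis .
qed

lemma nn_integral_law_of:
  assumes "sets \<eta> = sets borel" and [measurable]: "G \<in> borel_measurable (borel \<Otimes>\<^sub>M borel)"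
    "h \<in> borel_measurable (borel \<Otimes>\<^sub>M borel)"
  shows "(\<integral>\<^sup>+ z. h z \<partial>law_of G \<eta>) = (\<integral>\<^sup>+ z. h (fst z, G z) \<partial>(\<eta> \<Otimes>\<^sub>M unif))"
proof -
  have [measurable_cong]: "sets \<eta> = sets borel" by fact
  show ?thesis unfolding law_of_def by (subst nn_integral_distr) auto
qed

lemma ext_integral_law_of:
  assumes "sets \<eta> = sets borel" and [measurable]: "G \<in> borel_measurable (borel \<Otimes>\<^sub>M borel)"
    "h \<in> borel_measurable (borel \<Otimes>\<^sub>M borel)"
  shows "ext_integral (law_of G \<eta>) h = ext_integral (\<eta> \<Otimes>\<^sub>M unif) (\<lambda>z. h (fst z, G z))"
proof -
  have [measurable_cong]: "sets \<eta> = sets borel" by fact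
  show ?thesis unfolding law_of_def by (subst ext_integral_distr) auto
qed

lemma measurable_law_of [measurable]:
  assumes [measurable]: "G \<in> borel_measurable (borel \<Otimes>\<^sub>M borel)"
  shows "law_of G \<in> prob_algebra borel \<rightarrow>\<^sub>M prob_algebra (borel \<Otimes>\<^sub>M borel)"
proof -
  have [measurable]: "(\<lambda>\<eta>. unif) \<in> prob_algebra borel \<rightarrow>\<^sub>M prob_algebra borel"
    by (rule measurable_const) (simp add: space_prob_algebra prob_space_unif)
  show ?thesis unfolding law_of_def by measurable
qed

text \<open>The p-th power of \<open>cost p\<close>; without the root it passes through integrals
  and limits directly.\<close>

definition displacement :: "real \<Rightarrow> (real \<times> real) measure \<Rightarrow> ennreal" where
  "displacement p \<pi> = (\<integral>\<^sup>+ z. ennreal (\<bar>fst z - snd z\<bar> powr p) \<partial>\<pi>)"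

text \<open>Fatou's lemma for the gain and dominated convergence for the cost.\<close>

lemma law_of_approx:
  fixes v :: "real \<times> real \<Rightarrow> ereal" and B :: "real \<times> real \<Rightarrow> real" and Bn :: "nat \<Rightarrow> real \<times> real \<Rightarrow> real"
  assumes p: "1 \<le> p" and \<eta>: "prob_space \<eta>" "sets \<eta> = sets borel"
    and [measurable]: "B \<in> borel_measurable (borel \<Otimes>\<^sub>M borel)" "\<And>n. Bn n \<in> borel_measurable (borel \<Otimes>\<^sub>M borel)"
      "H \<in> borel_measurable (borel \<Otimes>\<^sub>M borel)"
      "v \<in> borel_measurable (borel \<Otimes>\<^sub>M borel)" "\<beta> \<in> borel_measurable borel"
    and lim: "AE z in \<eta> \<Otimes>\<^sub>M unif. (\<lambda>n. Bn n z) \<longlonglongrightarrow> B z"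
    and bnd: "\<And>n z. \<bar>fst z - Bn n z\<bar> \<le> H z" "\<And>z. \<bar>fst z - B z\<bar> \<le> H z"
    and H: "(\<integral>\<^sup>+ z. ennreal (H z powr p) \<partial>(\<eta> \<Otimes>\<^sub>M unif)) < \<infinity>"
    and \<beta>: "(\<integral>\<^sup>+ a. \<beta> a \<partial>\<eta>) < \<infinity>"
    and lb: "\<And>a b. - enn2ereal (\<beta> a + ennreal c * ennreal (\<bar>a - b\<bar> powr p)) \<le> v (a, b)"
    and lsc: "\<And>a b bn. bn \<longlonglongrightarrow> b \<Longrightarrow> v (a, b) \<le> liminf (\<lambda>n. v (a, bn n))"
    and cost: "displacement p (law_of B \<eta>) < \<delta>"
    and gain: "\<alpha> < ext_integral (law_of B \<eta>) v"
  shows "\<exists>n. displacement p (law_of (Bn n) \<eta>) < \<delta> \<and> \<alpha> < ext_integral (law_of (Bn n) \<eta>) v"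
proof -
  interpret \<eta>: prob_space \<eta> by fact
  interpret U: prob_space unif by (rule prob_space_unif)
  have s[measurable_cong]: "sets \<eta> = sets borel" by fact
  let ?Q = "\<eta> \<Otimes>\<^sub>M unif"
  have disp: "displacement p (law_of G \<eta>) = (\<integral>\<^sup>+ z. ennreal (\<bar>fst z - G z\<bar> powr p) \<partial>?Q)"
    if [measurable]: "G \<in> borel_measurable (borel \<Otimes>\<^sub>M borel)" for G
    unfolding displacement_def by (subst nn_integral_law_of[OF s]) auto
  have pw: "\<bar>fst z - y\<bar> powr p \<le> H z powr p" if "\<bar>fst z - y\<bar> \<le> H z" for y :: real and z
    using that p by (intro powr_mono2) auto
  have "(\<lambda>n. displacement p (law_of (Bn n) \<eta>)) \<longlonglongrightarrow> displacement p (law_of B \<eta>)"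
    unfolding disp[OF assms(4)] disp[OF assms(5)]
  proof (rule nn_integral_dominated_convergence[OF _ _ _ _ H])
    show "AE z in ?Q. (\<lambda>n. ennreal (\<bar>fst z - Bn n z\<bar> powr p)) \<longlonglongrightarrow> ennreal (\<bar>fst z - B z\<bar> powr p)"
      using lim
    proof eventually_elim
      case (elim z)
      have "(\<lambda>n. \<bar>fst z - Bn n z\<bar>) \<longlonglongrightarrow> \<bar>fst z - B z\<bar>"
        by (intro tendsto_intros elim)
      then have "(\<lambda>n. \<bar>fst z - Bn n z\<bar> powr p) \<longlonglongrightarrow> \<bar>fst z - B z\<bar> powr p"
        using p by (intro tendsto_powr' tendsto_const) auto
      then show ?case by (rule tendsto_ennrealI)
    qed
  qed (auto intro!: ennreal_leI pw bnd)
  then have 1: "\<forall>\<^sub>F n in sequentially. displacement p (law_of (Bn n) \<eta>) < \<delta>"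
    using cost by (rule order_tendstoD)
  \<comment> \<open>H bounds all displacements at once, so inserting it into the lower bound for v
    yields one integrable minorant for the whole sequence.\<close>
  have "\<forall>\<^sub>F n in sequentially. \<alpha> < ext_integral ?Q (\<lambda>z. v (fst z, Bn n z))"
  proof (rule ext_integral_Fatou[where L="\<lambda>z. \<beta> (fst z) + ennreal c * ennreal (H z powr p)" and w="\<lambda>z. v (fst z, B z)"])
    have "(\<integral>\<^sup>+ z. \<beta> (fst z) \<partial>?Q) = (\<integral>\<^sup>+ a. \<beta> a \<partial>\<eta>)"
      by (subst U.nn_integral_fst[symmetric]) (auto simp: U.emeasure_space_1[simplified])
    then show "(\<integral>\<^sup>+ z. \<beta> (fst z) + ennreal c * ennreal (H z powr p) \<partial>?Q) < \<infinity>"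
      using \<beta> H by (simp add: nn_integral_add nn_integral_cmult ennreal_mult_less_top)
    have *: "- enn2ereal (\<beta> (fst z) + ennreal c * ennreal (H z powr p)) \<le> v (fst z, y)" if "\<bar>fst z - y\<bar> \<le> H z" for z y
    proof -
      have "- enn2ereal (\<beta> (fst z) + ennreal c * ennreal (H z powr p)) \<le>
          - enn2ereal (\<beta> (fst z) + ennreal c * ennreal (\<bar>fst z - y\<bar> powr p))"
        using pw[OF that] by (auto simp flip: less_eq_ennreal.rep_eq intro!: add_left_mono mult_left_mono ennreal_leI)
      also have "\<dots> \<le> v (fst z, y)" by (rule lb)
      finally show ?thesis .
    qed
    show "AE z in ?Q. \<forall>n. - enn2ereal (\<beta> (fst z) + ennreal c * ennreal (H z powr p)) \<le> v (fst z, Bn n z)"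
      using bnd(1) by (intro AE_I2 allI *) auto
    show "AE z in ?Q. - enn2ereal (\<beta> (fst z) + ennreal c * ennreal (H z powr p)) \<le> v (fst z, B z)"
      using bnd(2) by (intro AE_I2 *) auto
    show "AE z in ?Q. v (fst z, B z) \<le> liminf (\<lambda>n. v (fst z, Bn n z))"
      using lim by eventually_elim (rule lsc)
    show "\<alpha> < ext_integral ?Q (\<lambda>z. v (fst z, B z))"
      using gain by (simp add: ext_integral_law_of[OF s])
  qed measurable
  then have 2: "\<forall>\<^sub>F n in sequentially. \<alpha> < ext_integral (law_of (Bn n) \<eta>) v"
    by (simp add: ext_integral_law_of[OF s])
  from 1 2 have "\<forall>\<^sub>F n in sequentially. displacement p (law_of (Bn n) \<eta>) < \<delta> \<and> \<alpha> < ext_integral (law_of (Bn n) \<eta>) v"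
    by eventually_elim simp
  then show ?thesis by (auto simp: eventually_sequentially)
qed

text \<open>Approximants with L1 error below 1 / (n + 1) converge in L1, hence almost everywhere
  along a subsequence.\<close>

lemma AE_approx_dense:
  fixes d :: "nat \<Rightarrow> 'a::polish_space \<Rightarrow> real"
  assumes [measurable]: "\<And>i. d i \<in> borel_measurable borel"
    and dense: "\<And>e. 0 < e \<Longrightarrow> \<exists>i. (\<integral>\<^sup>+ x. ennreal \<bar>h x - d i x\<bar> \<partial>Q) < ennreal e"
    and Q: "sets Q = sets borel" and [measurable]: "h \<in> borel_measurable borel"
  obtains r :: "nat \<Rightarrow> nat" where "AE x in Q. (\<lambda>n. d (r n) x) \<longlonglongrightarrow> h x"
proof -
  have [measurable_cong]: "sets Q = sets borel" by fact
  have "\<exists>i. (\<integral>\<^sup>+ x. ennreal \<bar>h x - d i x\<bar> \<partial>Q) < ennreal (inverse (real (Suc n)))" for n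
    by (rule dense) simp
  then obtain i where i: "\<And>n. (\<integral>\<^sup>+ x. ennreal \<bar>h x - d (i n) x\<bar> \<partial>Q) < ennreal (inverse (real (Suc n)))"
    by metis
  have int: "integrable Q (\<lambda>x. h x - d (i n) x)" for n
    using less_trans[OF i[of n] ennreal_less_top] by (intro integrableI_bounded) auto
  have "(\<lambda>n. \<integral>x. norm (h x - d (i n) x) \<partial>Q) \<longlonglongrightarrow> 0"
  proof (rule tendsto_sandwich[OF _ _ tendsto_const LIMSEQ_inverse_real_of_nat])
    show "\<forall>\<^sub>F n in sequentially. (\<integral>x. norm (h x - d (i n) x) \<partial>Q) \<le> inverse (real (Suc n))"
    proof (intro always_eventually allI)
      fix n
      have "ennreal (\<integral>x. norm (h x - d (i n) x) \<partial>Q) = (\<integral>\<^sup>+ x. ennreal \<bar>h x - d (i n) x\<bar> \<partial>Q)"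
        using int[of n] by (subst nn_integral_eq_integral) auto
      then have "ennreal (\<integral>x. norm (h x - d (i n) x) \<partial>Q) < ennreal (inverse (real (Suc n)))"
        using i[of n] by simp
      then show "(\<integral>x. norm (h x - d (i n) x) \<partial>Q) \<le> inverse (real (Suc n))"
        by (subst (asm) ennreal_less_iff) auto
    qed
  qed auto
  from tendsto_L1_AE_subseq[OF int this] obtain s
    where s: "AE x in Q. (\<lambda>n. h x - d (i (s n)) x) \<longlonglongrightarrow> 0" by auto
  have "AE x in Q. (\<lambda>n. d (i (s n)) x) \<longlonglongrightarrow> h x"
    using s
  proof eventually_elim
    case (elim x)
    then have "(\<lambda>n. h x - (h x - d (i (s n)) x)) \<longlonglongrightarrow> h x - 0" by (intro tendsto_intros)
    then show ?case by simp
  qed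
  then show thesis by (rule that)
qed

text \<open>The first coordinate is recovered for every value of the randomisation u. The member
  \<open>G 0\<close> is the identity transport of cost zero, so the competitors never form an empty
  set.\<close>

definition coding_family :: "(nat \<Rightarrow> real \<times> real \<Rightarrow> real) \<Rightarrow> (nat \<Rightarrow> real \<Rightarrow> real) \<Rightarrow> bool" where
  "coding_family G dc \<longleftrightarrow>
     (\<forall>i. G i \<in> borel_measurable (borel \<Otimes>\<^sub>M borel) \<and> dc i \<in> borel_measurable borel \<and>
        (\<forall>z. dc i (G i z) = fst z)) \<and> G 0 = fst"

text \<open>The coupling, its first marginal and the integrand are quantified inside, so one
  countable family serves at every time and for every past. The integrand is lower semicontinuous in
  its second argument with the first held fixed.\<close>

definition gain_dense :: "real \<Rightarrow> (nat \<Rightarrow> real \<times> real \<Rightarrow> real) \<Rightarrow> bool" where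
  "gain_dense p G \<longleftrightarrow> (\<forall>\<pi> \<eta> v \<beta> c \<delta> \<alpha>.
     \<pi> \<in> space (prob_algebra (borel \<Otimes>\<^sub>M borel)) \<longrightarrow> distr \<pi> borel fst = \<eta> \<longrightarrow>
     v \<in> borel_measurable (borel \<Otimes>\<^sub>M borel) \<longrightarrow> \<beta> \<in> borel_measurable borel \<longrightarrow> (\<integral>\<^sup>+ a. \<beta> a \<partial>\<eta>) < \<infinity> \<longrightarrow>
     (\<forall>a b. - enn2ereal (\<beta> a + ennreal c * ennreal (\<bar>a - b\<bar> powr p)) \<le> v (a, b)) \<longrightarrow>
     (\<forall>a b bn. bn \<longlonglongrightarrow> b \<longrightarrow> v (a, b) \<le> liminf (\<lambda>n. v (a, bn n))) \<longrightarrow>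
     displacement p \<pi> < \<delta> \<longrightarrow> \<alpha> < ext_integral \<pi> v \<longrightarrow>
     (\<exists>i. displacement p (law_of (G i) \<eta>) < \<delta> \<and> \<alpha> < ext_integral (law_of (G i) \<eta>) v))"

text \<open>Starting from the quantile transport of the coupling, three approximations are made:
  truncation of the displacement, replacement by a member of the dense family, and rounding with
  encoding. Each keeps the strict bound on the cost and the strict gain by
  \<open>law_of_approx\<close>.\<close>

lemma ex_coding_family:
  assumes p: "1 \<le> p"
  shows "\<exists>G dc. coding_family G dc \<and> gain_dense p G"
proof -
  obtain d :: "nat \<Rightarrow> real \<times> real \<Rightarrow> real"
    where d[measurable]: "\<And>i. d i \<in> borel_measurable borel"
      and dense: "\<And>Q h e. finite_measure Q \<Longrightarrow> sets Q = sets borel \<Longrightarrow> integrable Q h \<Longrightarrow> 0 < e \<Longrightarrow>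
      \<exists>i. (\<integral>\<^sup>+ x. ennreal \<bar>h x - d i x\<bar> \<partial>Q) < ennreal e"
    using ex_countable_L1_dense by blast
  have d'[measurable]: "d i \<in> borel_measurable (borel \<Otimes>\<^sub>M borel)" for i
    using d[of i] by (simp add: borel_prod)
  define E :: "nat \<times> nat \<times> nat \<Rightarrow> real \<times> real \<Rightarrow> real"
    where "E = (\<lambda>(i, M, n). encode n (\<lambda>z. clip (real M) (d i z)))"
  define G where "G i = (case i of 0 \<Rightarrow> fst | Suc j \<Rightarrow> E (from_nat j))" for i
  define dc where "dc i = (case i of 0 \<Rightarrow> id | Suc j \<Rightarrow> decode (snd (snd (from_nat j :: nat \<times> nat \<times> nat))))" for i
  have E[measurable]: "E x \<in> borel_measurable (borel \<Otimes>\<^sub>M borel)" for x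
    unfolding E_def split_beta' by measurable
  have "coding_family G dc"
    unfolding coding_family_def
    by (auto simp: G_def dc_def E_def decode_encode split: nat.split prod.split)
  moreover have "gain_dense p G"
    unfolding gain_dense_def
  proof (intro allI impI)
    fix \<pi> \<eta> c and v :: "real \<times> real \<Rightarrow> ereal" and \<beta> \<delta> \<alpha>
    assume \<pi>: "\<pi> \<in> space (prob_algebra (borel \<Otimes>\<^sub>M borel))" and \<eta>: "distr \<pi> borel fst = \<eta>"
      and v[measurable]: "v \<in> borel_measurable (borel \<Otimes>\<^sub>M borel)" and \<beta>[measurable]: "\<beta> \<in> borel_measurable borel"
      and fin: "(\<integral>\<^sup>+ a. \<beta> a \<partial>\<eta>) < \<infinity>"
      and lb: "\<forall>a b. - enn2ereal (\<beta> a + ennreal c * ennreal (\<bar>a - b\<bar> powr p)) \<le> v (a, b)"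
      and lsc: "\<forall>a b bn. bn \<longlonglongrightarrow> b \<longrightarrow> v (a, b) \<le> liminf (\<lambda>n. v (a, bn n))"
      and cost: "displacement p \<pi> < \<delta>" and gain: "\<alpha> < ext_integral \<pi> v"
    have s\<pi>[measurable_cong]: "sets \<pi> = sets (borel \<Otimes>\<^sub>M borel)" using \<pi> by (simp add: space_prob_algebra)
    have P\<eta>: "prob_space \<eta>" unfolding \<eta>[symmetric]
      using \<pi> by (intro prob_space.prob_space_distr) (auto simp: space_prob_algebra)
    have s\<eta>[measurable_cong]: "sets \<eta> = sets borel" unfolding \<eta>[symmetric] by simp
    interpret \<eta>: prob_space \<eta> by fact
    interpret U: prob_space unif by (rule prob_space_unif)
    interpret P: pair_prob_space \<eta> unif ..
    let ?Q = "\<eta> \<Otimes>\<^sub>M unif"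
    have sQ: "sets ?Q = sets (borel \<Otimes>\<^sub>M borel)" using s\<eta> by (intro sets_pair_measure_cong) auto
    have sQ': "sets ?Q = sets borel" by (simp only: sQ borel_prod)
    note step = law_of_approx[OF p P\<eta> s\<eta> _ _ _ v \<beta> _ _ _ _ fin lb[rule_format] lsc[rule_format]]
    have const: "(\<integral>\<^sup>+ z. ennreal ((K::real) powr p) \<partial>?Q) < \<infinity>" for K
      using P.emeasure_space_1 by simp
    obtain g where g[measurable]: "g \<in> borel_measurable (borel \<Otimes>\<^sub>M borel)" and g\<pi>: "law_of g \<eta> = \<pi>"
      by (rule quantile_coupling[OF \<pi> \<eta>])
    define h where "h z = g z - fst z" for z
    have [measurable]: "h \<in> borel_measurable (borel \<Otimes>\<^sub>M borel)" unfolding h_def by measurable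
    \<comment> \<open>Truncation only shortens the displacement h, so |h| dominates; the integral of
      its p-th power is the displacement of the given coupling.\<close>
    have "\<exists>n. displacement p (law_of (\<lambda>z. fst z + clip (real n) (h z)) \<eta>) < \<delta> \<and>
        \<alpha> < ext_integral (law_of (\<lambda>z. fst z + clip (real n) (h z)) \<eta>) v"
    proof (rule step[where B="\<lambda>z. g z" and H="\<lambda>z. \<bar>h z\<bar>"])
      show "AE z in ?Q. (\<lambda>n. fst z + clip (real n) (h z)) \<longlonglongrightarrow> g z"
      proof (intro AE_I2)
        fix z :: "real \<times> real"
        obtain n0 where "\<bar>h z\<bar> \<le> real n0" using real_arch_simple by blast
        then have "\<forall>n\<ge>n0. fst z + clip (real n) (h z) = g z"
        proof (intro allI impI)
          fix n assume "n0 \<le> n"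
          then have "clip (real n) (h z) = h z" using \<open>\<bar>h z\<bar> \<le> real n0\<close> by (intro clip_id) linarith
          then show "fst z + clip (real n) (h z) = g z" by (simp add: h_def)
        qed
        then show "(\<lambda>n. fst z + clip (real n) (h z)) \<longlonglongrightarrow> g z"
          by (intro tendsto_eventually) (auto simp: eventually_sequentially)
      qed
      show "(\<integral>\<^sup>+ z. ennreal (\<bar>h z\<bar> powr p) \<partial>?Q) < \<infinity>"
      proof -
        have "(\<integral>\<^sup>+ z. ennreal (\<bar>h z\<bar> powr p) \<partial>?Q) = displacement p \<pi>"
          unfolding g\<pi>[symmetric] displacement_def
          by (subst nn_integral_law_of[OF s\<eta>]) (auto simp: h_def abs_minus_commute)
        also have "\<dots> < \<infinity>" using cost by (auto intro: less_le_trans)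
        finally show ?thesis .
      qed
      show "\<bar>fst z - g z\<bar> \<le> \<bar>h z\<bar>" for z by (simp add: h_def)
      show "\<bar>fst z - (fst z + clip (real n) (h z))\<bar> \<le> \<bar>h z\<bar>" for n z using clip_le[of "real n" "h z"] by simp
    qed (use cost gain g\<pi> in auto)
    then obtain M where M: "displacement p (law_of (\<lambda>z. fst z + clip (real M) (h z)) \<eta>) < \<delta>"
        "\<alpha> < ext_integral (law_of (\<lambda>z. fst z + clip (real M) (h z)) \<eta>) v" by blast
    have h': "(\<lambda>z. clip (real M) (h z)) \<in> borel_measurable borel"
    proof -
      have "(\<lambda>z. clip (real M) (h z)) \<in> borel_measurable (borel \<Otimes>\<^sub>M borel)" by measurable
      then show ?thesis by (simp add: borel_prod)
    qed
    have int: "integrable ?Q (\<lambda>z. clip (real M) (h z))"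
      by (rule P.integrable_const_bound[where B="real M"]) (auto intro!: AE_I2 clip_bound)
    obtain r where r: "AE z in ?Q. (\<lambda>n. d (r n) z) \<longlonglongrightarrow> clip (real M) (h z)"
      using AE_approx_dense[OF d dense[OF P.finite_measure_axioms sQ' int] sQ' h'] by blast
    \<comment> \<open>A dense family controls the approximants in L1 only; clipping them at M
      supplies the uniform bound for dominated convergence, and does not disturb the limit, which is
      clipped already.\<close>
    have "\<exists>n. displacement p (law_of (\<lambda>z. fst z + clip (real M) (d (r n) z)) \<eta>) < \<delta> \<and>
        \<alpha> < ext_integral (law_of (\<lambda>z. fst z + clip (real M) (d (r n) z)) \<eta>) v"
    proof (rule step[where B="\<lambda>z. fst z + clip (real M) (h z)" and H="\<lambda>z. real M"])
      show "AE z in ?Q. (\<lambda>n. fst z + clip (real M) (d (r n) z)) \<longlonglongrightarrow> fst z + clip (real M) (h z)"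
        using r
      proof eventually_elim
        case (elim z)
        have "(\<lambda>n. clip (real M) (d (r n) z)) \<longlonglongrightarrow> clip (real M) (clip (real M) (h z))"
          by (rule tendsto_clip[OF elim])
        also have "clip (real M) (clip (real M) (h z)) = clip (real M) (h z)"
          by (rule clip_id) (simp add: clip_bound)
        finally show ?case by (intro tendsto_intros)
      qed
      show "\<bar>fst z - (fst z + clip (real M) (d (r n) z))\<bar> \<le> real M" for n z
        using clip_bound[of "real M" "d (r n) z"] by simp
      show "\<bar>fst z - (fst z + clip (real M) (h z))\<bar> \<le> real M" for z
        using clip_bound[of "real M" "h z"] by simp
    qed (use M const in auto)
    then obtain i where i: "displacement p (law_of (\<lambda>z. fst z + clip (real M) (d i z)) \<eta>) < \<delta>"
        "\<alpha> < ext_integral (law_of (\<lambda>z. fst z + clip (real M) (d i z)) \<eta>) v" by blast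
    \<comment> \<open>Rounding moves the target by at most 1 / (n + 1), whence the dominating
      constant M + 1.\<close>
    have "\<exists>n. displacement p (law_of (encode n (\<lambda>z. clip (real M) (d i z))) \<eta>) < \<delta> \<and>
        \<alpha> < ext_integral (law_of (encode n (\<lambda>z. clip (real M) (d i z))) \<eta>) v"
    proof (rule step[where B="\<lambda>z. fst z + clip (real M) (d i z)" and H="\<lambda>z. real M + 1"])
      show "AE z in ?Q. (\<lambda>n. encode n (\<lambda>z. clip (real M) (d i z)) z) \<longlonglongrightarrow> fst z + clip (real M) (d i z)"
      proof (intro AE_I2)
        fix z
        have "(\<lambda>n. encode n (\<lambda>z. clip (real M) (d i z)) z - (fst z + clip (real M) (d i z))) \<longlonglongrightarrow> 0"
          by (rule Lim_null_comparison[OF _ LIMSEQ_inverse_real_of_nat])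
            (use encode_dist[of _ "\<lambda>z. clip (real M) (d i z)" z] in auto)
        then show "(\<lambda>n. encode n (\<lambda>z. clip (real M) (d i z)) z) \<longlonglongrightarrow> fst z + clip (real M) (d i z)"
          by (rule LIM_zero_cancel)
      qed
      show "\<bar>fst z - encode n (\<lambda>z. clip (real M) (d i z)) z\<bar> \<le> real M + 1" for n z
      proof -
        have "inverse (real (Suc n)) \<le> 1" by (simp add: field_simps)
        then show ?thesis
          using encode_dist[of n "\<lambda>z. clip (real M) (d i z)" z] clip_bound[of "real M" "d i z"] by linarith
      qed
      show "\<bar>fst z - (fst z + clip (real M) (d i z))\<bar> \<le> real M + 1" for z
        using clip_bound[of "real M" "d i z"] by simp
    qed (use i const in auto)
    then obtain n where n: "displacement p (law_of (E (i, M, n)) \<eta>) < \<delta>" "\<alpha> < ext_integral (law_of (E (i, M, n)) \<eta>) v"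
      by (auto simp: E_def)
    have "G (Suc (to_nat (i, M, n))) = E (i, M, n)" by (simp add: G_def)
    with n show "\<exists>i. displacement p (law_of (G i) \<eta>) < \<delta> \<and> \<alpha> < ext_integral (law_of (G i) \<eta>) v"
      by metis
  qed
  ultimately show ?thesis by blast
qed

section \<open>Dynamic programming\<close>

lemma powr_triangle:
  fixes a b p :: real
  assumes "1 \<le> p"
  shows "\<bar>b\<bar> powr p \<le> 2 powr p * (\<bar>a\<bar> powr p + \<bar>a - b\<bar> powr p)"
proof -
  let ?m = "max \<bar>a\<bar> \<bar>a - b\<bar>"
  have "\<bar>b\<bar> \<le> \<bar>a\<bar> + \<bar>a - b\<bar>" by linarith
  also have "\<dots> \<le> ?m + ?m" by (intro add_mono) auto
  finally have "\<bar>b\<bar> powr p \<le> (2 * ?m) powr p" using assms by (intro powr_mono2) auto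
  also have "\<dots> = 2 powr p * ?m powr p" by (simp add: powr_mult)
  also have "\<dots> \<le> 2 powr p * (\<bar>a\<bar> powr p + \<bar>a - b\<bar> powr p)"
    by (intro mult_left_mono) (auto simp: max_def)
  finally show ?thesis .
qed

lemma ennreal_powr_triangle:
  fixes a b p :: real
  assumes "1 \<le> p"
  shows "ennreal (\<bar>b\<bar> powr p) \<le> ennreal (2 powr p) * (ennreal (\<bar>a\<bar> powr p) + ennreal (\<bar>a - b\<bar> powr p))"
  using ennreal_leI[OF powr_triangle[OF assms, of b a]] by (simp add: ennreal_mult)

lemma insert_Suc_atLeastAtMost: "insert (Suc t) {1..t} = {1..Suc t}"
  by auto

lemma coords_upd:
  "x \<in> space (coords {1..t}) \<Longrightarrow> x(Suc t := a) \<in> space (coords {1..Suc t})"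
  by (auto simp: space_PiM PiE_def extensional_def)

text \<open>The conditional expectation of \<open>\<Sum>s>t. \<bar>x\<^sub>s\<bar>\<^sup>p\<close> given \<open>x\<^sub>1\<^sub>:\<^sub>t\<close>, plus \<open>1\<close>.\<close>

function tail_moment :: "real \<Rightarrow> nat \<Rightarrow> (nat \<Rightarrow> (nat \<Rightarrow> real) \<Rightarrow> real measure) \<Rightarrow> nat \<Rightarrow> (nat \<Rightarrow> real) \<Rightarrow> ennreal" where
  "tail_moment p N \<kappa> t x =
     (if N \<le> t then 1
      else \<integral>\<^sup>+ a. ennreal (\<bar>a\<bar> powr p) + tail_moment p N \<kappa> (Suc t) (x(Suc t := a)) \<partial>\<kappa> t x)"
  by auto
termination by (relation "Wellfounded.measure (\<lambda>(p, N, \<kappa>, t, x). N - t)") auto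
declare tail_moment.simps [simp del]

lemma measurable_tail_moment:
  assumes "\<And>t. t < N \<Longrightarrow> \<kappa> t \<in> coords {1..t} \<rightarrow>\<^sub>M prob_algebra borel" "t \<le> N"
  shows "tail_moment p N \<kappa> t \<in> borel_measurable (coords {1..t})"
  using assms(2)
proof (induction rule: inc_induct)
  case base
  then show ?case by (simp add: tail_moment.simps[abs_def])
next
  case (step t)
  have T: "(\<lambda>z. (fst z)(Suc t := snd z)) \<in> coords {1..t} \<Otimes>\<^sub>M borel \<rightarrow>\<^sub>M coords {1..Suc t}"
    by (rule measurable_coords_upd[OF insert_Suc_atLeastAtMost]) measurable
  have "(\<lambda>z. ennreal (\<bar>snd z\<bar> powr p) + tail_moment p N \<kappa> (Suc t) ((fst z)(Suc t := snd z))) \<in>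
      borel_measurable (coords {1..t} \<Otimes>\<^sub>M borel)"
    using measurable_compose[OF T step.IH] by measurable
  then have "(\<lambda>x. \<integral>\<^sup>+ a. ennreal (\<bar>a\<bar> powr p) + tail_moment p N \<kappa> (Suc t) (x(Suc t := a)) \<partial>\<kappa> t x) \<in> borel_measurable (coords {1..t})"
    by (intro nn_integral_measurable_subprob_algebra2[OF _ measurable_prob_algebraD[OF assms(1)[OF step(2)]]])
      (simp add: split_beta')
  then show ?case using step(2) by (subst tail_moment.simps[abs_def]) simp
qed

text \<open>Finitely many competitors, each of cost at most \<open>radius \<delta> k < \<delta>\<close>: the supremum is attained
  and Borel measurable, and the functions increase to \<open>dp_value\<close>.\<close>

definition radius :: "real \<Rightarrow> nat \<Rightarrow> real" where
  "radius \<delta> k = \<delta> * (real k + 1) / (real k + 2)"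

definition competitors ::
  "real \<Rightarrow> real \<Rightarrow> (nat \<Rightarrow> real \<times> real \<Rightarrow> real) \<Rightarrow> nat \<Rightarrow> real measure \<Rightarrow> nat set" where
  "competitors p \<delta> G k \<eta> =
     {i. i \<le> k \<and> displacement p (law_of (G i) \<eta>) \<le> ennreal (radius \<delta> k powr p)}"

function finite_value ::
  "real \<Rightarrow> nat \<Rightarrow> (nat \<Rightarrow> (nat \<Rightarrow> real) \<Rightarrow> real measure) \<Rightarrow> ((nat \<Rightarrow> real) \<Rightarrow> real) \<Rightarrow> real \<Rightarrow>
   (nat \<Rightarrow> real \<times> real \<Rightarrow> real) \<Rightarrow> nat \<Rightarrow> nat \<Rightarrow> (nat \<Rightarrow> real) \<Rightarrow> (nat \<Rightarrow> real) \<Rightarrow> ereal"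
where
  "finite_value p N \<kappa> f \<delta> G k t x y =
     (if N \<le> t then ereal (f y)
      else SUP i \<in> competitors p \<delta> G k (\<kappa> t x).
        ext_integral (law_of (G i) (\<kappa> t x))
          (\<lambda>(a, b). finite_value p N \<kappa> f \<delta> G k (Suc t) (x(Suc t := a)) (y(Suc t := b))))"
  by auto
termination by (relation "Wellfounded.measure (\<lambda>(p, N, \<kappa>, f, \<delta>, G, k, t, x, y). N - t)") auto
declare finite_value.simps [simp del]

text \<open>Finiteness of the tail moment is demanded at every past, so that the comparisons below
  hold pointwise and not merely up to null sets. A given disintegration provides it almost
  everywhere; \<open>tame\<close> repairs the rest.\<close>

locale dp_setting =
  fixes p \<delta> C :: real and N :: nat and \<kappa> :: "nat \<Rightarrow> (nat \<Rightarrow> real) \<Rightarrow> real measure"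
    and f :: "(nat \<Rightarrow> real) \<Rightarrow> real" and G :: "nat \<Rightarrow> real \<times> real \<Rightarrow> real" and dc :: "nat \<Rightarrow> real \<Rightarrow> real"
  assumes p: "1 \<le> p" and \<delta>: "0 < \<delta>" and C: "0 < C"
    and \<kappa>: "\<And>t. t < N \<Longrightarrow> \<kappa> t \<in> coords {1..t} \<rightarrow>\<^sub>M prob_algebra borel"
    and moment: "\<And>t x. t \<le> N \<Longrightarrow> x \<in> space (coords {1..t}) \<Longrightarrow> tail_moment p N \<kappa> t x < \<infinity>"
    and f_meas: "f \<in> borel_measurable (coords {1..N})"
    and f_lsc: "\<And>y yn. y \<in> space (coords {1..N}) \<Longrightarrow> (\<And>n. yn n \<in> space (coords {1..N})) \<Longrightarrow>
      (\<And>s. s \<in> {1..N} \<Longrightarrow> (\<lambda>n. yn n s) \<longlonglongrightarrow> y s) \<Longrightarrow> ereal (f y) \<le> liminf (\<lambda>n. ereal (f (yn n)))"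
    and f_lower: "\<And>y. y \<in> space (coords {1..N}) \<Longrightarrow> - C * (1 + (\<Sum>s=1..N. \<bar>y s\<bar> powr p)) \<le> f y"
    and coding: "coding_family G dc" and dense: "gain_dense p G"
begin

abbreviation V :: "nat \<Rightarrow> (nat \<Rightarrow> real) \<Rightarrow> (nat \<Rightarrow> real) \<Rightarrow> ereal" where
  "V \<equiv> dp_value p N \<kappa> f \<delta>"

abbreviation W :: "nat \<Rightarrow> nat \<Rightarrow> (nat \<Rightarrow> real) \<Rightarrow> (nat \<Rightarrow> real) \<Rightarrow> ereal" where
  "W \<equiv> finite_value p N \<kappa> f \<delta> G"

abbreviation mom :: "nat \<Rightarrow> (nat \<Rightarrow> real) \<Rightarrow> ennreal" where
  "mom \<equiv> tail_moment p N \<kappa>"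

text \<open>Up to sign, the lower bound for the value at time t obtained from the growth bound on f
  by letting y follow x from time t on.\<close>

definition Lb :: "nat \<Rightarrow> (nat \<Rightarrow> real) \<Rightarrow> (nat \<Rightarrow> real) \<Rightarrow> ennreal" where
  "Lb t x y = ennreal C * (mom t x + (\<Sum>s=1..t. ennreal (\<bar>y s\<bar> powr p)))"

lemma G_meas [measurable]: "G i \<in> borel_measurable (borel \<Otimes>\<^sub>M borel)"
  and dc_meas [measurable]: "dc i \<in> borel_measurable borel"
  and dc_G: "dc i (G i z) = fst z"
  and G0: "G 0 = fst"
  using coding unfolding coding_family_def by blast+

lemma kernel:
  assumes "t < N" "x \<in> space (coords {1..t})"
  shows "prob_space (\<kappa> t x)" "sets (\<kappa> t x) = sets borel" "space (\<kappa> t x) = UNIV"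
  using prob_space_kernel[OF \<kappa>[OF assms(1)] assms(2)] by auto

lemma mom_meas: "t \<le> N \<Longrightarrow> mom t \<in> borel_measurable (coords {1..t})"
  by (rule measurable_tail_moment[OF \<kappa>])

lemma mom_Suc_meas:
  assumes "t < N" "x \<in> space (coords {1..t})"
  shows "(\<lambda>a. mom (Suc t) (x(Suc t := a))) \<in> borel_measurable borel"
proof -
  have m: "(\<lambda>a. x(Suc t := a)) \<in> borel \<rightarrow>\<^sub>M coords {1..Suc t}"
    using assms by (intro measurable_coords_upd[OF insert_Suc_atLeastAtMost] measurable_const) auto
  show ?thesis by (rule measurable_compose[OF m mom_meas]) (use assms(1) in simp)
qed

lemma mom_eq:
  assumes "t < N" "x \<in> space (coords {1..t})"
  shows "mom t x = (\<integral>\<^sup>+ a. ennreal (\<bar>a\<bar> powr p) \<partial>\<kappa> t x) + (\<integral>\<^sup>+ a. mom (Suc t) (x(Suc t := a)) \<partial>\<kappa> t x)"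
proof -
  note [measurable] = mom_Suc_meas[OF assms] and [measurable_cong] = kernel(2)[OF assms]
  show ?thesis using assms(1) by (subst tail_moment.simps) (simp add: nn_integral_add)
qed

lemma Lb_meas: "t \<le> N \<Longrightarrow> (\<lambda>z. Lb t (fst z) (snd z)) \<in> borel_measurable (pcoords {1..t})"
proof -
  assume "t \<le> N"
  note [measurable] = mom_meas[OF this]
  have [measurable]: "(\<lambda>z. snd z s) \<in> borel_measurable (pcoords {1..t})" if "s \<in> {1..t}" for s
    using that by (intro measurable_compose[OF measurable_snd measurable_component_singleton]) auto
  show ?thesis unfolding Lb_def by measurable
qed

lemma Lb_upd:
  "Lb (Suc t) (x(Suc t := a)) (y(Suc t := b)) =
    ennreal C * (mom (Suc t) (x(Suc t := a)) + (\<Sum>s=1..t. ennreal (\<bar>y s\<bar> powr p)) + ennreal (\<bar>b\<bar> powr p))"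
proof -
  have "(\<Sum>s=1..Suc t. ennreal (\<bar>(y(Suc t := b)) s\<bar> powr p)) =
      (\<Sum>s=1..t. ennreal (\<bar>y s\<bar> powr p)) + ennreal (\<bar>b\<bar> powr p)"
    by (simp add: sum.cl_ivl_Suc)
  then show ?thesis unfolding Lb_def by (simp add: ac_simps)
qed

lemma Lb_finite:
  assumes "t \<le> N" "x \<in> space (coords {1..t})"
  shows "Lb t x y < \<infinity>"
  unfolding Lb_def using moment[OF assms] by (auto simp: ennreal_mult_less_top)

lemma upd_meas:
  assumes "z \<in> space (pcoords {1..t})"
  shows "(\<lambda>w. pupd z (Suc t) w) \<in> borel \<Otimes>\<^sub>M borel \<rightarrow>\<^sub>M pcoords {1..Suc t}"
  using assms by (intro measurable_pupd[OF insert_Suc_atLeastAtMost] measurable_const) auto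

lemma upd_meas2:
  "(\<lambda>z. pupd (fst z) (Suc t) (snd z)) \<in> pcoords {1..t} \<Otimes>\<^sub>M (borel \<Otimes>\<^sub>M borel) \<rightarrow>\<^sub>M pcoords {1..Suc t}"
  by (intro measurable_pupd[OF insert_Suc_atLeastAtMost]) auto

lemma upd_meas_comp:
  assumes g: "(\<lambda>z. g (fst z) (snd z)) \<in> borel_measurable (pcoords {1..Suc t})"
    and "x \<in> space (coords {1..t})" "y \<in> space (coords {1..t})"
  shows "(\<lambda>z. g (x(Suc t := fst z)) (y(Suc t := snd z))) \<in> borel_measurable (borel \<Otimes>\<^sub>M borel)"
  using measurable_compose[OF upd_meas[of "(x, y)"] g] assms(2,3) by (simp add: pupd_def space_pair_measure)

lemma in_couplings_withinD:
  assumes "t < N" "x \<in> space (coords {1..t})" "\<gamma> \<in> couplings_within p \<delta> (\<kappa> t x)"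
  shows "\<gamma> \<in> space (prob_algebra (borel \<Otimes>\<^sub>M borel))" "distr \<gamma> borel fst = \<kappa> t x"
    "displacement p \<gamma> < ennreal (\<delta> powr p)"
  using assms(3) cost_less_iff[OF p \<delta>, of \<gamma>] by (auto simp: couplings_within_def displacement_def)

lemma second_moment_le:
  assumes "\<gamma> \<in> space (prob_algebra (borel \<Otimes>\<^sub>M borel))" "distr \<gamma> borel fst = \<eta>"
  shows "(\<integral>\<^sup>+ z. ennreal (\<bar>snd z\<bar> powr p) \<partial>\<gamma>) \<le>
    ennreal (2 powr p) * ((\<integral>\<^sup>+ a. ennreal (\<bar>a\<bar> powr p) \<partial>\<eta>) + displacement p \<gamma>)"
proof -
  have [measurable_cong]: "sets \<gamma> = sets (borel \<Otimes>\<^sub>M borel)" using assms(1) by (simp add: space_prob_algebra)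
  have "(\<integral>\<^sup>+ z. ennreal (\<bar>snd z\<bar> powr p) \<partial>\<gamma>) \<le>
    (\<integral>\<^sup>+ z. ennreal (2 powr p) * (ennreal (\<bar>fst z\<bar> powr p) + ennreal (\<bar>fst z - snd z\<bar> powr p)) \<partial>\<gamma>)"
    by (intro nn_integral_mono ennreal_powr_triangle p)
  also have "\<dots> = ennreal (2 powr p) * ((\<integral>\<^sup>+ z. ennreal (\<bar>fst z\<bar> powr p) \<partial>\<gamma>) + displacement p \<gamma>)"
    by (simp add: nn_integral_cmult nn_integral_add displacement_def)
  also have "(\<integral>\<^sup>+ z. ennreal (\<bar>fst z\<bar> powr p) \<partial>\<gamma>) = (\<integral>\<^sup>+ a. ennreal (\<bar>a\<bar> powr p) \<partial>\<eta>)"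
    unfolding assms(2)[symmetric] by (subst nn_integral_distr) auto
  finally show ?thesis .
qed

text \<open>Only the moment of the new y-coordinate calls for the triangle inequality. The other
  terms are enlarged by the same factor 2^p, at least 1, so that the estimate has a form that can be
  iterated in t.\<close>

lemma Lb_step:
  assumes t: "t < N" and x: "x \<in> space (coords {1..t})" and y: "y \<in> space (coords {1..t})"
    and \<gamma>: "\<gamma> \<in> space (prob_algebra (borel \<Otimes>\<^sub>M borel))" "distr \<gamma> borel fst = \<kappa> t x"
  shows "(\<integral>\<^sup>+ z. Lb (Suc t) (x(Suc t := fst z)) (y(Suc t := snd z)) \<partial>\<gamma>) \<le>
    ennreal (2 powr p) * (Lb t x y + ennreal C * displacement p \<gamma>)"
proof -
  interpret \<gamma>: prob_space \<gamma> using \<gamma>(1) by (simp add: space_prob_algebra)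
  have [measurable_cong]: "sets \<gamma> = sets (borel \<Otimes>\<^sub>M borel)" using \<gamma>(1) by (simp add: space_prob_algebra)
  note [measurable] = mom_Suc_meas[OF t x]
  let ?S = "\<Sum>s=1..t. ennreal (\<bar>y s\<bar> powr p)" and ?c = "ennreal (2 powr p)"
  let ?A = "\<integral>\<^sup>+ a. ennreal (\<bar>a\<bar> powr p) \<partial>\<kappa> t x" and ?M = "\<integral>\<^sup>+ a. mom (Suc t) (x(Suc t := a)) \<partial>\<kappa> t x"
  have c: "1 \<le> ?c" using p by (simp add: ge_one_powr_ge_zero)
  have M: "(\<integral>\<^sup>+ z. mom (Suc t) (x(Suc t := fst z)) \<partial>\<gamma>) = ?M"
    unfolding \<gamma>(2)[symmetric] by (subst nn_integral_distr) auto
  have "(\<integral>\<^sup>+ z. Lb (Suc t) (x(Suc t := fst z)) (y(Suc t := snd z)) \<partial>\<gamma>) =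
      ennreal C * (?M + ?S + (\<integral>\<^sup>+ z. ennreal (\<bar>snd z\<bar> powr p) \<partial>\<gamma>))"
    unfolding Lb_upd by (simp add: nn_integral_cmult nn_integral_add M \<gamma>.emeasure_space_1)
  also have "\<dots> \<le> ennreal C * (?c * ?M + ?c * ?S + ?c * (?A + displacement p \<gamma>))"
    using c second_moment_le[OF \<gamma>] mult_right_mono[OF c, of ?M] mult_right_mono[OF c, of ?S]
    by (intro mult_left_mono add_mono) auto
  also have "\<dots> = ?c * (Lb t x y + ennreal C * displacement p \<gamma>)"
    unfolding Lb_def mom_eq[OF t x] by (simp add: algebra_simps)
  finally show ?thesis .
qed

lemma Lb_step_finite:
  assumes "t < N" "x \<in> space (coords {1..t})" "y \<in> space (coords {1..t})"
    "\<gamma> \<in> space (prob_algebra (borel \<Otimes>\<^sub>M borel))" "distr \<gamma> borel fst = \<kappa> t x" "displacement p \<gamma> < \<infinity>"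
  shows "(\<integral>\<^sup>+ z. Lb (Suc t) (x(Suc t := fst z)) (y(Suc t := snd z)) \<partial>\<gamma>) < \<infinity>"
proof -
  have "ennreal (2 powr p) * (Lb t x y + ennreal C * displacement p \<gamma>) < \<infinity>"
    using assms Lb_finite[of t x y] by (auto simp: ennreal_mult_less_top)
  then show ?thesis by (rule le_less_trans[OF Lb_step[OF assms(1-5)]])
qed

lemma law_of_kernel:
  assumes "t < N" "x \<in> space (coords {1..t})"
  shows "law_of (G i) (\<kappa> t x) \<in> space (prob_algebra (borel \<Otimes>\<^sub>M borel))"
    "distr (law_of (G i) (\<kappa> t x)) borel fst = \<kappa> t x"
    "sets (law_of (G i) (\<kappa> t x)) = sets (borel \<Otimes>\<^sub>M borel)"
  using law_of_in_prob_algebra[of "\<kappa> t x" "G i"] distr_law_of_fst[of "\<kappa> t x" "G i"] kernel[OF assms]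
  by (auto simp: law_of_def)

lemma displacement_law_of_fst:
  "displacement p (law_of fst \<eta>) = 0" if "sets \<eta> = sets borel"
  unfolding displacement_def using p by (subst nn_integral_law_of[OF that]) auto

lemma radius_eq: "radius \<delta> k = \<delta> * (1 - inverse (real k + 2))"
  by (simp add: radius_def field_simps)

lemma radius: "0 < radius \<delta> k" "radius \<delta> k < \<delta>" "k \<le> k' \<Longrightarrow> radius \<delta> k \<le> radius \<delta> k'"
proof -
  show "0 < radius \<delta> k" using \<delta> by (simp add: radius_def)
  show "radius \<delta> k < \<delta>" using \<delta> unfolding radius_eq by (simp add: algebra_simps)
  show "radius \<delta> k \<le> radius \<delta> k'" if "k \<le> k'"
    unfolding radius_eq using \<delta> that by (intro mult_left_mono diff_left_mono le_imp_inverse_le) auto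
qed

lemma radius_tendsto: "(\<lambda>k. radius \<delta> k) \<longlonglongrightarrow> \<delta>"
proof -
  have "(\<lambda>k. \<delta> * (1 - inverse (real (k + 2)))) \<longlonglongrightarrow> \<delta> * (1 - 0)"
    by (intro tendsto_intros LIMSEQ_ignore_initial_segment lim_inverse_n)
  moreover have "\<delta> * (1 - inverse (real (k + 2))) = radius \<delta> k" for k
    by (simp add: radius_def field_simps)
  ultimately show ?thesis by simp
qed

lemma zero_competitor:
  assumes "t < N" "x \<in> space (coords {1..t})"
  shows "0 \<in> competitors p \<delta> G k (\<kappa> t x)"
  using displacement_law_of_fst[OF kernel(2)[OF assms]] by (simp add: competitors_def G0)

lemma finite_competitors: "finite (competitors p \<delta> G k \<eta>)"
  by (rule finite_subset[of _ "{..k}"]) (auto simp: competitors_def)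

lemma competitors_mono:
  assumes "k \<le> k'"
  shows "competitors p \<delta> G k \<eta> \<subseteq> competitors p \<delta> G k' \<eta>"
proof -
  have "ennreal (radius \<delta> k powr p) \<le> ennreal (radius \<delta> k' powr p)"
    using radius(1)[of k] radius(3)[OF assms] p by (intro ennreal_leI powr_mono2) auto
  with assms show ?thesis by (auto simp: competitors_def intro: order_trans)
qed

lemma W_step:
  "t < N \<Longrightarrow> W k t x y = (SUP i \<in> competitors p \<delta> G k (\<kappa> t x).
    ext_integral (law_of (G i) (\<kappa> t x)) (\<lambda>z. W k (Suc t) (x(Suc t := fst z)) (y(Suc t := snd z))))"
  by (subst finite_value.simps) (simp add: split_beta')

lemma V_step:
  "t < N \<Longrightarrow> V t x y = (SUP \<gamma> \<in> couplings_within p \<delta> (\<kappa> t x).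
    ext_integral \<gamma> (\<lambda>z. V (Suc t) (x(Suc t := fst z)) (y(Suc t := snd z))))"
  by (subst dp_value.simps) (simp add: split_beta')

lemma W_N: "W k N x y = ereal (f y)"
  by (subst finite_value.simps) simp

lemma V_N: "V N x y = ereal (f y)"
  by (subst dp_value.simps) simp

lemma kernel_meas2:
  assumes "t < N"
  shows "(\<lambda>z. law_of (G i) (\<kappa> t (fst z))) \<in> pcoords {1..t} \<rightarrow>\<^sub>M prob_algebra (borel \<Otimes>\<^sub>M borel)"
proof -
  note [measurable] = \<kappa>[OF assms]
  show ?thesis by measurable
qed

lemma competitors_meas:
  assumes "t < N"
  shows "Measurable.pred (pcoords {1..t}) (\<lambda>z. i \<in> competitors p \<delta> G k (\<kappa> t (fst z)))"
proof -
  note [measurable] = measurable_prob_algebraD[OF kernel_meas2[OF assms]]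
  have [measurable]: "displacement p \<in> borel_measurable (subprob_algebra (borel \<Otimes>\<^sub>M borel))"
    unfolding displacement_def by (rule nn_integral_measurable_subprob_algebra) measurable
  show ?thesis unfolding competitors_def by measurable
qed

lemma W_branch_meas:
  assumes "t < N" "(\<lambda>z. W k (Suc t) (fst z) (snd z)) \<in> borel_measurable (pcoords {1..Suc t})"
  shows "(\<lambda>z. ext_integral (law_of (G i) (\<kappa> t (fst z)))
    (\<lambda>w. W k (Suc t) ((fst z)(Suc t := fst w)) ((snd z)(Suc t := snd w)))) \<in> borel_measurable (pcoords {1..t})"
  using measurable_compose[OF upd_meas2 assms(2)]
  by (intro measurable_ext_integral_kernel[OF kernel_meas2[OF assms(1)]]) (simp add: pupd_def split_beta')

lemma W_meas: "t \<le> N \<Longrightarrow> (\<lambda>z. W k t (fst z) (snd z)) \<in> borel_measurable (pcoords {1..t})"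
proof (induction rule: inc_induct)
  case base
  note [measurable] = f_meas
  show ?case unfolding W_N by measurable
next
  case (step t)
  note [measurable] = W_branch_meas[OF step(2,3)] competitors_meas[OF step(2)]
  \<comment> \<open>The index set of the supremum depends on the past. Giving non-competitors the
    value minus infinity turns it into a countable supremum of measurable functions.\<close>
  have "W k t (fst z) (snd z) = (SUP i. if i \<in> competitors p \<delta> G k (\<kappa> t (fst z))
    then ext_integral (law_of (G i) (\<kappa> t (fst z)))
      (\<lambda>w. W k (Suc t) ((fst z)(Suc t := fst w)) ((snd z)(Suc t := snd w))) else - \<infinity>)" for z
    unfolding W_step[OF step(2)]
  proof (intro antisym SUP_least)
    fix i assume "i \<in> competitors p \<delta> G k (\<kappa> t (fst z))"
    then show "ext_integral (law_of (G i) (\<kappa> t (fst z)))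
        (\<lambda>w. W k (Suc t) ((fst z)(Suc t := fst w)) ((snd z)(Suc t := snd w))) \<le>
      (SUP i. if i \<in> competitors p \<delta> G k (\<kappa> t (fst z))
        then ext_integral (law_of (G i) (\<kappa> t (fst z)))
          (\<lambda>w. W k (Suc t) ((fst z)(Suc t := fst w)) ((snd z)(Suc t := snd w))) else - \<infinity>)"
      by (intro SUP_upper2[of i]) auto
  qed (auto intro: SUP_upper)
  moreover have "(\<lambda>z. SUP i. if i \<in> competitors p \<delta> G k (\<kappa> t (fst z))
    then ext_integral (law_of (G i) (\<kappa> t (fst z)))
      (\<lambda>w. W k (Suc t) ((fst z)(Suc t := fst w)) ((snd z)(Suc t := snd w))) else - \<infinity>) \<in> borel_measurable (pcoords {1..t})"
    by measurable
  ultimately show ?case by simp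
qed

text \<open>The identity transport \<open>G 0\<close> is always a competitor, and under it the
  integral of the next bound is exactly \<open>Lb t x y\<close>: the moment of the new y-coordinate
  equals that of the new x-coordinate.\<close>

lemma W_lower:
  assumes "t \<le> N" "x \<in> space (coords {1..t})" "y \<in> space (coords {1..t})"
  shows "- enn2ereal (Lb t x y) \<le> W k t x y"
  using assms
proof (induction arbitrary: x y rule: inc_induct)
  case base
  have "Lb N x y = ennreal (C * (1 + (\<Sum>s=1..N. \<bar>y s\<bar> powr p)))"
    using C by (simp add: Lb_def tail_moment.simps ennreal_mult sum_nonneg ennreal_plus sum_ennreal)
  then have "enn2ereal (Lb N x y) = ereal (C * (1 + (\<Sum>s=1..N. \<bar>y s\<bar> powr p)))"
    using C by (simp add: enn2ereal_ennreal sum_nonneg)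
  then show ?case using f_lower[OF base(2)] by (simp add: W_N)
next
  case (step t)
  note t = step(2) and x = step(4) and y = step(5)
  let ?L = "\<lambda>z. Lb (Suc t) (x(Suc t := fst z)) (y(Suc t := snd z))"
  have Lm: "?L \<in> borel_measurable (borel \<Otimes>\<^sub>M borel)"
    using Lb_meas[of "Suc t"] t x y by (intro upd_meas_comp) auto
  have "(\<integral>\<^sup>+ z. ?L z \<partial>law_of fst (\<kappa> t x)) = (\<integral>\<^sup>+ a. Lb (Suc t) (x(Suc t := a)) (y(Suc t := a)) \<partial>\<kappa> t x)"
  proof -
    interpret U: prob_space unif by (rule prob_space_unif)
    interpret K: prob_space "\<kappa> t x" by (rule kernel(1)[OF t x])
    note [measurable_cong] = kernel(2)[OF t x]
    have m: "(\<lambda>a. ?L (a, a)) \<in> borel_measurable borel"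
      by (rule measurable_compose[OF _ Lm]) measurable
    then have [measurable]: "(\<lambda>a. Lb (Suc t) (x(Suc t := a)) (y(Suc t := a))) \<in> borel_measurable borel" by simp
    have "(\<integral>\<^sup>+ z. ?L z \<partial>law_of fst (\<kappa> t x)) =
        (\<integral>\<^sup>+ z. Lb (Suc t) (x(Suc t := fst z)) (y(Suc t := fst z)) \<partial>(\<kappa> t x \<Otimes>\<^sub>M unif))"
      using nn_integral_law_of[OF kernel(2)[OF t x] measurable_fst Lm] by simp
    also have "\<dots> = (\<integral>\<^sup>+ a. Lb (Suc t) (x(Suc t := a)) (y(Suc t := a)) \<partial>\<kappa> t x)"
      by (subst U.nn_integral_fst[symmetric]) (auto simp: U.emeasure_space_1[simplified])
    finally show ?thesis .
  qed
  also have "\<dots> = Lb t x y"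
  proof -
    interpret K: prob_space "\<kappa> t x" by (rule kernel(1)[OF t x])
    note [measurable] = mom_Suc_meas[OF t x] and [measurable_cong] = kernel(2)[OF t x]
    have "(\<integral>\<^sup>+ a. Lb (Suc t) (x(Suc t := a)) (y(Suc t := a)) \<partial>\<kappa> t x) =
      ennreal C * ((\<integral>\<^sup>+ a. mom (Suc t) (x(Suc t := a)) \<partial>\<kappa> t x) + (\<Sum>s=1..t. ennreal (\<bar>y s\<bar> powr p)) +
        (\<integral>\<^sup>+ a. ennreal (\<bar>a\<bar> powr p) \<partial>\<kappa> t x))"
      unfolding Lb_upd by (simp add: nn_integral_cmult nn_integral_add K.emeasure_space_1)
    then show ?thesis unfolding Lb_def mom_eq[OF t x] by (simp add: ac_simps)
  qed
  finally have eq: "(\<integral>\<^sup>+ z. ?L z \<partial>law_of (G 0) (\<kappa> t x)) = Lb t x y" unfolding G0 .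
  have "- enn2ereal (\<integral>\<^sup>+ z. ?L z \<partial>law_of (G 0) (\<kappa> t x)) \<le>
      ext_integral (law_of (G 0) (\<kappa> t x)) (\<lambda>z. W k (Suc t) (x(Suc t := fst z)) (y(Suc t := snd z)))"
  proof (rule ext_integral_lower_bound)
    show "?L \<in> borel_measurable (law_of (G 0) (\<kappa> t x))"
      using Lm by (simp add: measurable_cong_sets[OF law_of_kernel(3)[OF t x] refl])
    show "(\<integral>\<^sup>+ z. ?L z \<partial>law_of (G 0) (\<kappa> t x)) < \<infinity>"
      unfolding eq using Lb_finite[of t x y] t x by simp
    show "AE z in law_of (G 0) (\<kappa> t x). - enn2ereal (?L z) \<le> W k (Suc t) (x(Suc t := fst z)) (y(Suc t := snd z))"
      using x y by (intro AE_I2 step.IH coords_upd)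
  qed
  also have "\<dots> \<le> W k t x y"
    unfolding W_step[OF t] by (rule SUP_upper) (rule zero_competitor[OF t x])
  finally show ?case unfolding eq .
qed

lemma W_mono:
  assumes "t \<le> N" "k \<le> k'"
  shows "W k t x y \<le> W k' t x y"
  using assms(1)
proof (induction arbitrary: x y rule: inc_induct)
  case base
  show ?case by (simp add: W_N)
next
  case (step t)
  show ?case
    unfolding W_step[OF step(2)]
    by (intro SUP_mono' SUP_subset_mono competitors_mono assms(2) ext_integral_mono_AE AE_I2 step.IH)
qed

section \<open>The value function as an increasing limit, together with its lower
  semicontinuity\<close>

lemma V_lower:
  assumes "t \<le> N" "x \<in> space (coords {1..t})" "y \<in> space (coords {1..t})"
    and V: "V t x y = (SUP k. W k t x y)"
  shows "- enn2ereal (Lb t x y) \<le> V t x y"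
  unfolding V using W_lower[OF assms(1-3), of 0] by (rule SUP_upper2[OF UNIV_I])

text \<open>The representation as a supremum is a hypothesis because measurability is already used
  inside the backward induction that establishes it.\<close>

lemma V_meas_if:
  assumes "t \<le> N" and V: "\<And>x y. x \<in> space (coords {1..t}) \<Longrightarrow> y \<in> space (coords {1..t}) \<Longrightarrow> V t x y = (SUP k. W k t x y)"
  shows "(\<lambda>z. V t (fst z) (snd z)) \<in> borel_measurable (pcoords {1..t})"
proof -
  note [measurable] = W_meas[OF assms(1)]
  have "(\<lambda>z. V t (fst z) (snd z)) \<in> borel_measurable (pcoords {1..t}) \<longleftrightarrow>
      (\<lambda>z. SUP k. W k t (fst z) (snd z)) \<in> borel_measurable (pcoords {1..t})"
    by (intro measurable_cong V) (auto simp: space_pair_measure)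
  moreover have "(\<lambda>z. SUP k. W k t (fst z) (snd z)) \<in> borel_measurable (pcoords {1..t})" by measurable
  ultimately show ?thesis by blast
qed

text \<open>The past x is held fixed: the kernels are only measurable in x, whereas y enters the
  recursion through the next value function alone.\<close>

definition lsc_at :: "nat \<Rightarrow> bool" where
  "lsc_at t \<longleftrightarrow> (\<forall>x y yn. x \<in> space (coords {1..t}) \<longrightarrow> y \<in> space (coords {1..t}) \<longrightarrow>
     (\<forall>n. yn n \<in> space (coords {1..t})) \<longrightarrow> (\<forall>s\<in>{1..t}. (\<lambda>n. yn n s) \<longlonglongrightarrow> y s) \<longrightarrow>
     V t x y \<le> liminf (\<lambda>n. V t x (yn n)))"

text \<open>A coupling whose gain strictly exceeds the right-hand side would pass this excess to
  some transport \<open>G i\<close>, then by monotone convergence to a finite level of the next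
  value function, and finally to a level at which i is a competitor, which is absurd.\<close>

lemma V_le_SUP_W:
  assumes t: "t < N" and x: "x \<in> space (coords {1..t})" and y: "y \<in> space (coords {1..t})"
    and V: "\<And>x y. x \<in> space (coords {1..Suc t}) \<Longrightarrow> y \<in> space (coords {1..Suc t}) \<Longrightarrow> V (Suc t) x y = (SUP k. W k (Suc t) x y)"
    and lsc: "lsc_at (Suc t)"
  shows "V t x y \<le> (SUP k. W k t x y)"
  unfolding V_step[OF t]
proof (rule SUP_least, rule ccontr)
  fix \<gamma> assume \<gamma>: "\<gamma> \<in> couplings_within p \<delta> (\<kappa> t x)"
  let ?v = "\<lambda>z. V (Suc t) (x(Suc t := fst z)) (y(Suc t := snd z))"
  let ?w = "\<lambda>k z. W k (Suc t) (x(Suc t := fst z)) (y(Suc t := snd z))"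
  let ?\<alpha> = "SUP k. W k t x y"
  let ?S = "\<Sum>s=1..t. ennreal (\<bar>y s\<bar> powr p)"
  let ?L = "\<lambda>z. Lb (Suc t) (x(Suc t := fst z)) (y(Suc t := snd z))"
  assume "\<not> ext_integral \<gamma> ?v \<le> ?\<alpha>"
  then have less: "?\<alpha> < ext_integral \<gamma> ?v" by simp
  note \<gamma>' = in_couplings_withinD[OF t x \<gamma>]
  interpret K: prob_space "\<kappa> t x" by (rule kernel(1)[OF t x])
  note [measurable] = mom_Suc_meas[OF t x] and [measurable_cong] = kernel(2)[OF t x]
  have vm: "?v \<in> borel_measurable (borel \<Otimes>\<^sub>M borel)"
    using V_meas_if[OF _ V] t x y by (intro upd_meas_comp) auto
  \<comment> \<open>The next bound involves |b|^p. The triangle inequality splits it into a part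
    depending on a alone, collected here, and a multiple of |a - b|^p; this explains the constant C
    * 2^p below.\<close>
  let ?\<beta> = "\<lambda>a. ennreal C * (mom (Suc t) (x(Suc t := a)) + ?S + ennreal (2 powr p) * ennreal (\<bar>a\<bar> powr p))"
  have "\<exists>i. displacement p (law_of (G i) (\<kappa> t x)) < ennreal (\<delta> powr p) \<and> ?\<alpha> < ext_integral (law_of (G i) (\<kappa> t x)) ?v"
  proof (rule dense[unfolded gain_dense_def, rule_format, OF \<gamma>'(1,2) vm _ _ _ _ \<gamma>'(3) less, where \<beta>="?\<beta>" and c="C * 2 powr p"])
    show "?\<beta> \<in> borel_measurable borel" by measurable
    have fin: "(\<integral>\<^sup>+ a. ennreal (\<bar>a\<bar> powr p) \<partial>\<kappa> t x) < \<infinity>" "(\<integral>\<^sup>+ a. mom (Suc t) (x(Suc t := a)) \<partial>\<kappa> t x) < \<infinity>"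
      using moment[of t x] t x unfolding mom_eq[OF t x] by auto
    then show "(\<integral>\<^sup>+ a. ?\<beta> a \<partial>\<kappa> t x) < \<infinity>"
      by (simp add: nn_integral_cmult nn_integral_add K.emeasure_space_1 ennreal_mult_less_top)
    show "- enn2ereal (?\<beta> a + ennreal (C * 2 powr p) * ennreal (\<bar>a - b\<bar> powr p)) \<le> ?v (a, b)" for a b
    proof -
      have "?L (a, b) \<le> ennreal C * (mom (Suc t) (x(Suc t := a)) + ?S + ennreal (2 powr p) * (ennreal (\<bar>a\<bar> powr p) + ennreal (\<bar>a - b\<bar> powr p)))"
        unfolding fst_conv snd_conv Lb_upd by (intro mult_left_mono add_mono ennreal_powr_triangle p) auto
      also have "\<dots> = ?\<beta> a + ennreal (C * 2 powr p) * ennreal (\<bar>a - b\<bar> powr p)"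
        using C by (simp add: ennreal_mult algebra_simps)
      finally have "- enn2ereal (?\<beta> a + ennreal (C * 2 powr p) * ennreal (\<bar>a - b\<bar> powr p)) \<le> - enn2ereal (?L (a, b))"
        by (simp add: less_eq_ennreal.rep_eq)
      also have "\<dots> \<le> ?v (a, b)"
        using t coords_upd[OF x, of a] coords_upd[OF y, of b] V by (intro V_lower) auto
      finally show ?thesis .
    qed
    show "?v (a, b) \<le> liminf (\<lambda>n. ?v (a, bn n))" if "bn \<longlonglongrightarrow> b" for a b bn
      using lsc[unfolded lsc_at_def, rule_format, OF coords_upd[OF x, of a] coords_upd[OF y, of b] coords_upd[OF y, of "bn _"]] that
      by auto
  qed
  then obtain i where i: "displacement p (law_of (G i) (\<kappa> t x)) < ennreal (\<delta> powr p)"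
    "?\<alpha> < ext_integral (law_of (G i) (\<kappa> t x)) ?v" by blast
  note l = law_of_kernel[OF t x, of i]
  have "ext_integral (law_of (G i) (\<kappa> t x)) ?v = ext_integral (law_of (G i) (\<kappa> t x)) (\<lambda>z. SUP k. ?w k z)"
    using V coords_upd[OF x] coords_upd[OF y] by simp
  also have "\<dots> \<le> (SUP k. ext_integral (law_of (G i) (\<kappa> t x)) (?w k))"
  proof (rule ext_integral_SUP_le)
    show "?w k \<in> borel_measurable (law_of (G i) (\<kappa> t x))" for k
      unfolding measurable_cong_sets[OF l(3) refl] using W_meas[of "Suc t" k] t x y by (intro upd_meas_comp) auto
    show "?L \<in> borel_measurable (law_of (G i) (\<kappa> t x))"
      unfolding measurable_cong_sets[OF l(3) refl] using Lb_meas[of "Suc t"] t x y by (intro upd_meas_comp) auto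
    show "(\<integral>\<^sup>+ z. ?L z \<partial>law_of (G i) (\<kappa> t x)) < \<infinity>"
      using i(1) by (intro Lb_step_finite t x y l) (auto intro: less_le_trans)
    show "AE z in law_of (G i) (\<kappa> t x). \<forall>k. - enn2ereal (?L z) \<le> ?w k z"
      using t x y by (intro AE_I2 allI W_lower coords_upd) auto
    show "AE z in law_of (G i) (\<kappa> t x). incseq (\<lambda>k. ?w k z)"
      using t by (intro AE_I2 incseq_SucI W_mono) auto
  qed
  finally have "?\<alpha> < (SUP k. ext_integral (law_of (G i) (\<kappa> t x)) (?w k))" using i(2) by simp
  then obtain k where k: "?\<alpha> < ext_integral (law_of (G i) (\<kappa> t x)) (?w k)" by (auto simp: less_SUP_iff)
  \<comment> \<open>The transport found has cost strictly below \<delta>, so the radii, which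
    increase to \<delta>, eventually admit it.\<close>
  have "\<exists>k1. \<forall>k\<ge>k1. displacement p (law_of (G i) (\<kappa> t x)) \<le> ennreal (radius \<delta> k powr p)"
  proof -
    have "(\<lambda>k. ennreal (radius \<delta> k powr p)) \<longlonglongrightarrow> ennreal (\<delta> powr p)"
      using \<delta> by (intro tendsto_ennrealI tendsto_powr tendsto_const radius_tendsto) auto
    then have "\<forall>\<^sub>F k in sequentially. displacement p (law_of (G i) (\<kappa> t x)) < ennreal (radius \<delta> k powr p)"
      using i(1) by (rule order_tendstoD)
    then show ?thesis by (auto simp: eventually_sequentially intro: less_imp_le)
  qed
  then obtain k1 where k1: "\<And>k. k1 \<le> k \<Longrightarrow> displacement p (law_of (G i) (\<kappa> t x)) \<le> ennreal (radius \<delta> k powr p)" by blast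
  \<comment> \<open>Large enough for the gain to persist, for the radius to admit the cost, and for
    the index i to be in range.\<close>
  let ?k = "max k (max k1 i)"
  have "ext_integral (law_of (G i) (\<kappa> t x)) (?w k) \<le> ext_integral (law_of (G i) (\<kappa> t x)) (?w ?k)"
    using t by (intro ext_integral_mono_AE AE_I2 W_mono) auto
  also have "\<dots> \<le> W ?k t x y"
    unfolding W_step[OF t] using k1[of ?k] by (intro SUP_upper) (auto simp: competitors_def)
  also have "\<dots> \<le> ?\<alpha>" by (rule SUP_upper) simp
  finally show False using k by simp
qed

lemma SUP_W_le_V:
  assumes t: "t < N" and x: "x \<in> space (coords {1..t})" and y: "y \<in> space (coords {1..t})"
    and V: "\<And>x y. x \<in> space (coords {1..Suc t}) \<Longrightarrow> y \<in> space (coords {1..Suc t}) \<Longrightarrow> V (Suc t) x y = (SUP k. W k (Suc t) x y)"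
  shows "(SUP k. W k t x y) \<le> V t x y"
  unfolding W_step[OF t]
proof (intro SUP_least)
  fix k i assume i: "i \<in> competitors p \<delta> G k (\<kappa> t x)"
  note l = law_of_kernel[OF t x, of i]
  have "displacement p (law_of (G i) (\<kappa> t x)) \<le> ennreal (radius \<delta> k powr p)"
    using i by (simp add: competitors_def)
  also have "\<dots> < ennreal (\<delta> powr p)"
    using radius[of k] p \<delta> by (intro ennreal_lessI powr_less_mono2) auto
  finally have "law_of (G i) (\<kappa> t x) \<in> couplings_within p \<delta> (\<kappa> t x)"
    using l cost_less_iff[OF p \<delta>, of "law_of (G i) (\<kappa> t x)"] by (auto simp: couplings_within_def displacement_def)
  moreover have "ext_integral (law_of (G i) (\<kappa> t x)) (\<lambda>z. W k (Suc t) (x(Suc t := fst z)) (y(Suc t := snd z))) \<le>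
      ext_integral (law_of (G i) (\<kappa> t x)) (\<lambda>z. V (Suc t) (x(Suc t := fst z)) (y(Suc t := snd z)))"
    using V coords_upd[OF x] coords_upd[OF y] by (intro ext_integral_mono_AE AE_I2) (auto intro: SUP_upper)
  ultimately show "ext_integral (law_of (G i) (\<kappa> t x)) (\<lambda>z. W k (Suc t) (x(Suc t := fst z)) (y(Suc t := snd z))) \<le> V t x y"
    unfolding V_step[OF t] by (rule SUP_upper2)
qed

text \<open>The admissible couplings at time t depend on x but not on y, so a coupling that beats
  \<alpha> at y remains admissible along the sequence, and Fatou's lemma preserves the strict
  gain.\<close>

lemma lsc_at_step:
  assumes t: "t < N"
    and V: "\<And>x y. x \<in> space (coords {1..Suc t}) \<Longrightarrow> y \<in> space (coords {1..Suc t}) \<Longrightarrow> V (Suc t) x y = (SUP k. W k (Suc t) x y)"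
    and lsc: "lsc_at (Suc t)"
  shows "lsc_at t"
  unfolding lsc_at_def le_Liminf_iff
proof (intro allI impI)
  fix x y yn \<alpha>
  assume x: "x \<in> space (coords {1..t})" and y: "y \<in> space (coords {1..t})"
    and yn: "\<forall>n. yn n \<in> space (coords {1..t})" and lim: "\<forall>s\<in>{1..t}. (\<lambda>n. yn n s) \<longlonglongrightarrow> y s"
    and "\<alpha> < V t x y"
  then obtain \<gamma> where \<gamma>: "\<gamma> \<in> couplings_within p \<delta> (\<kappa> t x)"
    and less: "\<alpha> < ext_integral \<gamma> (\<lambda>z. V (Suc t) (x(Suc t := fst z)) (y(Suc t := snd z)))"
    unfolding V_step[OF t] by (auto simp: less_SUP_iff)
  note \<gamma>' = in_couplings_withinD[OF t x \<gamma>]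
  interpret \<gamma>: prob_space \<gamma> using \<gamma>'(1) by (simp add: space_prob_algebra)
  have s\<gamma>: "sets \<gamma> = sets (borel \<Otimes>\<^sub>M borel)" using \<gamma>'(1) by (simp add: space_prob_algebra)
  have "(\<lambda>n. \<Sum>s=1..t. \<bar>yn n s\<bar> powr p) \<longlonglongrightarrow> (\<Sum>s=1..t. \<bar>y s\<bar> powr p)"
    using lim p by (intro tendsto_sum tendsto_powr' tendsto_rabs tendsto_const) auto
  then have "Bseq (\<lambda>n. \<Sum>s=1..t. \<bar>yn n s\<bar> powr p)" by (intro convergent_imp_Bseq convergentI)
  then obtain M where M: "\<And>n. \<bar>\<Sum>s=1..t. \<bar>yn n s\<bar> powr p\<bar> \<le> M" by (auto simp: Bseq_def)
  \<comment> \<open>M bounds the moments of the convergent pasts of y; adding C * M to the bound at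
    y gives a minorant common to the limit and the whole sequence.\<close>
  define L where "L z = Lb (Suc t) (x(Suc t := fst z)) (y(Suc t := snd z)) + ennreal C * ennreal M" for z
  have Lm: "(\<lambda>z. Lb (Suc t) (x(Suc t := fst z)) (y(Suc t := snd z))) \<in> borel_measurable \<gamma>"
    unfolding measurable_cong_sets[OF s\<gamma> refl] using Lb_meas[of "Suc t"] t x y by (intro upd_meas_comp) auto
  have vm: "(\<lambda>z. V (Suc t) (x(Suc t := fst z)) (y(Suc t := snd z))) \<in> borel_measurable \<gamma>"
    if "y \<in> space (coords {1..t})" for y
    unfolding measurable_cong_sets[OF s\<gamma> refl] using V_meas_if[OF _ V] t x that by (intro upd_meas_comp) auto
  have lb: "- enn2ereal (Lb (Suc t) (x(Suc t := a)) (y(Suc t := b))) \<le> V (Suc t) (x(Suc t := a)) (y(Suc t := b))"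
    if "y \<in> space (coords {1..t})" for y a b
    using t coords_upd[OF x, of a] coords_upd[OF that, of b] V by (intro V_lower) auto
  have "\<forall>\<^sub>F n in sequentially. \<alpha> < ext_integral \<gamma> (\<lambda>z. V (Suc t) (x(Suc t := fst z)) ((yn n)(Suc t := snd z)))"
  proof (rule ext_integral_Fatou[OF vm[OF y] vm _ _ _ _ _ less, where L=L])
    show "yn n \<in> space (coords {1..t})" for n using yn by simp
    show "L \<in> borel_measurable \<gamma>" unfolding L_def using Lm by measurable
    have "(\<integral>\<^sup>+ z. Lb (Suc t) (x(Suc t := fst z)) (y(Suc t := snd z)) \<partial>\<gamma>) < \<infinity>"
      using \<gamma>'(3) by (intro Lb_step_finite t x y \<gamma>') (auto intro: less_le_trans)
    then show "(\<integral>\<^sup>+ z. L z \<partial>\<gamma>) < \<infinity>"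
      unfolding L_def using Lm by (simp add: nn_integral_add \<gamma>.emeasure_space_1 ennreal_mult_less_top)
    show "AE z in \<gamma>. \<forall>n. - enn2ereal (L z) \<le> V (Suc t) (x(Suc t := fst z)) ((yn n)(Suc t := snd z))"
    proof (intro AE_I2 allI)
      fix z n
      have "(\<Sum>s=1..t. ennreal (\<bar>yn n s\<bar> powr p)) \<le> ennreal M"
        using M[of n] by (simp add: sum_ennreal ennreal_leI)
      then have "Lb (Suc t) (x(Suc t := fst z)) ((yn n)(Suc t := snd z)) \<le>
          ennreal C * (mom (Suc t) (x(Suc t := fst z)) + ennreal M + ennreal (\<bar>snd z\<bar> powr p))"
        unfolding Lb_upd by (intro mult_left_mono add_mono) auto
      also have "\<dots> \<le> ennreal C * (mom (Suc t) (x(Suc t := fst z)) + (\<Sum>s=1..t. ennreal (\<bar>y s\<bar> powr p)) + ennreal (\<bar>snd z\<bar> powr p)) + ennreal C * ennreal M"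
        by (simp add: algebra_simps)
      also have "\<dots> = L z" by (simp add: L_def Lb_upd)
      finally have "- enn2ereal (L z) \<le> - enn2ereal (Lb (Suc t) (x(Suc t := fst z)) ((yn n)(Suc t := snd z)))"
        by (simp add: less_eq_ennreal.rep_eq)
      also have "\<dots> \<le> V (Suc t) (x(Suc t := fst z)) ((yn n)(Suc t := snd z))"
        using yn by (intro lb) simp
      finally show "- enn2ereal (L z) \<le> V (Suc t) (x(Suc t := fst z)) ((yn n)(Suc t := snd z))" .
    qed
    show "AE z in \<gamma>. - enn2ereal (L z) \<le> V (Suc t) (x(Suc t := fst z)) (y(Suc t := snd z))"
    proof (intro AE_I2)
      fix z
      have "- enn2ereal (L z) \<le> - enn2ereal (Lb (Suc t) (x(Suc t := fst z)) (y(Suc t := snd z)))"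
        by (simp add: L_def flip: less_eq_ennreal.rep_eq)
      also have "\<dots> \<le> V (Suc t) (x(Suc t := fst z)) (y(Suc t := snd z))"
        by (rule lb[OF y])
      finally show "- enn2ereal (L z) \<le> \<dots>" .
    qed
    show "AE z in \<gamma>. V (Suc t) (x(Suc t := fst z)) (y(Suc t := snd z)) \<le>
        liminf (\<lambda>n. V (Suc t) (x(Suc t := fst z)) ((yn n)(Suc t := snd z)))"
      using lsc[unfolded lsc_at_def, rule_format, OF coords_upd[OF x] coords_upd[OF y] coords_upd] yn lim
      by (intro AE_I2) auto
  qed
  then show "\<forall>\<^sub>F n in sequentially. \<alpha> < V t x (yn n)"
  proof eventually_elim
    case (elim n)
    also have "ext_integral \<gamma> (\<lambda>z. V (Suc t) (x(Suc t := fst z)) ((yn n)(Suc t := snd z))) \<le> V t x (yn n)"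
      unfolding V_step[OF t] by (rule SUP_upper[OF \<gamma>])
    finally show ?case .
  qed
qed

text \<open>The two assertions are proved jointly: the representation at t uses lower semicontinuity
  at t + 1, and each step of lower semicontinuity uses the measurability that comes from the
  representation.\<close>

lemma V_eq_SUP_W_and_lsc:
  assumes "t \<le> N"
  shows "(\<forall>x\<in>space (coords {1..t}). \<forall>y\<in>space (coords {1..t}). V t x y = (SUP k. W k t x y)) \<and> lsc_at t"
  using assms
proof (induction rule: inc_induct)
  case base
  show ?case using f_lsc by (auto simp: V_N W_N lsc_at_def)
next
  case (step t)
  then have V: "\<And>x y. x \<in> space (coords {1..Suc t}) \<Longrightarrow> y \<in> space (coords {1..Suc t}) \<Longrightarrow> V (Suc t) x y = (SUP k. W k (Suc t) x y)"
    and lsc: "lsc_at (Suc t)" by auto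
  show ?case
    using V_le_SUP_W[OF step(2) _ _ V lsc] SUP_W_le_V[OF step(2) _ _ V] lsc_at_step[OF step(2) V lsc]
    by (auto intro: antisym)
qed

lemma V_eq_SUP_W: "t \<le> N \<Longrightarrow> x \<in> space (coords {1..t}) \<Longrightarrow> y \<in> space (coords {1..t}) \<Longrightarrow> V t x y = (SUP k. W k t x y)"
  using V_eq_SUP_W_and_lsc by blast

end

section \<open>Measures on pairs of paths\<close>

abbreviation past :: "nat \<Rightarrow> path_pair \<Rightarrow> path_pair" where
  "past t \<omega> \<equiv> prestrict \<omega> {1..t}"

definition pair_disintegration ::
  "nat \<Rightarrow> path_pair measure \<Rightarrow> (nat \<Rightarrow> path_pair \<Rightarrow> (real \<times> real) measure) \<Rightarrow> bool"
where
  "pair_disintegration N \<gamma> k \<longleftrightarrow> \<gamma> \<in> space (prob_algebra (pcoords {1..N})) \<and>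
     (\<forall>t<N. is_cond_law \<gamma> (\<lambda>\<omega>. past t \<omega>) (pcoords {1..t})
       (\<lambda>\<omega>. pstep \<omega> (Suc t)) (borel \<Otimes>\<^sub>M borel) (k t))"

lemma pair_disintegrationD:
  assumes "pair_disintegration N \<gamma> k"
  shows "prob_space \<gamma>" "sets \<gamma> = sets (pcoords {1..N})"
    "t \<le> N \<Longrightarrow> (\<lambda>\<omega>. past t \<omega>) \<in> \<gamma> \<rightarrow>\<^sub>M pcoords {1..t}"
    "t < N \<Longrightarrow> (\<lambda>\<omega>. pstep \<omega> (Suc t)) \<in> \<gamma> \<rightarrow>\<^sub>M borel \<Otimes>\<^sub>M borel"
    "t < N \<Longrightarrow> is_cond_law \<gamma> (\<lambda>\<omega>. past t \<omega>) (pcoords {1..t})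
       (\<lambda>\<omega>. pstep \<omega> (Suc t)) (borel \<Otimes>\<^sub>M borel) (k t)"
proof -
  show "prob_space \<gamma>" and s: "sets \<gamma> = sets (pcoords {1..N})"
    using assms by (auto simp: pair_disintegration_def space_prob_algebra)
  show "t \<le> N \<Longrightarrow> (\<lambda>\<omega>. past t \<omega>) \<in> \<gamma> \<rightarrow>\<^sub>M pcoords {1..t}"
    unfolding measurable_cong_sets[OF s refl] by (intro measurable_prestrict) auto
  show "t < N \<Longrightarrow> (\<lambda>\<omega>. pstep \<omega> (Suc t)) \<in> \<gamma> \<rightarrow>\<^sub>M borel \<Otimes>\<^sub>M borel"
    unfolding measurable_cong_sets[OF s refl] by (intro measurable_pstep) auto
  show "t < N \<Longrightarrow> is_cond_law \<gamma> (\<lambda>\<omega>. past t \<omega>) (pcoords {1..t})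
       (\<lambda>\<omega>. pstep \<omega> (Suc t)) (borel \<Otimes>\<^sub>M borel) (k t)"
    using assms by (auto simp: pair_disintegration_def)
qed

lemma prestrict_Suc: "past (Suc t) \<omega> = pupd (past t \<omega>) (Suc t) (pstep \<omega> (Suc t))"
  by (auto simp: prestrict_def pupd_def pstep_def fun_eq_iff)

lemma prestrict_0: "past 0 \<omega> = (\<lambda>_. undefined, \<lambda>_. undefined)"
  by (auto simp: prestrict_def)

lemma prestrict_pupd:
  "t \<le> n \<Longrightarrow> prestrict (pupd \<omega> (Suc n) z) {1..t} = past t \<omega>"
  by (auto simp: prestrict_def pupd_def fun_eq_iff)

lemma pstep_pupd: "pstep (pupd \<omega> t z) s = (if s = t then z else pstep \<omega> s)"
  by (auto simp: pstep_def pupd_def)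

text \<open>The finite-horizon form of the Ionescu-Tulcea construction: the measure is extended by
  one pair drawn from the last kernel. Integrals over the past are unaffected, so the earlier
  conditional laws persist.\<close>

lemma ex_pair_disintegration:
  assumes k: "\<And>t. t < N \<Longrightarrow> k t \<in> pcoords {1..t} \<rightarrow>\<^sub>M prob_algebra (borel \<Otimes>\<^sub>M borel)"
  shows "\<exists>\<gamma>. pair_disintegration N \<gamma> k"
  using k
proof (induction N)
  case 0
  have "return (pcoords {1..0}) (\<lambda>_. undefined, \<lambda>_. undefined) \<in> space (prob_algebra (pcoords {1..0}))"
    by (auto simp: space_prob_algebra space_pair_measure space_PiM intro!: prob_space_return)
  then show ?case unfolding pair_disintegration_def by blast
next
  case (Suc n)
  let ?B = "borel \<Otimes>\<^sub>M borel :: (real \<times> real) measure"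
  obtain \<gamma> where \<gamma>: "pair_disintegration n \<gamma> k" using Suc by auto
  note P = pair_disintegrationD[OF \<gamma>]
  have \<gamma>': "\<gamma> \<in> space (prob_algebra (pcoords {1..n}))" using \<gamma> by (simp add: pair_disintegration_def)
  note km = Suc.prems[OF lessI]
  note [measurable] = km measurable_prob_algebraD[OF km]
  let ?K = "\<lambda>\<omega>. distr (k n \<omega>) (pcoords {1..Suc n}) (pupd \<omega> (Suc n))"
  have um[measurable]: "(\<lambda>z. pupd (fst z) (Suc n) (snd z)) \<in> pcoords {1..n} \<Otimes>\<^sub>M ?B \<rightarrow>\<^sub>M pcoords {1..Suc n}"
    by (rule measurable_pupd[OF insert_Suc_atLeastAtMost]) measurable
  have Km: "?K \<in> pcoords {1..n} \<rightarrow>\<^sub>M prob_algebra (pcoords {1..Suc n})"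
    by (rule measurable_distr_prob_space2[OF km]) (use um in \<open>simp add: split_beta'\<close>)
  define \<gamma>1 where "\<gamma>1 = \<gamma> \<bind> ?K"
  have s1: "\<gamma>1 \<in> space (prob_algebra (pcoords {1..Suc n}))"
    unfolding \<gamma>1_def space_prob_algebra using sets_bind'[OF \<gamma>' Km] prob_space_bind'[OF \<gamma>' Km] by auto
  then have s1': "sets \<gamma>1 = sets (pcoords {1..Suc n})" by (simp add: space_prob_algebra)
  have kn: "prob_space (k n \<omega>)" "sets (k n \<omega>) = sets ?B" if "\<omega> \<in> space \<gamma>" for \<omega>
    using prob_space_kernel[OF km] that sets_eq_imp_space_eq[OF P(2)] by auto
  \<comment> \<open>Integration against the extended measure is integration over the new pair
    followed by integration over the old paths; every later computation reduces to it.\<close>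
  have nn: "(\<integral>\<^sup>+ \<omega>. h \<omega> \<partial>\<gamma>1) = (\<integral>\<^sup>+ \<omega>. (\<integral>\<^sup>+ z. h (pupd \<omega> (Suc n) z) \<partial>k n \<omega>) \<partial>\<gamma>)"
    if h: "h \<in> borel_measurable (pcoords {1..Suc n})" for h :: "path_pair \<Rightarrow> ennreal"
  proof -
    have "(\<integral>\<^sup>+ \<omega>. h \<omega> \<partial>\<gamma>1) = (\<integral>\<^sup>+ \<omega>. (\<integral>\<^sup>+ w. h w \<partial>?K \<omega>) \<partial>\<gamma>)"
      unfolding \<gamma>1_def
      by (rule nn_integral_bind[OF h]) (use measurable_prob_algebraD[OF Km] in \<open>simp add: measurable_cong_sets[OF P(2) refl]\<close>)
    also have "\<dots> = (\<integral>\<^sup>+ \<omega>. (\<integral>\<^sup>+ z. h (pupd \<omega> (Suc n) z) \<partial>k n \<omega>) \<partial>\<gamma>)"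
    proof (intro nn_integral_cong)
      fix \<omega> assume \<omega>: "\<omega> \<in> space \<gamma>"
      have "pupd \<omega> (Suc n) \<in> k n \<omega> \<rightarrow>\<^sub>M pcoords {1..Suc n}"
        unfolding measurable_cong_sets[OF kn(2)[OF \<omega>] refl]
        using measurable_pupd[OF insert_Suc_atLeastAtMost, of "\<lambda>_. \<omega>" ?B n "\<lambda>z. z"] \<omega> sets_eq_imp_space_eq[OF P(2)] by simp
      then show "(\<integral>\<^sup>+ w. h w \<partial>?K \<omega>) = (\<integral>\<^sup>+ z. h (pupd \<omega> (Suc n) z) \<partial>k n \<omega>)"
        using h by (subst nn_integral_distr) auto
    qed
    finally show ?thesis .
  qed
  have nn_const: "(\<integral>\<^sup>+ \<omega>. (\<integral>\<^sup>+ z. h \<omega> \<partial>k n \<omega>) \<partial>\<gamma>) = (\<integral>\<^sup>+ \<omega>. h \<omega> \<partial>\<gamma>)" for h :: "path_pair \<Rightarrow> ennreal"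
    by (intro nn_integral_cong) (simp add: prob_space.emeasure_space_1[OF kn(1)])
  have m1: "(\<lambda>\<omega>. past t \<omega>) \<in> pcoords {1..Suc n} \<rightarrow>\<^sub>M pcoords {1..t}" if "t \<le> n" for t
    using that by (intro measurable_prestrict) auto
  have m2: "(\<lambda>\<omega>. pstep \<omega> (Suc t)) \<in> pcoords {1..Suc n} \<rightarrow>\<^sub>M ?B" if "t \<le> n" for t
    using that by (intro measurable_pstep) auto
  have "is_cond_law \<gamma>1 (\<lambda>\<omega>. past t \<omega>) (pcoords {1..t}) (\<lambda>\<omega>. pstep \<omega> (Suc t)) ?B (k t)"
    if t: "t < Suc n" for t
  proof (rule is_cond_lawI)
    show "(\<lambda>\<omega>. past t \<omega>) \<in> \<gamma>1 \<rightarrow>\<^sub>M pcoords {1..t}"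
      unfolding measurable_cong_sets[OF s1' refl] using t by (intro m1) auto
    show "(\<lambda>\<omega>. pstep \<omega> (Suc t)) \<in> \<gamma>1 \<rightarrow>\<^sub>M ?B"
      unfolding measurable_cong_sets[OF s1' refl] using t by (intro m2) auto
    show kt: "k t \<in> pcoords {1..t} \<rightarrow>\<^sub>M prob_algebra ?B" by (rule Suc.prems[OF t])
    fix S T assume S: "S \<in> sets (pcoords {1..t})" and T: "T \<in> sets ?B"
    note [measurable] = S T measurable_prob_algebraD[OF kt]
    note [measurable] = m1[of t] m2[of t]
    have t': "t \<le> n" using t by simp
    have h1: "(\<lambda>\<omega>. indicator S (past t \<omega>) * indicator T (pstep \<omega> (Suc t)) :: ennreal) \<in> borel_measurable (pcoords {1..Suc n})"
      using t' by measurable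
    have h2: "(\<lambda>\<omega>. indicator S (past t \<omega>) * emeasure (k t (past t \<omega>)) T :: ennreal) \<in> borel_measurable (pcoords {1..Suc n})"
      using t' by measurable
    have R: "(\<integral>\<^sup>+ \<omega>. indicator S (past t \<omega>) * emeasure (k t (past t \<omega>)) T \<partial>\<gamma>1) =
        (\<integral>\<^sup>+ \<omega>. indicator S (past t \<omega>) * emeasure (k t (past t \<omega>)) T \<partial>\<gamma>)"
      unfolding nn[OF h2] prestrict_pupd[OF t'] nn_const ..
    show "(\<integral>\<^sup>+ \<omega>. indicator S (past t \<omega>) * indicator T (pstep \<omega> (Suc t)) \<partial>\<gamma>1) =
      (\<integral>\<^sup>+ \<omega>. indicator S (past t \<omega>) * emeasure (k t (past t \<omega>)) T \<partial>\<gamma>1)"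
    proof (cases "t = n")
      case True
      have "(\<integral>\<^sup>+ \<omega>. indicator S (past t \<omega>) * indicator T (pstep \<omega> (Suc t)) \<partial>\<gamma>1) =
          (\<integral>\<^sup>+ \<omega>. (\<integral>\<^sup>+ z. indicator S (past n \<omega>) * indicator T z \<partial>k n \<omega>) \<partial>\<gamma>)"
        unfolding nn[OF h1] prestrict_pupd[OF t'] using True by (simp add: pstep_pupd)
      also have "\<dots> = (\<integral>\<^sup>+ \<omega>. indicator S (past n \<omega>) * emeasure (k n (past n \<omega>)) T \<partial>\<gamma>)"
      proof (intro nn_integral_cong)
        fix \<omega> assume \<omega>: "\<omega> \<in> space \<gamma>"
        have "past n \<omega> = \<omega>" using \<omega> sets_eq_imp_space_eq[OF P(2)] by (intro prestrict_id) auto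
        moreover have "T \<in> sets (k n \<omega>)" using T kn(2)[OF \<omega>] by simp
        ultimately show "(\<integral>\<^sup>+ z. indicator S (past n \<omega>) * indicator T z \<partial>k n \<omega>) =
            indicator S (past n \<omega>) * emeasure (k n (past n \<omega>)) T"
          by (simp add: nn_integral_cmult_indicator)
      qed
      finally show ?thesis using R True by simp
    next
      case False
      then have tn: "t < n" using t by simp
      have "(\<integral>\<^sup>+ \<omega>. indicator S (past t \<omega>) * indicator T (pstep \<omega> (Suc t)) \<partial>\<gamma>1) =
          (\<integral>\<^sup>+ \<omega>. indicator S (past t \<omega>) * indicator T (pstep \<omega> (Suc t)) \<partial>\<gamma>)"
      proof -
        have "pstep (pupd \<omega> (Suc n) z) (Suc t) = pstep \<omega> (Suc t)" for \<omega> z using tn by (simp add: pstep_pupd)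
        then show ?thesis unfolding nn[OF h1] prestrict_pupd[OF t'] by (simp only: nn_const)
      qed
      also have "\<dots> = (\<integral>\<^sup>+ \<omega>. (\<integral>\<^sup>+ z. indicator S (past t \<omega>) * indicator T z \<partial>k t (past t \<omega>)) \<partial>\<gamma>)"
      proof -
        have "(\<lambda>x. indicator S (fst x) * indicator T (snd x) :: ennreal) \<in> borel_measurable (pcoords {1..t} \<Otimes>\<^sub>M ?B)"
          by measurable
        from is_cond_law_nn_integral[OF P(1) P(3)[OF less_imp_le[OF tn]] P(4)[OF tn] P(5)[OF tn] this]
        show ?thesis by simp
      qed
      also have "\<dots> = (\<integral>\<^sup>+ \<omega>. indicator S (past t \<omega>) * emeasure (k t (past t \<omega>)) T \<partial>\<gamma>)"
      proof (intro nn_integral_cong)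
        fix \<omega> assume \<omega>: "\<omega> \<in> space \<gamma>"
        have "past t \<omega> \<in> space (pcoords {1..t})"
          using measurable_space[OF P(3)[OF less_imp_le[OF tn]] \<omega>] .
        then have "T \<in> sets (k t (past t \<omega>))" using T prob_space_kernel(2)[OF kt] by simp
        then show "(\<integral>\<^sup>+ z. indicator S (past t \<omega>) * indicator T z \<partial>k t (past t \<omega>)) =
            indicator S (past t \<omega>) * emeasure (k t (past t \<omega>)) T"
          by (simp add: nn_integral_cmult_indicator)
      qed
      finally show ?thesis using R by simp
    qed
  qed
  with s1 show ?case unfolding pair_disintegration_def by blast
qed

text \<open>The kernels determine the laws of the initial segments successively, starting from the
  one-point space. It identifies the first marginal of a composed path measure with \<mu>.\<close>

lemma disintegration_unique:
  assumes \<mu>: "\<mu> \<in> space (prob_algebra (coords {1..N}))" and \<nu>: "\<nu> \<in> space (prob_algebra (coords {1..N}))"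
    and "disintegration N \<mu> \<kappa>" "disintegration N \<nu> \<kappa>"
  shows "\<mu> = \<nu>"
proof -
  have s: "sets \<mu> = sets (coords {1..N})" "sets \<nu> = sets (coords {1..N})" "prob_space \<mu>" "prob_space \<nu>"
    using \<mu> \<nu> by (auto simp: space_prob_algebra)
  have mr: "(\<lambda>x. restrict x {1..t}) \<in> M \<rightarrow>\<^sub>M coords {1..t}" if "t \<le> N" "sets M = sets (coords {1..N})" for t and M
    unfolding measurable_cong_sets[OF that(2) refl] using that(1) by (intro measurable_restrict_coords) auto
  have ms: "(\<lambda>x. x (Suc t)) \<in> borel_measurable M" if "t < N" "sets M = sets (coords {1..N})" for t and M
    unfolding measurable_cong_sets[OF that(2) refl] using that(1) by (intro measurable_component_singleton) auto
  have "distr \<mu> (coords {1..t}) (\<lambda>x. restrict x {1..t}) = distr \<nu> (coords {1..t}) (\<lambda>x. restrict x {1..t})" if "t \<le> N" for t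
    using that
  proof (induction t)
    case 0
    have r: "restrict x {1..0} = (\<lambda>_. undefined)" for x :: "nat \<Rightarrow> real" by auto
    show ?case unfolding r
      by (rule measure_eqI) (auto simp: emeasure_distr space_PiM indicator_def s(3,4)[THEN prob_space.emeasure_space_1] vimage_def)
  next
    case (Suc t)
    then have t: "t < N" by simp
    let ?T = "\<lambda>z. (fst z)(Suc t := snd z)"
    have T: "?T \<in> coords {1..t} \<Otimes>\<^sub>M borel \<rightarrow>\<^sub>M coords {1..Suc t}"
      by (rule measurable_coords_upd[OF insert_Suc_atLeastAtMost]) measurable
    have step: "distr M (coords {1..Suc t}) (\<lambda>x. restrict x {1..Suc t}) =
      distr (distr M (coords {1..t}) (\<lambda>x. restrict x {1..t}) \<bind> (\<lambda>x. distr (\<kappa> t x) (coords {1..t} \<Otimes>\<^sub>M borel) (Pair x))) (coords {1..Suc t}) ?T"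
      if M: "sets M = sets (coords {1..N})" "prob_space M" "disintegration N M \<kappa>" for M
    proof -
      have K: "is_cond_law M (\<lambda>x. restrict x {1..t}) (coords {1..t}) (\<lambda>x. x (Suc t)) borel (\<kappa> t)"
        using M(3) t by (auto simp: disintegration_def)
      note m = mr[OF less_imp_le[OF t] M(1)] ms[OF t M(1)]
      have "distr M (coords {1..Suc t}) (\<lambda>x. restrict x {1..Suc t}) =
          distr (distr M (coords {1..t} \<Otimes>\<^sub>M borel) (\<lambda>x. (restrict x {1..t}, x (Suc t)))) (coords {1..Suc t}) ?T"
      proof (subst distr_distr[OF T])
        show "(\<lambda>x. (restrict x {1..t}, x (Suc t))) \<in> M \<rightarrow>\<^sub>M coords {1..t} \<Otimes>\<^sub>M borel"
          using m by (rule measurable_Pair)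
        show "distr M (coords {1..Suc t}) (\<lambda>x. restrict x {1..Suc t}) =
            distr M (coords {1..Suc t}) (?T \<circ> (\<lambda>x. (restrict x {1..t}, x (Suc t))))"
          by (intro distr_cong) (auto simp: fun_eq_iff)
      qed
      then show ?thesis using is_cond_law_distr_bind[OF M(2) m K] by simp
    qed
    show ?case
      unfolding step[OF s(1,3) assms(3)] step[OF s(2,4) assms(4)] Suc.IH[OF less_imp_le[OF t]] ..
  qed
  from this[of N] have eq: "distr \<mu> (coords {1..N}) (\<lambda>x. restrict x {1..N}) = distr \<nu> (coords {1..N}) (\<lambda>x. restrict x {1..N})" by simp
  have "distr M (coords {1..N}) (\<lambda>x. restrict x {1..N}) = M" if "sets M = sets (coords {1..N})" for M
    using sets_eq_imp_space_eq[OF that] by (intro distr_id_cong) (auto simp: that space_PiM)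
  then show ?thesis using eq s by metis
qed

section \<open>Path measures with prescribed conditional first marginals: upper bound and optimal
  strategies\<close>

context dp_setting
begin

text \<open>Causality in one direction: the first marginal of each conditional law is the kernel at
  the past of x alone, while the second is free, as in the couplings over which the dynamic
  programme maximises. A single D bounds all conditional displacements.\<close>

definition admissible :: "path_pair measure \<Rightarrow> (nat \<Rightarrow> path_pair \<Rightarrow> (real \<times> real) measure) \<Rightarrow> ennreal \<Rightarrow> bool" where
  "admissible \<gamma> k D \<longleftrightarrow> pair_disintegration N \<gamma> k \<and>
     (\<forall>t<N. AE \<omega> in \<gamma>. distr (k t (past t \<omega>)) borel fst = \<kappa> t (fst (past t \<omega>)) \<and>
       displacement p (k t (past t \<omega>)) \<le> D)"

text \<open>\<open>Lb_step\<close> iterated along the path: a common bound on the displacements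
  means that each step costs a factor 2^p and an additive constant. Hence the negative of
  \<open>Lb\<close> is an integrable minorant under the path measure.\<close>

lemma Lb_path_finite:
  assumes adm: "admissible \<gamma> k D" and D: "D < \<infinity>" and "t \<le> N"
  shows "(\<integral>\<^sup>+ \<omega>. Lb t (fst (past t \<omega>)) (snd (past t \<omega>)) \<partial>\<gamma>) < \<infinity>"
  using assms(3)
proof (induction t)
  case 0
  have "(\<lambda>_. undefined) \<in> space (coords {1..0})" by (simp add: space_PiM)
  then have "Lb 0 (\<lambda>_. undefined) (\<lambda>_. undefined) < \<infinity>" by (intro Lb_finite) auto
  moreover have "prob_space \<gamma>" using adm pair_disintegrationD(1) by (auto simp: admissible_def)
  ultimately show ?case unfolding prestrict_0 by (simp add: prob_space.emeasure_space_1)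
next
  case (Suc t)
  then have t: "t < N" by simp
  have dis: "pair_disintegration N \<gamma> k" using adm by (simp add: admissible_def)
  note P = pair_disintegrationD[OF dis]
  let ?c = "ennreal (2 powr p)"
  let ?x = "\<lambda>\<omega>. fst (past t \<omega>)" and ?y = "\<lambda>\<omega>. snd (past t \<omega>)"
  have m: "(\<lambda>z. Lb (Suc t) (fst (pupd (fst z) (Suc t) (snd z))) (snd (pupd (fst z) (Suc t) (snd z)))) \<in> borel_measurable (pcoords {1..t} \<Otimes>\<^sub>M (borel \<Otimes>\<^sub>M borel))"
    using measurable_compose[OF upd_meas2 Lb_meas[OF Suc.prems]] .
  have m2: "(\<lambda>\<omega>. Lb t (?x \<omega>) (?y \<omega>)) \<in> borel_measurable \<gamma>"
    using measurable_compose[OF P(3)[OF less_imp_le[OF t]] Lb_meas[OF less_imp_le[OF t]]] .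
  interpret \<gamma>: prob_space \<gamma> by (rule P(1))
  have "(\<integral>\<^sup>+ \<omega>. Lb (Suc t) (fst (past (Suc t) \<omega>)) (snd (past (Suc t) \<omega>)) \<partial>\<gamma>) =
    (\<integral>\<^sup>+ \<omega>. (\<integral>\<^sup>+ z. Lb (Suc t) ((?x \<omega>)(Suc t := fst z)) ((?y \<omega>)(Suc t := snd z)) \<partial>k t (past t \<omega>)) \<partial>\<gamma>)"
    unfolding prestrict_Suc using is_cond_law_nn_integral[OF P(1) P(3)[OF less_imp_le[OF t]] P(4)[OF t] P(5)[OF t] m]
    by (simp add: pupd_def)
  also have "\<dots> \<le> (\<integral>\<^sup>+ \<omega>. ?c * (Lb t (?x \<omega>) (?y \<omega>) + ennreal C * D) \<partial>\<gamma>)"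
  proof (rule nn_integral_mono_AE)
    have "AE \<omega> in \<gamma>. distr (k t (past t \<omega>)) borel fst = \<kappa> t (?x \<omega>) \<and> displacement p (k t (past t \<omega>)) \<le> D"
      using adm t by (simp add: admissible_def)
    with AE_space show "AE \<omega> in \<gamma>. (\<integral>\<^sup>+ z. Lb (Suc t) ((?x \<omega>)(Suc t := fst z)) ((?y \<omega>)(Suc t := snd z)) \<partial>k t (past t \<omega>)) \<le>
        ?c * (Lb t (?x \<omega>) (?y \<omega>) + ennreal C * D)"
    proof eventually_elim
      case (elim \<omega>)
      have sp: "past t \<omega> \<in> space (pcoords {1..t})"
        using measurable_space[OF P(3)[OF less_imp_le[OF t]] elim(1)] .
      then have xy: "?x \<omega> \<in> space (coords {1..t})" "?y \<omega> \<in> space (coords {1..t})" by (auto simp: space_pair_measure)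
      have "k t (past t \<omega>) \<in> space (prob_algebra (borel \<Otimes>\<^sub>M borel))"
        using measurable_space[OF is_cond_lawD(1)[OF P(5)[OF t]] sp] .
      then have "(\<integral>\<^sup>+ z. Lb (Suc t) ((?x \<omega>)(Suc t := fst z)) ((?y \<omega>)(Suc t := snd z)) \<partial>k t (past t \<omega>)) \<le>
          ?c * (Lb t (?x \<omega>) (?y \<omega>) + ennreal C * displacement p (k t (past t \<omega>)))"
        using elim(2) by (intro Lb_step t xy) auto
      also have "\<dots> \<le> ?c * (Lb t (?x \<omega>) (?y \<omega>) + ennreal C * D)"
        using elim(2) by (intro mult_left_mono add_left_mono) auto
      finally show ?case .
    qed
  qed
  also have "\<dots> = ?c * ((\<integral>\<^sup>+ \<omega>. Lb t (?x \<omega>) (?y \<omega>) \<partial>\<gamma>) + ennreal C * D)"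
    using m2 by (simp add: nn_integral_cmult nn_integral_add \<gamma>.emeasure_space_1)
  also have "\<dots> < \<infinity>"
    using Suc.IH t D by (auto simp: ennreal_mult_less_top)
  finally show ?case .
qed

lemma path_tower:
  assumes adm: "admissible \<gamma> k D" and D: "D < \<infinity>" and t: "t < N"
    and g: "(\<lambda>z. g (fst z) (snd z)) \<in> borel_measurable (pcoords {1..Suc t})"
    and lb: "\<And>x y. x \<in> space (coords {1..Suc t}) \<Longrightarrow> y \<in> space (coords {1..Suc t}) \<Longrightarrow> - enn2ereal (Lb (Suc t) x y) \<le> g x y"
  shows "ext_integral \<gamma> (\<lambda>\<omega>. g (fst (past (Suc t) \<omega>)) (snd (past (Suc t) \<omega>))) =
    ext_integral \<gamma> (\<lambda>\<omega>. ext_integral (k t (past t \<omega>))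
      (\<lambda>z. g ((fst (past t \<omega>))(Suc t := fst z)) ((snd (past t \<omega>))(Suc t := snd z))))"
proof -
  have dis: "pair_disintegration N \<gamma> k" using adm by (simp add: admissible_def)
  note P = pair_disintegrationD[OF dis]
  let ?u = "\<lambda>z. pupd (fst z) (Suc t) (snd z)"
  have m: "(\<lambda>z. Lb (Suc t) (fst (?u z)) (snd (?u z))) \<in> borel_measurable (pcoords {1..t} \<Otimes>\<^sub>M (borel \<Otimes>\<^sub>M borel))"
    using measurable_compose[OF upd_meas2 Lb_meas] t by simp
  have mg: "(\<lambda>z. g (fst (?u z)) (snd (?u z))) \<in> borel_measurable (pcoords {1..t} \<Otimes>\<^sub>M (borel \<Otimes>\<^sub>M borel))"
    using measurable_compose[OF upd_meas2 g] .
  have fin: "(\<integral>\<^sup>+ \<omega>. Lb (Suc t) (fst (?u (past t \<omega>, pstep \<omega> (Suc t)))) (snd (?u (past t \<omega>, pstep \<omega> (Suc t)))) \<partial>\<gamma>) < \<infinity>"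
    using Lb_path_finite[OF adm D, of "Suc t"] t unfolding prestrict_Suc by simp
  have "ext_integral \<gamma> (\<lambda>\<omega>. g (fst (?u (past t \<omega>, pstep \<omega> (Suc t)))) (snd (?u (past t \<omega>, pstep \<omega> (Suc t))))) =
    ext_integral \<gamma> (\<lambda>\<omega>. ext_integral (k t (past t \<omega>)) (\<lambda>z. g (fst (?u (past t \<omega>, z))) (snd (?u (past t \<omega>, z)))))"
  proof (rule is_cond_law_ext_integral[OF P(1) P(3)[OF less_imp_le[OF t]] P(4)[OF t] P(5)[OF t] mg m fin])
    fix x and b :: "real \<times> real" assume "x \<in> space (pcoords {1..t})"
    then show "- enn2ereal (Lb (Suc t) (fst (?u (x, b))) (snd (?u (x, b)))) \<le> g (fst (?u (x, b))) (snd (?u (x, b)))"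
      unfolding pupd_def fst_conv snd_conv by (intro lb coords_upd) (auto simp: space_pair_measure)
  qed
  then show ?thesis unfolding prestrict_Suc by (simp add: pupd_def)
qed

lemma ext_integral_const:
  assumes "prob_space M"
  shows "ext_integral M (\<lambda>_. c) = c"
proof -
  interpret prob_space M by fact
  have "enn2ereal (e2ennreal c) - enn2ereal (e2ennreal (- c)) = c"
  proof (cases "0 \<le> c")
    case True
    then show ?thesis by (simp add: enn2ereal_e2ennreal e2ennreal_neg zero_ennreal.rep_eq)
  next
    case False
    then show ?thesis by (simp add: enn2ereal_e2ennreal e2ennreal_neg zero_ennreal.rep_eq)
  qed
  then show ?thesis unfolding ext_integral_eq by (simp add: emeasure_space_1)
qed

lemma V_meas: "t \<le> N \<Longrightarrow> (\<lambda>z. V t (fst z) (snd z)) \<in> borel_measurable (pcoords {1..t})"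
  by (rule V_meas_if) (auto intro: V_eq_SUP_W)

text \<open>In the sense of extended integrals, the value along the path is a supermartingale:
  almost every conditional law is one of the couplings over which the supremum defining
  \<open>V t\<close> is taken.\<close>

lemma path_upper_bound:
  assumes adm: "admissible \<gamma> k D" and D: "D < ennreal (\<delta> powr p)" and "t \<le> N"
  shows "ext_integral \<gamma> (\<lambda>\<omega>. V t (fst (past t \<omega>)) (snd (past t \<omega>))) \<le>
    V 0 (\<lambda>_. undefined) (\<lambda>_. undefined)"
  using assms(3)
proof (induction t)
  case 0
  have "prob_space \<gamma>" using adm pair_disintegrationD(1) by (auto simp: admissible_def)
  then show ?case unfolding prestrict_0 by (simp add: ext_integral_const)
next
  case (Suc t)
  then have t: "t < N" by simp
  have dis: "pair_disintegration N \<gamma> k" using adm by (simp add: admissible_def)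
  note P = pair_disintegrationD[OF dis]
  have D': "D < \<infinity>" using D by (rule less_trans) simp
  have "ext_integral \<gamma> (\<lambda>\<omega>. V (Suc t) (fst (past (Suc t) \<omega>)) (snd (past (Suc t) \<omega>))) =
    ext_integral \<gamma> (\<lambda>\<omega>. ext_integral (k t (past t \<omega>))
      (\<lambda>z. V (Suc t) ((fst (past t \<omega>))(Suc t := fst z)) ((snd (past t \<omega>))(Suc t := snd z))))"
    using Suc.prems by (intro path_tower[OF adm D' t] V_meas V_lower V_eq_SUP_W) auto
  also have "\<dots> \<le> ext_integral \<gamma> (\<lambda>\<omega>. V t (fst (past t \<omega>)) (snd (past t \<omega>)))"
  proof (rule ext_integral_mono_AE)
    have "AE \<omega> in \<gamma>. distr (k t (past t \<omega>)) borel fst = \<kappa> t (fst (past t \<omega>)) \<and> displacement p (k t (past t \<omega>)) \<le> D"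
      using adm t by (simp add: admissible_def)
    with AE_space show "AE \<omega> in \<gamma>. ext_integral (k t (past t \<omega>))
      (\<lambda>z. V (Suc t) ((fst (past t \<omega>))(Suc t := fst z)) ((snd (past t \<omega>))(Suc t := snd z))) \<le>
      V t (fst (past t \<omega>)) (snd (past t \<omega>))"
    proof eventually_elim
      case (elim \<omega>)
      have "past t \<omega> \<in> space (pcoords {1..t})"
        using measurable_space[OF P(3)[OF less_imp_le[OF t]] elim(1)] .
      then have "k t (past t \<omega>) \<in> space (prob_algebra (borel \<Otimes>\<^sub>M borel))"
        by (rule measurable_space[OF is_cond_lawD(1)[OF P(5)[OF t]]])
      then have "k t (past t \<omega>) \<in> couplings_within p \<delta> (\<kappa> t (fst (past t \<omega>)))"
        using elim(2) D cost_less_iff[OF p \<delta>, of "k t (past t \<omega>)"]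
        by (auto simp: couplings_within_def displacement_def)
      then show ?case unfolding V_step[OF t] by (rule SUP_upper)
    qed
  qed
  also have "\<dots> \<le> V 0 (\<lambda>_. undefined) (\<lambda>_. undefined)" using Suc by simp
  finally show ?case .
qed

definition branch :: "nat \<Rightarrow> nat \<Rightarrow> path_pair \<Rightarrow> nat \<Rightarrow> ereal" where
  "branch K t z i = ext_integral (law_of (G i) (\<kappa> t (fst z)))
     (\<lambda>w. W K (Suc t) ((fst z)(Suc t := fst w)) ((snd z)(Suc t := snd w)))"

text \<open>The maximum over finitely many competitors is attained, and the least maximiser is
  measurable because for each index the condition defining it is.\<close>

definition sel :: "nat \<Rightarrow> nat \<Rightarrow> path_pair \<Rightarrow> nat" where
  "sel K t z = (LEAST i. i \<in> competitors p \<delta> G K (\<kappa> t (fst z)) \<and> branch K t z i = W K t (fst z) (snd z))"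

lemma sel:
  assumes t: "t < N" and z: "z \<in> space (pcoords {1..t})"
  shows "sel K t z \<in> competitors p \<delta> G K (\<kappa> t (fst z))" "branch K t z (sel K t z) = W K t (fst z) (snd z)"
proof -
  let ?S = "competitors p \<delta> G K (\<kappa> t (fst z))"
  have "fst z \<in> space (coords {1..t})" using z by (auto simp: space_pair_measure)
  then have "?S \<noteq> {}" using zero_competitor[OF t] by blast
  then have "Max (branch K t z ` ?S) \<in> branch K t z ` ?S" "Max (branch K t z ` ?S) = Sup (branch K t z ` ?S)"
    using finite_competitors by (auto intro!: Max_in Max_Sup)
  moreover have "Sup (branch K t z ` ?S) = W K t (fst z) (snd z)"
    unfolding W_step[OF t] branch_def ..
  ultimately obtain i where "i \<in> ?S \<and> branch K t z i = W K t (fst z) (snd z)" by auto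
  then have "sel K t z \<in> ?S \<and> branch K t z (sel K t z) = W K t (fst z) (snd z)"
    unfolding sel_def by (rule LeastI)
  then show "sel K t z \<in> ?S" "branch K t z (sel K t z) = W K t (fst z) (snd z)" by auto
qed

lemma sel_meas: "t < N \<Longrightarrow> sel K t \<in> pcoords {1..t} \<rightarrow>\<^sub>M count_space UNIV"
proof -
  assume t: "t < N"
  have [measurable]: "(\<lambda>z. branch K t z i) \<in> borel_measurable (pcoords {1..t})" for i
    unfolding branch_def using t by (intro W_branch_meas W_meas) auto
  note [measurable] = competitors_meas[OF t] W_meas[OF less_imp_le[OF t]]
  show ?thesis unfolding sel_def[abs_def] by measurable
qed

definition strategy :: "nat \<Rightarrow> nat \<Rightarrow> path_pair \<Rightarrow> (real \<times> real) measure" where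
  "strategy K t z = law_of (G (sel K t z)) (\<kappa> t (fst z))"

lemma strategy_meas: "t < N \<Longrightarrow> strategy K t \<in> pcoords {1..t} \<rightarrow>\<^sub>M prob_algebra (borel \<Otimes>\<^sub>M borel)"
  unfolding strategy_def[abs_def]
  by (rule measurable_compose_countable[OF kernel_meas2 sel_meas]) auto

lemma strategy:
  assumes t: "t < N" and z: "z \<in> space (pcoords {1..t})"
  shows "distr (strategy K t z) borel fst = \<kappa> t (fst z)"
    "displacement p (strategy K t z) \<le> ennreal (radius \<delta> K powr p)"
    "AE w in strategy K t z. fst w = dc (sel K t z) (snd w)"
    "ext_integral (strategy K t z) (\<lambda>w. W K (Suc t) ((fst z)(Suc t := fst w)) ((snd z)(Suc t := snd w))) = W K t (fst z) (snd z)"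
proof -
  have x: "fst z \<in> space (coords {1..t})" using z by (auto simp: space_pair_measure)
  show "distr (strategy K t z) borel fst = \<kappa> t (fst z)"
    unfolding strategy_def by (rule law_of_kernel[OF t x])
  show "displacement p (strategy K t z) \<le> ennreal (radius \<delta> K powr p)"
    using sel(1)[OF t z] by (simp add: competitors_def strategy_def)
  show "ext_integral (strategy K t z) (\<lambda>w. W K (Suc t) ((fst z)(Suc t := fst w)) ((snd z)(Suc t := snd w))) = W K t (fst z) (snd z)"
    using sel(2)[OF t z] by (simp add: branch_def strategy_def)
  note [measurable_cong] = kernel(2)[OF t x]
  show "AE w in strategy K t z. fst w = dc (sel K t z) (snd w)"
    unfolding strategy_def law_of_def
    by (subst AE_distr_iff) (auto simp: dc_G)
qed

text \<open>Under the maximising kernels the inequality of the supermartingale argument becomes an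
  equality: \<open>W K\<close> is a martingale along the path, with all costs at most
  \<open>radius \<delta> K\<close>.\<close>

lemma path_strategy_value:
  assumes dis: "pair_disintegration N \<gamma> (strategy K)"
  shows "admissible \<gamma> (strategy K) (ennreal (radius \<delta> K powr p))"
    and "t \<le> N \<Longrightarrow> ext_integral \<gamma> (\<lambda>\<omega>. W K t (fst (past t \<omega>)) (snd (past t \<omega>))) =
      W K 0 (\<lambda>_. undefined) (\<lambda>_. undefined)"
proof -
  note P = pair_disintegrationD[OF dis]
  show adm: "admissible \<gamma> (strategy K) (ennreal (radius \<delta> K powr p))"
    unfolding admissible_def
  proof (intro conjI dis allI impI AE_I2)
    fix t \<omega> assume t: "t < N" and \<omega>: "\<omega> \<in> space \<gamma>"
    have z: "past t \<omega> \<in> space (pcoords {1..t})"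
      using measurable_space[OF P(3)[OF less_imp_le[OF t]] \<omega>] .
    show "distr (strategy K t (past t \<omega>)) borel fst = \<kappa> t (fst (past t \<omega>))"
      "displacement p (strategy K t (past t \<omega>)) \<le> ennreal (radius \<delta> K powr p)"
      using strategy[OF t z] by auto
  qed
  show "ext_integral \<gamma> (\<lambda>\<omega>. W K t (fst (past t \<omega>)) (snd (past t \<omega>))) =
      W K 0 (\<lambda>_. undefined) (\<lambda>_. undefined)" if "t \<le> N"
    using that
  proof (induction t)
    case 0
    show ?case unfolding prestrict_0 using P(1) by (simp add: ext_integral_const)
  next
    case (Suc t)
    then have t: "t < N" by simp
    have "ext_integral \<gamma> (\<lambda>\<omega>. W K (Suc t) (fst (past (Suc t) \<omega>)) (snd (past (Suc t) \<omega>))) =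
      ext_integral \<gamma> (\<lambda>\<omega>. ext_integral (strategy K t (past t \<omega>))
        (\<lambda>z. W K (Suc t) ((fst (past t \<omega>))(Suc t := fst z)) ((snd (past t \<omega>))(Suc t := snd z))))"
      using Suc.prems by (intro path_tower[OF adm _ t] W_meas W_lower) auto
    also have "\<dots> = ext_integral \<gamma> (\<lambda>\<omega>. W K t (fst (past t \<omega>)) (snd (past t \<omega>)))"
      using measurable_space[OF P(3)[OF less_imp_le[OF t]]]
      by (intro ext_integral_cong_AE AE_I2 strategy(4)[OF t]) auto
    also have "\<dots> = W K 0 (\<lambda>_. undefined) (\<lambda>_. undefined)" using Suc by simp
    finally show ?case .
  qed
qed

end

section \<open>Integrability and growth\<close>

lemma is_cond_law_cong_AE:
  assumes "prob_space P" and X[measurable]: "X \<in> P \<rightarrow>\<^sub>M A" and Y[measurable]: "Y \<in> P \<rightarrow>\<^sub>M B"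
    and K: "is_cond_law P X A Y B K" and K': "K' \<in> A \<rightarrow>\<^sub>M prob_algebra B"
    and eq: "AE \<omega> in P. K (X \<omega>) = K' (X \<omega>)"
  shows "is_cond_law P X A Y B K'"
proof (rule is_cond_lawI[OF X Y K'])
  fix S T assume [measurable]: "S \<in> sets A" "T \<in> sets B"
  have "(\<integral>\<^sup>+ \<omega>. indicator S (X \<omega>) * indicator T (Y \<omega>) \<partial>P) =
      (\<integral>\<^sup>+ \<omega>. (\<integral>\<^sup>+ b. indicator S (X \<omega>) * indicator T b \<partial>K (X \<omega>)) \<partial>P)"
    using is_cond_law_nn_integral[OF assms(1) X Y K, of "\<lambda>z. indicator S (fst z) * indicator T (snd z)"] by simp
  also have "\<dots> = (\<integral>\<^sup>+ \<omega>. indicator S (X \<omega>) * emeasure (K' (X \<omega>)) T \<partial>P)"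
  proof (rule nn_integral_cong_AE)
    from eq AE_space show "AE \<omega> in P. (\<integral>\<^sup>+ b. indicator S (X \<omega>) * indicator T b \<partial>K (X \<omega>)) =
        indicator S (X \<omega>) * emeasure (K' (X \<omega>)) T"
    proof eventually_elim
      case (elim \<omega>)
      have "T \<in> sets (K' (X \<omega>))"
        using prob_space_kernel(2)[OF K' measurable_space[OF X elim(2)]] by simp
      then show ?case using elim(1) by (simp add: nn_integral_cmult_indicator)
    qed
  qed
  finally show "(\<integral>\<^sup>+ \<omega>. indicator S (X \<omega>) * indicator T (Y \<omega>) \<partial>P) = \<dots>" .
qed

text \<open>If the image under w of the conditional law depends on the past only through u, then it
  is also the conditional law of w(Y) given the smaller information u(X). With first and with second
  projections this yields the disintegrations of the two marginals.\<close>

lemma is_cond_law_project: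
  assumes "prob_space P" and X[measurable]: "X \<in> P \<rightarrow>\<^sub>M A" and Y[measurable]: "Y \<in> P \<rightarrow>\<^sub>M B"
    and K: "is_cond_law P X A Y B K"
    and u[measurable]: "u \<in> A \<rightarrow>\<^sub>M A'" and w[measurable]: "w \<in> B \<rightarrow>\<^sub>M B'"
    and K': "K' \<in> A' \<rightarrow>\<^sub>M prob_algebra B'"
    and eq: "AE \<omega> in P. distr (K (X \<omega>)) B' w = K' (u (X \<omega>))"
  shows "is_cond_law P (\<lambda>\<omega>. u (X \<omega>)) A' (\<lambda>\<omega>. w (Y \<omega>)) B' K'"
proof (rule is_cond_lawI[OF _ _ K'])
  fix S T assume [measurable]: "S \<in> sets A'" "T \<in> sets B'"
  have "(\<integral>\<^sup>+ \<omega>. indicator S (u (X \<omega>)) * indicator T (w (Y \<omega>)) \<partial>P) =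
      (\<integral>\<^sup>+ \<omega>. (\<integral>\<^sup>+ b. indicator S (u (X \<omega>)) * indicator T (w b) \<partial>K (X \<omega>)) \<partial>P)"
    using is_cond_law_nn_integral[OF assms(1) X Y K, of "\<lambda>z. indicator S (u (fst z)) * indicator T (w (snd z))"] by simp
  also have "\<dots> = (\<integral>\<^sup>+ \<omega>. indicator S (u (X \<omega>)) * emeasure (K' (u (X \<omega>))) T \<partial>P)"
  proof (rule nn_integral_cong_AE)
    from eq AE_space show "AE \<omega> in P. (\<integral>\<^sup>+ b. indicator S (u (X \<omega>)) * indicator T (w b) \<partial>K (X \<omega>)) =
        indicator S (u (X \<omega>)) * emeasure (K' (u (X \<omega>))) T"
    proof eventually_elim
      case (elim \<omega>)
      have w': "w \<in> K (X \<omega>) \<rightarrow>\<^sub>M B'"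
        unfolding measurable_cong_sets[OF prob_space_kernel(2)[OF is_cond_lawD(1)[OF K] measurable_space[OF X elim(2)]] refl]
        by (rule w)
      have "emeasure (K' (u (X \<omega>))) T = (\<integral>\<^sup>+ b. indicator T (w b) \<partial>K (X \<omega>))"
        unfolding elim(1)[symmetric] by (subst nn_integral_indicator[symmetric], simp, subst nn_integral_distr[OF w'], simp_all)
      then show ?case by (cases "u (X \<omega>) \<in> S") simp_all
    qed
  qed
  finally show "(\<integral>\<^sup>+ \<omega>. indicator S (u (X \<omega>)) * indicator T (w (Y \<omega>)) \<partial>P) = \<dots>" .
qed measurable

section \<open>Moments along a disintegration, and a version with finite moments at every
  past\<close>

lemma pnorm_powr:
  assumes "1 \<le> p"
  shows "pnorm p N x powr p = (\<Sum>s=1..N. \<bar>x s\<bar> powr p)"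
  using assms by (simp add: pnorm_def powr_powr sum_nonneg)

definition tame :: "real \<Rightarrow> nat \<Rightarrow> (nat \<Rightarrow> (nat \<Rightarrow> real) \<Rightarrow> real measure) \<Rightarrow> nat \<Rightarrow> (nat \<Rightarrow> real) \<Rightarrow> real measure" where
  "tame p N \<kappa> t x = (if tail_moment p N \<kappa> t x < \<infinity> then \<kappa> t x else return borel 0)"

lemma measurable_tame:
  assumes \<kappa>: "\<And>t. t < N \<Longrightarrow> \<kappa> t \<in> coords {1..t} \<rightarrow>\<^sub>M prob_algebra borel" and t: "t < N"
  shows "tame p N \<kappa> t \<in> coords {1..t} \<rightarrow>\<^sub>M prob_algebra borel"
proof -
  note [measurable] = \<kappa>[OF t] measurable_tail_moment[of N \<kappa>, OF \<kappa> less_imp_le[OF t]]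
  have [measurable]: "(\<lambda>_. return borel 0) \<in> coords {1..t} \<rightarrow>\<^sub>M prob_algebra (borel :: real measure)"
    by (rule measurable_const) (simp add: space_prob_algebra prob_space_return)
  show ?thesis unfolding tame_def by measurable
qed

lemma measurable_tail_moment_upd:
  assumes \<kappa>: "\<And>t. t < N \<Longrightarrow> \<kappa> t \<in> coords {1..t} \<rightarrow>\<^sub>M prob_algebra borel"
    and "t < N" "x \<in> space (coords {1..t})"
  shows "(\<lambda>a. tail_moment p N \<kappa> (Suc t) (x(Suc t := a))) \<in> borel_measurable borel"
proof -
  have m: "(\<lambda>a. x(Suc t := a)) \<in> borel \<rightarrow>\<^sub>M coords {1..Suc t}"
    using assms by (intro measurable_coords_upd[OF insert_Suc_atLeastAtMost] measurable_const) auto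
  show ?thesis
    by (rule measurable_compose[OF m measurable_tail_moment[OF \<kappa>]]) (use assms(2) in auto)
qed

lemma AE_tail_moment_upd:
  assumes \<kappa>: "\<And>t. t < N \<Longrightarrow> \<kappa> t \<in> coords {1..t} \<rightarrow>\<^sub>M prob_algebra borel"
    and t: "t < N" and x: "x \<in> space (coords {1..t})" and fin: "tail_moment p N \<kappa> t x < \<infinity>"
  shows "AE a in \<kappa> t x. tail_moment p N \<kappa> (Suc t) (x(Suc t := a)) < \<infinity>"
proof -
  note [measurable] = measurable_tail_moment_upd[OF \<kappa> t x] and [measurable_cong] = prob_space_kernel(2)[OF \<kappa>[OF t] x]
  have "(\<integral>\<^sup>+ a. ennreal (\<bar>a\<bar> powr p) + tail_moment p N \<kappa> (Suc t) (x(Suc t := a)) \<partial>\<kappa> t x) \<noteq> \<infinity>"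
    using fin t by (subst (asm) tail_moment.simps) auto
  then have "AE a in \<kappa> t x. ennreal (\<bar>a\<bar> powr p) + tail_moment p N \<kappa> (Suc t) (x(Suc t := a)) \<noteq> \<infinity>"
    by (intro nn_integral_PInf_AE) measurable
  then show ?thesis by eventually_elim (auto simp: top.not_eq_extremum)
qed

text \<open>Backward induction. Where the moment is finite, almost every continuation has finite
  moment and nothing changes; elsewhere the point mass at 0 reduces the integral to a single value,
  finite by induction.\<close>

lemma tail_moment_tame:
  assumes \<kappa>: "\<And>t. t < N \<Longrightarrow> \<kappa> t \<in> coords {1..t} \<rightarrow>\<^sub>M prob_algebra borel" and "t \<le> N" "x \<in> space (coords {1..t})"
  shows "tail_moment p N (tame p N \<kappa>) t x < \<infinity> \<and>
    (tail_moment p N \<kappa> t x < \<infinity> \<longrightarrow> tail_moment p N (tame p N \<kappa>) t x = tail_moment p N \<kappa> t x)"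
  using assms(2,3)
proof (induction arbitrary: x rule: inc_induct)
  case base
  then show ?case by (simp add: tail_moment.simps)
next
  case (step t)
  note t = step(2) and x = step(4)
  have IH: "tail_moment p N (tame p N \<kappa>) (Suc t) (x(Suc t := a)) < \<infinity>"
      "tail_moment p N \<kappa> (Suc t) (x(Suc t := a)) < \<infinity> \<Longrightarrow>
        tail_moment p N (tame p N \<kappa>) (Suc t) (x(Suc t := a)) = tail_moment p N \<kappa> (Suc t) (x(Suc t := a))" for a
    using step.IH[OF coords_upd[OF x, of a]] by blast+
  show ?case
  proof (cases "tail_moment p N \<kappa> t x < \<infinity>")
    case True
    have tame: "tame p N \<kappa> t x = \<kappa> t x" using True by (simp add: tame_def)
    have ae: "AE a in \<kappa> t x. tail_moment p N \<kappa> (Suc t) (x(Suc t := a)) < \<infinity>"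
      using \<kappa> t x True by (rule AE_tail_moment_upd)
    have "tail_moment p N (tame p N \<kappa>) t x =
        (\<integral>\<^sup>+ a. ennreal (\<bar>a\<bar> powr p) + tail_moment p N (tame p N \<kappa>) (Suc t) (x(Suc t := a)) \<partial>\<kappa> t x)"
      unfolding tail_moment.simps[of p N "tame p N \<kappa>" t] tame using t by simp
    also have "\<dots> = (\<integral>\<^sup>+ a. ennreal (\<bar>a\<bar> powr p) + tail_moment p N \<kappa> (Suc t) (x(Suc t := a)) \<partial>\<kappa> t x)"
    proof (rule nn_integral_cong_AE)
      from ae show "AE a in \<kappa> t x. ennreal (\<bar>a\<bar> powr p) + tail_moment p N (tame p N \<kappa>) (Suc t) (x(Suc t := a)) =
          ennreal (\<bar>a\<bar> powr p) + tail_moment p N \<kappa> (Suc t) (x(Suc t := a))"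
      proof eventually_elim
        case (elim a)
        show ?case unfolding IH(2)[OF elim] ..
      qed
    qed
    also have "\<dots> = tail_moment p N \<kappa> t x"
      unfolding tail_moment.simps[of p N \<kappa> t] using t by simp
    finally have "tail_moment p N (tame p N \<kappa>) t x = tail_moment p N \<kappa> t x" .
    with True show ?thesis by simp
  next
    case False
    have m: "(\<lambda>a. ennreal (\<bar>a\<bar> powr p) + tail_moment p N (tame p N \<kappa>) (Suc t) (x(Suc t := a))) \<in> borel_measurable borel"
      using measurable_tail_moment_upd[OF measurable_tame[OF \<kappa>] t x] by measurable
    have "tail_moment p N (tame p N \<kappa>) t x = ennreal (\<bar>0\<bar> powr p) + tail_moment p N (tame p N \<kappa>) (Suc t) (x(Suc t := 0))"
      using False t m by (subst tail_moment.simps) (simp add: tame_def nn_integral_return)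
    then show ?thesis using False IH(1)[of 0] by (simp only: ennreal_add_eq_top less_top) simp
  qed
qed

text \<open>From a past of finite moment, every admissible coupling has first marginal \<kappa> and
  so leads almost surely to pasts of finite moment, where the recursion has identical values by
  induction.\<close>

lemma dp_value_tame:
  assumes \<kappa>: "\<And>t. t < N \<Longrightarrow> \<kappa> t \<in> coords {1..t} \<rightarrow>\<^sub>M prob_algebra borel" and "t \<le> N" "x \<in> space (coords {1..t})"
    and "tail_moment p N \<kappa> t x < \<infinity>"
  shows "dp_value p N (tame p N \<kappa>) f \<delta> t x y = dp_value p N \<kappa> f \<delta> t x y"
  using assms(2-)
proof (induction arbitrary: x y rule: inc_induct)
  case base
  then show ?case by (simp add: dp_value.simps)
next
  case (step t)
  note t = step(2) and x = step(4)
  have tame: "tame p N \<kappa> t x = \<kappa> t x" using step(5) by (simp add: tame_def)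
  have "ext_integral \<gamma> (\<lambda>(a, b). dp_value p N (tame p N \<kappa>) f \<delta> (Suc t) (x(Suc t := a)) (y(Suc t := b))) =
     ext_integral \<gamma> (\<lambda>(a, b). dp_value p N \<kappa> f \<delta> (Suc t) (x(Suc t := a)) (y(Suc t := b)))"
    if \<gamma>: "\<gamma> \<in> couplings_within p \<delta> (\<kappa> t x)" for \<gamma>
  proof (rule ext_integral_cong_AE)
    have s: "sets \<gamma> = sets (borel \<Otimes>\<^sub>M borel)" and d: "distr \<gamma> borel fst = \<kappa> t x"
      using \<gamma> by (auto simp: couplings_within_def space_prob_algebra)
    have "fst \<in> \<gamma> \<rightarrow>\<^sub>M borel" unfolding measurable_cong_sets[OF s refl] by measurable
    have "AE a in distr \<gamma> borel fst. tail_moment p N \<kappa> (Suc t) (x(Suc t := a)) < \<infinity>"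
      unfolding d using \<kappa> t x step(5) by (rule AE_tail_moment_upd)
    from AE_distrD[OF \<open>fst \<in> _\<close> this]
    show "AE z in \<gamma>. (case z of (a, b) \<Rightarrow> dp_value p N (tame p N \<kappa>) f \<delta> (Suc t) (x(Suc t := a)) (y(Suc t := b))) =
        (case z of (a, b) \<Rightarrow> dp_value p N \<kappa> f \<delta> (Suc t) (x(Suc t := a)) (y(Suc t := b)))"
    proof eventually_elim
      case (elim z)
      show ?case unfolding split_beta' by (rule step.IH[OF coords_upd[OF x] elim])
    qed
  qed
  then show ?case using t unfolding dp_value.simps[of p N _ f \<delta> t] tame by (auto intro!: SUP_cong)
qed

text \<open>By the tower property the mean of the tail moment is 1 plus the p-th moments of the
  later coordinates, which is finite.\<close>

lemma AE_tail_moment: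
  assumes p: "1 \<le> p" and \<mu>: "\<mu> \<in> P_p p N" and dis: "disintegration N \<mu> \<kappa>" and "t \<le> N"
  shows "AE x in \<mu>. tail_moment p N \<kappa> t (restrict x {1..t}) < \<infinity>"
proof -
  have s: "sets \<mu> = sets (coords {1..N})" and P: "prob_space \<mu>"
    using \<mu> by (auto simp: P_p_def space_prob_algebra)
  interpret prob_space \<mu> by fact
  have c: "is_cond_law \<mu> (\<lambda>x. restrict x {1..t}) (coords {1..t}) (\<lambda>x. x (Suc t)) borel (\<kappa> t)" if "t < N" for t
    using dis that by (simp add: disintegration_def)
  have \<kappa>: "\<kappa> t \<in> coords {1..t} \<rightarrow>\<^sub>M prob_algebra borel" if "t < N" for t
    by (rule is_cond_lawD(1)[OF c[OF that]])
  have mr: "(\<lambda>x. restrict x {1..t}) \<in> \<mu> \<rightarrow>\<^sub>M coords {1..t}" if "t \<le> N" for t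
    unfolding measurable_cong_sets[OF s refl] using that by (intro measurable_restrict_coords) auto
  have ms: "(\<lambda>x. x s) \<in> borel_measurable \<mu>" if "s \<in> {1..N}" for s
    unfolding measurable_cong_sets[OF s refl] by (rule measurable_component_singleton[OF that])
  have coord: "(\<integral>\<^sup>+ x. ennreal (\<bar>x s\<bar> powr p) \<partial>\<mu>) < \<infinity>" if s': "s \<in> {1..N}" for s
  proof -
    have "(\<integral>\<^sup>+ x. ennreal (\<bar>x s\<bar> powr p) \<partial>\<mu>) \<le> (\<integral>\<^sup>+ x. ennreal (pnorm p N x powr p) \<partial>\<mu>)"
      unfolding pnorm_powr[OF p]
    proof (intro nn_integral_mono ennreal_leI)
      show "\<bar>x s\<bar> powr p \<le> (\<Sum>s=1..N. \<bar>x s\<bar> powr p)" for x :: "nat \<Rightarrow> real"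
        by (rule member_le_sum[OF s']) auto
    qed
    also have "\<dots> < \<infinity>" using \<mu> by (simp add: P_p_def)
    finally show ?thesis .
  qed
  have "(\<integral>\<^sup>+ x. tail_moment p N \<kappa> t (restrict x {1..t}) \<partial>\<mu>) < \<infinity>"
    using assms(4)
  proof (induction rule: inc_induct)
    case base
    then show ?case by (simp add: tail_moment.simps emeasure_space_1)
  next
    case (step t)
    note t = step(2)
    let ?T = "\<lambda>z. (fst z)(Suc t := snd z)"
    have T: "?T \<in> coords {1..t} \<Otimes>\<^sub>M borel \<rightarrow>\<^sub>M coords {1..Suc t}"
      by (rule measurable_coords_upd[OF insert_Suc_atLeastAtMost]) measurable
    have m: "(\<lambda>z. ennreal (\<bar>snd z\<bar> powr p) + tail_moment p N \<kappa> (Suc t) (?T z)) \<in> borel_measurable (coords {1..t} \<Otimes>\<^sub>M borel)"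
      using measurable_compose[OF T measurable_tail_moment[OF \<kappa> Suc_leI[OF t]]] by measurable
    have m2: "(\<lambda>x. tail_moment p N \<kappa> (Suc t) (restrict x {1..Suc t})) \<in> borel_measurable \<mu>"
      using t by (intro measurable_compose[OF mr measurable_tail_moment[OF \<kappa>]]) auto
    have r: "(restrict x {1..t})(Suc t := x (Suc t)) = restrict x {1..Suc t}" for x :: "nat \<Rightarrow> real"
      by (auto simp: fun_eq_iff)
    have "(\<integral>\<^sup>+ x. tail_moment p N \<kappa> t (restrict x {1..t}) \<partial>\<mu>) =
        (\<integral>\<^sup>+ x. (\<integral>\<^sup>+ a. ennreal (\<bar>a\<bar> powr p) + tail_moment p N \<kappa> (Suc t) ((restrict x {1..t})(Suc t := a)) \<partial>\<kappa> t (restrict x {1..t})) \<partial>\<mu>)"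
      using t by (subst tail_moment.simps) simp
    also have "\<dots> = (\<integral>\<^sup>+ x. ennreal (\<bar>x (Suc t)\<bar> powr p) + tail_moment p N \<kappa> (Suc t) (restrict x {1..Suc t}) \<partial>\<mu>)"
    proof -
      have "(\<lambda>x. x (Suc t)) \<in> borel_measurable \<mu>" by (rule ms) (use t in auto)
      from is_cond_law_nn_integral[OF P mr[OF less_imp_le[OF t]] this c[OF t] m, symmetric]
      show ?thesis by (simp only: fst_conv snd_conv r)
    qed
    also have "\<dots> = (\<integral>\<^sup>+ x. ennreal (\<bar>x (Suc t)\<bar> powr p) \<partial>\<mu>) + (\<integral>\<^sup>+ x. tail_moment p N \<kappa> (Suc t) (restrict x {1..Suc t}) \<partial>\<mu>)"
      using ms[of "Suc t"] t m2 by (intro nn_integral_add) auto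
    also have "\<dots> < \<infinity>"
    proof -
      have "A + B < \<infinity>" if "A < \<infinity>" "B < \<infinity>" for A B :: ennreal using that by simp
      then show ?thesis using coord[of "Suc t"] t step.IH by (auto simp del: restrict_apply)
    qed
    finally show ?case .
  qed
  then have "AE x in \<mu>. tail_moment p N \<kappa> t (restrict x {1..t}) \<noteq> \<infinity>"
    using measurable_compose[OF mr[OF assms(4)] measurable_tail_moment[OF \<kappa> assms(4)]]
    by (intro nn_integral_PInf_AE) auto
  then show ?thesis by eventually_elim (simp add: top.not_eq_extremum)
qed

lemma lower_semicontinuous_liminf:
  assumes lsc: "lower_semicontinuous N f"
    and y: "y \<in> space (coords {1..N})" "\<And>n. yn n \<in> space (coords {1..N})"
    and lim: "\<And>s. s \<in> {1..N} \<Longrightarrow> (\<lambda>n. yn n s) \<longlonglongrightarrow> y s"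
  shows "ereal (f y) \<le> liminf (\<lambda>n. ereal (f (yn n)))"
proof -
  have lt: "limitin (product_topology (\<lambda>_. euclideanreal) {1..N}) yn y sequentially"
    using y lim by (auto simp: limitin_componentwise space_PiM PiE_def)
  have *: "\<forall>\<^sub>F n in sequentially. a < f (yn n)" if "a < f y" for a
  proof -
    have "openin (product_topology (\<lambda>_. euclideanreal) {1..N}) {x \<in> PiE {1..N} (\<lambda>_. UNIV). a < f x}"
      using lsc by (simp add: lower_semicontinuous_def)
    moreover have "y \<in> {x \<in> PiE {1..N} (\<lambda>_. UNIV). a < f x}" using y that by (simp add: space_PiM)
    ultimately have "\<forall>\<^sub>F n in sequentially. yn n \<in> {x \<in> PiE {1..N} (\<lambda>_. UNIV). a < f x}"
      using lt by (auto simp: limitin_def)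
    then show ?thesis by eventually_elim simp
  qed
  show ?thesis
    unfolding le_Liminf_iff
  proof (intro allI impI)
    fix \<alpha> assume "\<alpha> < ereal (f y)"
    then obtain a where a: "\<alpha> \<le> ereal a" "a < f y"
    proof (cases \<alpha>)
      case MInf
      then show thesis using that[of "f y - 1"] by simp
    qed (use that in auto)
    then show "\<forall>\<^sub>F n in sequentially. \<alpha> < ereal (f (yn n))"
      using *[OF a(2)] by (auto elim!: eventually_mono intro: le_less_trans)
  qed
qed

text \<open>Semicontinuity refers to the product topology over {1..N}, while Borel sets belong to
  the type of all functions. Restriction is continuous between the two, so the superlevel sets
  become open in the type.\<close>

lemma borel_measurable_lower_semicontinuous:
  assumes lsc: "lower_semicontinuous N f"
  shows "f \<in> borel_measurable (coords {1..N})"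
  unfolding borel_measurable_iff_greater
proof
  fix a
  let ?I = "{1..N}"
  let ?S = "{x \<in> PiE ?I (\<lambda>_. UNIV). a < f x}"
  have "continuous_map (product_topology (\<lambda>_. euclideanreal) UNIV) (product_topology (\<lambda>_. euclideanreal) ?I) (\<lambda>z. restrict z ?I)"
    by (auto simp: continuous_map_componentwise intro: continuous_map_product_projection)
  moreover have "openin (product_topology (\<lambda>_. euclideanreal) ?I) ?S"
    using lsc by (simp add: lower_semicontinuous_def)
  ultimately have "open {z :: nat \<Rightarrow> real. restrict z ?I \<in> ?S}"
    using openin_continuous_map_preimage[of "product_topology (\<lambda>_. euclideanreal) UNIV" "product_topology (\<lambda>_. euclideanreal) ?I" "\<lambda>z. restrict z ?I" ?S]
    by (simp add: euclidean_product_topology)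
  then have "(\<lambda>x. x) -` {z. restrict z ?I \<in> ?S} \<inter> space (coords ?I) \<in> sets (coords ?I)"
    by (intro measurable_sets[OF measurable_id_coords_borel]) auto
  also have "(\<lambda>x. x) -` {z. restrict z ?I \<in> ?S} \<inter> space (coords ?I) = {x \<in> space (coords ?I). a < f x}"
    by (auto simp: space_PiM)
  finally show "{x \<in> space (coords ?I). a < f x} \<in> sets (coords ?I)" .
qed

text \<open>For \<open>p \<le> \<epsilon>\<close> the growth hypothesis says nothing near the origin, where lower semicontinuity
  takes over.\<close>

lemma lower_growth:
  assumes p: "1 \<le> p" and lsc: "lower_semicontinuous N f" and \<epsilon>: "0 < \<epsilon>" and C: "0 < C"
    and lower: "\<forall>x \<in> space (coords {1..N}). f x \<ge> - C * (1 + pnorm p N x powr (p - \<epsilon>))"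
  shows "\<exists>C'>0. \<forall>x \<in> space (coords {1..N}). - C' * (1 + (\<Sum>s=1..N. \<bar>x s\<bar> powr p)) \<le> f x"
proof (cases "0 < p - \<epsilon>")
  case True
  \<comment> \<open>The factor 2 comes from s powr (p - \<epsilon>) \<le> 1 + s powr p for s \<ge>
    0, a comparison valid on both sides of 1.\<close>
  have "- (2 * C) * (1 + (\<Sum>s=1..N. \<bar>x s\<bar> powr p)) \<le> f x" if x: "x \<in> space (coords {1..N})" for x
  proof -
    have n: "0 \<le> pnorm p N x" by (simp add: pnorm_def)
    have "pnorm p N x powr (p - \<epsilon>) \<le> 1 + pnorm p N x powr p"
    proof (cases "pnorm p N x \<le> 1")
      case True
      then have "pnorm p N x powr (p - \<epsilon>) \<le> 1" using \<open>0 < p - \<epsilon>\<close> n by (intro powr_le1) auto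
      then show ?thesis by (intro add_increasing2) auto
    next
      case False
      then have "pnorm p N x powr (p - \<epsilon>) \<le> pnorm p N x powr p" using \<epsilon> by (intro powr_mono) auto
      then show ?thesis by simp
    qed
    then have "1 + pnorm p N x powr (p - \<epsilon>) \<le> 2 * (1 + pnorm p N x powr p)"
      using powr_ge_zero[of "pnorm p N x" p] unfolding distrib_left by linarith
    then have "C * (1 + pnorm p N x powr (p - \<epsilon>)) \<le> C * (2 * (1 + pnorm p N x powr p))"
      using C by (intro mult_left_mono) auto
    moreover have "- (C * (1 + pnorm p N x powr (p - \<epsilon>))) \<le> f x" using lower x by simp
    moreover have "- (2 * C) * (1 + (\<Sum>s=1..N. \<bar>x s\<bar> powr p)) = - (C * (2 * (1 + pnorm p N x powr p)))"
      unfolding pnorm_powr[OF p] by simp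
    ultimately show ?thesis by linarith
  qed
  then show ?thesis using C by (intro exI[of _ "2 * C"]) auto
next
  case False
  show ?thesis
  proof (rule ccontr)
    assume neg: "\<not> ?thesis"
    have "\<exists>x \<in> space (coords {1..N}). f x < - real (Suc n) * (1 + (\<Sum>s=1..N. \<bar>x s\<bar> powr p))" for n
      using neg of_nat_0_less_iff[of "Suc n"] unfolding not_le[symmetric] by blast
    then obtain y where y: "\<And>n. y n \<in> space (coords {1..N})"
      and fy: "\<And>n. f (y n) < - real (Suc n) * (1 + (\<Sum>s=1..N. \<bar>y n s\<bar> powr p))"
      by metis
    have fy': "f (y n) < - real (Suc n)" for n
    proof -
      have "real (Suc n) * 1 \<le> real (Suc n) * (1 + (\<Sum>s=1..N. \<bar>y n s\<bar> powr p))"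
        by (intro mult_left_mono) (auto simp: sum_nonneg)
      moreover have "- real (Suc n) * (1 + (\<Sum>s=1..N. \<bar>y n s\<bar> powr p)) = - (real (Suc n) * (1 + (\<Sum>s=1..N. \<bar>y n s\<bar> powr p)))"
        by (rule mult_minus_left)
      moreover note fy[of n]
      ultimately show ?thesis unfolding mult_1_right by (simp only: mult_minus_left)
    qed
    \<comment> \<open>For a nonpositive exponent the growth hypothesis bounds f from below away from
      the origin, so values below - (n + 1) force the points to converge to it.\<close>
    have "(\<lambda>n. pnorm p N (y n)) \<longlonglongrightarrow> 0"
    proof (rule order_tendstoI)
      show "\<forall>\<^sub>F n in sequentially. a < pnorm p N (y n)" if "a < 0" for a
        using that by (auto intro!: always_eventually less_le_trans[of a 0] simp: pnorm_def)
      fix e :: real assume e: "0 < e"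
      obtain n0 where n0: "C * (1 + e powr (p - \<epsilon>)) < real n0" using reals_Archimedean2 by blast
      have "pnorm p N (y n) < e" if "n0 \<le> n" for n
      proof (rule ccontr)
        assume "\<not> pnorm p N (y n) < e"
        then have "pnorm p N (y n) powr (p - \<epsilon>) \<le> e powr (p - \<epsilon>)"
          using False e by (intro powr_mono2') auto
        then have "C * (1 + pnorm p N (y n) powr (p - \<epsilon>)) \<le> C * (1 + e powr (p - \<epsilon>))"
          using C by (intro mult_left_mono) auto
        moreover have "- (C * (1 + pnorm p N (y n) powr (p - \<epsilon>))) \<le> f (y n)" using lower y by simp
        ultimately show False using fy'[of n] n0 that by simp
      qed
      then show "\<forall>\<^sub>F n in sequentially. pnorm p N (y n) < e" by (auto simp: eventually_sequentially)
    qed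
    moreover have "\<bar>y n s\<bar> \<le> pnorm p N (y n)" if "s \<in> {1..N}" for n s
    proof -
      have "\<bar>y n s\<bar> powr p \<le> (\<Sum>s=1..N. \<bar>y n s\<bar> powr p)"
        by (rule member_le_sum[OF that]) auto
      then have "(\<bar>y n s\<bar> powr p) powr (1 / p) \<le> pnorm p N (y n)"
        unfolding pnorm_def using p by (intro powr_mono2) auto
      then show ?thesis using p by (simp add: powr_powr)
    qed
    ultimately have "(\<lambda>n. y n s) \<longlonglongrightarrow> 0" if "s \<in> {1..N}" for s
      using that by (intro Lim_null_comparison[of "\<lambda>n. y n s" "\<lambda>n. pnorm p N (y n)"]) auto
    \<comment> \<open>Near the origin f stays above f(0) - 1, against values that tend to minus
      infinity.\<close>
    then have "ereal (f (restrict (\<lambda>_. 0) {1..N})) \<le> liminf (\<lambda>n. ereal (f (y n)))"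
      by (intro lower_semicontinuous_liminf[OF lsc _ y]) (auto simp: space_PiM)
    moreover have "ereal (f (restrict (\<lambda>_. 0) {1..N}) - 1) < ereal (f (restrict (\<lambda>_. 0) {1..N}))" by simp
    ultimately have "ereal (f (restrict (\<lambda>_. 0) {1..N}) - 1) < liminf (\<lambda>n. ereal (f (y n)))" by (rule less_le_trans[rotated])
    then have "\<forall>\<^sub>F n in sequentially. ereal (f (restrict (\<lambda>_. 0) {1..N}) - 1) < ereal (f (y n))" by (rule less_LiminfD)
    then obtain n0 where n0: "\<And>n. n0 \<le> n \<Longrightarrow> f (restrict (\<lambda>_. 0) {1..N}) - 1 < f (y n)" by (auto simp: eventually_sequentially)
    obtain n1 where n1: "- f (restrict (\<lambda>_. 0) {1..N}) + 1 < real n1" using reals_Archimedean2 by blast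
    show False using n0[of "max n0 n1"] fy'[of "max n0 n1"] n1 by simp
  qed
qed

section \<open>Strategies and bicausal couplings\<close>

text \<open>\<open>step_law\<close> is a version picked by choice. Uniqueness compares it with a
  concrete kernel under \<mu>, and the projection \<pi> carries this over to paths under
  \<gamma>.\<close>

lemma step_law_eq_AE:
  assumes \<gamma>: "prob_space \<gamma>" and \<pi>: "\<pi> \<in> \<gamma> \<rightarrow>\<^sub>M coords {1..N}" and \<mu>: "distr \<gamma> (coords {1..N}) \<pi> = \<mu>"
    and t: "t < N"
    and K: "is_cond_law \<mu> (\<lambda>x. restrict x {1..t}) (coords {1..t}) (\<lambda>x. x (Suc t)) borel K"
  shows "AE \<omega> in \<gamma>. step_law \<mu> t (restrict (\<pi> \<omega>) {1..t}) = K (restrict (\<pi> \<omega>) {1..t})"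
proof -
  have s: "sets \<mu> = sets (coords {1..N})" unfolding \<mu>[symmetric] by simp
  have P: "prob_space \<mu>" unfolding \<mu>[symmetric] by (rule prob_space.prob_space_distr[OF \<gamma> \<pi>])
  have r: "(\<lambda>x. restrict x {1..t}) \<in> \<mu> \<rightarrow>\<^sub>M coords {1..t}"
    unfolding measurable_cong_sets[OF s refl] using t by (intro measurable_restrict_coords) auto
  have m: "(\<lambda>x. x (Suc t)) \<in> borel_measurable \<mu>"
    unfolding measurable_cong_sets[OF s refl] using t by (intro measurable_component_singleton) auto
  have "is_cond_law \<mu> (\<lambda>x. restrict x {1..t}) (coords {1..t}) (\<lambda>x. x (Suc t)) borel (step_law \<mu> t)"
    unfolding step_law_def using K by (rule is_cond_law_cond_law)
  from is_cond_law_unique[OF P r m this K, of "\<lambda>x. x" "\<lambda>x. x"]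
  have "AE x in distr \<mu> (coords {1..t}) (\<lambda>x. restrict x {1..t}). step_law \<mu> t x = K x" by simp
  from AE_distrD[OF r this]
  have "AE x in distr \<gamma> (coords {1..N}) \<pi>. step_law \<mu> t (restrict x {1..t}) = K (restrict x {1..t})"
    unfolding \<mu> .
  from AE_distrD[OF \<pi> this] show ?thesis .
qed

lemma pair_step_law_eq_AE:
  assumes "pair_disintegration N \<gamma> k" "t < N"
  shows "AE \<omega> in \<gamma>. pair_step_law \<gamma> t (past t \<omega>) = k t (past t \<omega>)"
proof -
  note P = pair_disintegrationD[OF assms(1)]
  note m = P(3)[OF less_imp_le[OF assms(2)]] P(4)[OF assms(2)]
  have "is_cond_law \<gamma> (\<lambda>\<omega>. past t \<omega>) (pcoords {1..t}) (\<lambda>\<omega>. pstep \<omega> (Suc t)) (borel \<Otimes>\<^sub>M borel) (pair_step_law \<gamma> t)"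
    unfolding pair_step_law_eq using P(5)[OF assms(2)] by (rule is_cond_law_cond_law)
  from is_cond_law_unique[OF P(1) m this P(5)[OF assms(2)], of "\<lambda>x. x" "\<lambda>x. x"]
  have "AE x in distr \<gamma> (pcoords {1..t}) (\<lambda>\<omega>. past t \<omega>). pair_step_law \<gamma> t x = k t x"
    by (simp add: borel_prod)
  from AE_distrD[OF m(1) this] show ?thesis .
qed

lemma F_functional_le_iff_pair_disintegration:
  assumes "pair_disintegration N \<gamma> k"
  shows "F_functional p N 0 \<gamma> \<le> r \<longleftrightarrow> (\<forall>t<N. AE \<omega> in \<gamma>. cost p (k t (past t \<omega>)) \<le> r)"
  using F_functional_le_iff[of \<gamma> 0 N k p r] pair_disintegrationD[OF assms] by (auto simp flip: One_nat_def)

context dp_setting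
begin

lemma f_measurable_path:
  assumes "pair_disintegration N \<gamma> k"
  shows "ext_integral (distr \<gamma> (coords {1..N}) snd) (\<lambda>y. ereal (f y)) =
    ext_integral \<gamma> (\<lambda>\<omega>. ereal (f (snd (past N \<omega>))))"
proof -
  note P = pair_disintegrationD[OF assms]
  note [measurable] = f_meas
  have "snd \<in> \<gamma> \<rightarrow>\<^sub>M coords {1..N}" unfolding measurable_cong_sets[OF P(2) refl] by measurable
  moreover have "(\<lambda>y. ereal (f y)) \<in> borel_measurable (coords {1..N})" by measurable
  ultimately have "ext_integral (distr \<gamma> (coords {1..N}) snd) (\<lambda>y. ereal (f y)) = ext_integral \<gamma> (\<lambda>\<omega>. ereal (f (snd \<omega>)))"
    by (rule ext_integral_distr)
  also have "\<dots> = ext_integral \<gamma> (\<lambda>\<omega>. ereal (f (snd (past N \<omega>))))"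
    using sets_eq_imp_space_eq[OF P(2)] by (intro ext_integral_cong_AE AE_I2) (simp add: prestrict_id)
  finally show ?thesis .
qed

lemma value_upper_bound:
  assumes \<mu>: "\<mu> \<in> space (prob_algebra (coords {1..N}))" "disintegration N \<mu> \<kappa>"
    and \<nu>: "\<nu> \<in> AW_ball p N \<delta> \<mu>"
  shows "ext_integral \<nu> (\<lambda>y. ereal (f y)) \<le> V 0 (\<lambda>_. undefined) (\<lambda>_. undefined)"
proof -
  have s\<mu>: "sets \<mu> = sets (coords {1..N})" using \<mu> by (simp add: space_prob_algebra)
  have s\<nu>: "sets \<nu> = sets (coords {1..N})" using \<nu> by (simp add: AW_ball_def P_p_def space_prob_algebra)
  obtain \<gamma> where \<gamma>: "\<gamma> \<in> bicausal N \<mu> \<nu>" and F: "F_functional p N 0 \<gamma> < ennreal \<delta>"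
    using \<nu> by (auto simp: AW_ball_def AW_inf_def INF_less_iff)
  have cp: "\<gamma> \<in> space (prob_algebra (\<mu> \<Otimes>\<^sub>M \<nu>))" "distr \<gamma> \<mu> fst = \<mu>" "distr \<gamma> \<nu> snd = \<nu>"
    and bc: "\<And>t. t < N \<Longrightarrow> AE \<omega> in \<gamma>. pair_step_law \<gamma> t (past t \<omega>) \<in>
       couplings (step_law \<mu> t (fst (past t \<omega>))) (step_law \<nu> t (snd (past t \<omega>)))"
    using \<gamma> by (auto simp: bicausal_def couplings_def prestrict_def split_beta')
  have sp: "sets (\<mu> \<Otimes>\<^sub>M \<nu>) = sets (pcoords {1..N})" using s\<mu> s\<nu> by (intro sets_pair_measure_cong)
  have s\<gamma>: "sets \<gamma> = sets (pcoords {1..N})" and P: "prob_space \<gamma>"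
    using cp(1) sp by (auto simp: space_prob_algebra)
  have dis: "pair_disintegration N \<gamma> (pair_step_law \<gamma>)"
    unfolding pair_disintegration_def
  proof (intro conjI allI impI)
    show "\<gamma> \<in> space (prob_algebra (pcoords {1..N}))" using s\<gamma> P by (simp add: space_prob_algebra)
    fix t assume t: "t < N"
    have "(\<lambda>\<omega>. past t \<omega>) \<in> \<gamma> \<rightarrow>\<^sub>M pcoords {1..t}"
      unfolding measurable_cong_sets[OF s\<gamma> refl] using t by (intro measurable_prestrict) auto
    moreover have "(\<lambda>\<omega>. pstep \<omega> (Suc t)) \<in> \<gamma> \<rightarrow>\<^sub>M borel \<Otimes>\<^sub>M borel"
      unfolding measurable_cong_sets[OF s\<gamma> refl] using t by (intro measurable_pstep) auto
    ultimately show "is_cond_law \<gamma> (\<lambda>\<omega>. past t \<omega>) (pcoords {1..t}) (\<lambda>\<omega>. pstep \<omega> (Suc t)) (borel \<Otimes>\<^sub>M borel) (pair_step_law \<gamma> t)"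
      unfolding pair_step_law_eq using ex_cond_law_real_pair[OF P] is_cond_law_cond_law by blast
  qed
  note D = pair_disintegrationD[OF dis]
  \<comment> \<open>One real number strictly below \<delta> that bounds all conditional costs; it
    supplies the uniform bound required of admissible measures.\<close>
  define r where "r = enn2real (F_functional p N 0 \<gamma>)"
  have r: "F_functional p N 0 \<gamma> = ennreal r" "0 \<le> r"
    using F by (auto simp: r_def less_top intro!: ennreal_enn2real[symmetric] intro: less_trans)
  then have r\<delta>: "r < \<delta>" using F by (simp add: ennreal_less_iff)
  \<comment> \<open>\<open>couplings\<close> uses the two measures themselves as target spaces; an
    image measure depends on its target only through the sigma-algebra.\<close>
  have fst: "distr \<gamma> (coords {1..N}) fst = \<mu>" using cp(2) s\<mu> by (metis distr_cong)
  have snd: "distr \<gamma> (coords {1..N}) snd = \<nu>" using cp(3) s\<nu> by (metis distr_cong)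
  have fm: "fst \<in> \<gamma> \<rightarrow>\<^sub>M coords {1..N}" unfolding measurable_cong_sets[OF s\<gamma> refl] by measurable
  have "admissible \<gamma> (pair_step_law \<gamma>) (ennreal (r powr p))"
    unfolding admissible_def
  proof (intro conjI dis allI impI)
    fix t assume t: "t < N"
    have "AE \<omega> in \<gamma>. cost p (pair_step_law \<gamma> t (past t \<omega>)) \<le> ennreal r"
      using F_functional_le_iff_pair_disintegration[OF dis, of p "ennreal r"] r t by simp
    moreover have "is_cond_law \<mu> (\<lambda>x. restrict x {1..t}) (coords {1..t}) (\<lambda>x. x (Suc t)) borel (\<kappa> t)"
      using \<mu>(2) t by (simp add: disintegration_def)
    note step_law_eq_AE[OF P fm fst t this]
    ultimately show "AE \<omega> in \<gamma>. distr (pair_step_law \<gamma> t (past t \<omega>)) borel fst = \<kappa> t (fst (past t \<omega>)) \<and>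
       displacement p (pair_step_law \<gamma> t (past t \<omega>)) \<le> ennreal (r powr p)"
      using bc[OF t] AE_space
    proof eventually_elim
      case (elim \<omega>)
      have x: "fst (past t \<omega>) \<in> space (coords {1..t})"
        using measurable_space[OF D(3)[OF less_imp_le[OF t]] elim(4)] by (auto simp: space_pair_measure)
      have eq: "step_law \<mu> t (fst (past t \<omega>)) = \<kappa> t (fst (past t \<omega>))"
        using elim(2) by (simp add: prestrict_def)
      have "distr (pair_step_law \<gamma> t (past t \<omega>)) (\<kappa> t (fst (past t \<omega>))) fst = \<kappa> t (fst (past t \<omega>))"
        using elim(3) unfolding couplings_def eq by simp
      moreover have "distr (pair_step_law \<gamma> t (past t \<omega>)) (\<kappa> t (fst (past t \<omega>))) fst =
          distr (pair_step_law \<gamma> t (past t \<omega>)) borel fst"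
        using kernel(2)[OF t x] by (intro distr_cong) auto
      moreover have "displacement p (pair_step_law \<gamma> t (past t \<omega>)) \<le> ennreal (r powr p)"
        using elim(1) cost_le_iff[OF p r(2)] by (simp add: displacement_def)
      ultimately show ?case by simp
    qed
  qed
  moreover have "ennreal (r powr p) < ennreal (\<delta> powr p)"
    using r(2) r\<delta> p \<delta> by (intro ennreal_lessI powr_less_mono2) auto
  ultimately have "ext_integral \<gamma> (\<lambda>\<omega>. V N (fst (past N \<omega>)) (snd (past N \<omega>))) \<le> V 0 (\<lambda>_. undefined) (\<lambda>_. undefined)"
    by (rule path_upper_bound) simp
  then show ?thesis using f_measurable_path[OF dis] unfolding snd V_N by simp
qed

text \<open>The index chosen at time t depends on both pasts, but at that stage the past of x has
  been recovered already, so the right decoder is known from y alone.\<close>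

primrec decode_path :: "nat \<Rightarrow> nat \<Rightarrow> (nat \<Rightarrow> real) \<Rightarrow> nat \<Rightarrow> real" where
  "decode_path K 0 y = (\<lambda>_. undefined)"
| "decode_path K (Suc t) y =
     (decode_path K t y)(Suc t := dc (sel K t (decode_path K t y, restrict y {1..t})) (y (Suc t)))"

lemma decode_path_restrict: "t \<le> n \<Longrightarrow> decode_path K t (restrict y {1..n}) = decode_path K t y"
proof (induction t)
  case (Suc t)
  have r: "restrict (restrict y {1..n}) {1..t} = restrict y {1..t}" "restrict y {1..n} (Suc t) = y (Suc t)"
    using Suc.prems by (auto simp: fun_eq_iff)
  show ?case unfolding decode_path.simps r Suc.IH[OF Suc_leD[OF Suc.prems]] ..
qed simp

lemma decode_path_meas: "t \<le> n \<Longrightarrow> t \<le> N \<Longrightarrow> decode_path K t \<in> coords {1..n} \<rightarrow>\<^sub>M coords {1..t}"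
proof (induction t)
  case 0
  show ?case by (simp add: space_PiM)
next
  case (Suc t)
  then have IH: "decode_path K t \<in> coords {1..n} \<rightarrow>\<^sub>M coords {1..t}" by simp
  have r: "(\<lambda>y. restrict y {1..t}) \<in> coords {1..n} \<rightarrow>\<^sub>M coords {1..t}"
    using Suc.prems by (intro measurable_restrict_coords) auto
  have s: "(\<lambda>y. sel K t (decode_path K t y, restrict y {1..t})) \<in> coords {1..n} \<rightarrow>\<^sub>M count_space UNIV"
    using Suc.prems by (intro measurable_compose[OF _ sel_meas] measurable_Pair IH r) auto
  have y: "(\<lambda>y. y (Suc t)) \<in> borel_measurable (coords {1..n})"
    using Suc.prems by (intro measurable_component_singleton) auto
  have "(\<lambda>y. dc (sel K t (decode_path K t y, restrict y {1..t})) (y (Suc t))) \<in> borel_measurable (coords {1..n})"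
    by (rule measurable_compose_countable[OF measurable_compose[OF y dc_meas] s])
  then have "(\<lambda>y. (decode_path K t y)(Suc t := dc (sel K t (decode_path K t y, restrict y {1..t})) (y (Suc t)))) \<in> coords {1..n} \<rightarrow>\<^sub>M coords {1..Suc t}"
    by (intro measurable_coords_upd[OF insert_Suc_atLeastAtMost] IH)
  moreover have "decode_path K (Suc t) = (\<lambda>y. (decode_path K t y)(Suc t := dc (sel K t (decode_path K t y, restrict y {1..t})) (y (Suc t))))"
    by (rule ext) (rule decode_path.simps(2))
  ultimately show ?case by (simp only:)
qed

text \<open>Hence the law of \<open>y\<^sub>t\<^sub>+\<^sub>1\<close> given both paths depends on \<open>y\<^sub>1\<^sub>:\<^sub>t\<close> only, which makes the coupling
  bicausal.\<close>

lemma AE_decode_path: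
  assumes dis: "pair_disintegration N \<gamma> (strategy K)" and "t \<le> N"
  shows "AE \<omega> in \<gamma>. fst (past t \<omega>) = decode_path K t (snd (past t \<omega>))"
  using assms(2)
proof (induction t)
  case 0
  show ?case unfolding prestrict_0 by simp
next
  case (Suc t)
  then have t: "t < N" by simp
  note P = pair_disintegrationD[OF dis]
  let ?Q = "\<lambda>w. fst (snd w) = dc (sel K t (fst w)) (snd (snd w))"
  have "(\<lambda>w. dc (sel K t (fst w)) (snd (snd w))) \<in> borel_measurable (pcoords {1..t} \<Otimes>\<^sub>M (borel \<Otimes>\<^sub>M borel))"
    by (rule measurable_compose_countable[OF measurable_compose[OF _ dc_meas] measurable_compose[OF _ sel_meas[OF t]]]) measurable
  then have Q: "Measurable.pred (pcoords {1..t} \<Otimes>\<^sub>M (borel \<Otimes>\<^sub>M borel)) ?Q" by measurable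
  \<comment> \<open>The decoding identity holds at each past under the strategy's one-step law; the
    kernel form of Fubini turns it into a statement about the next pair of the path.\<close>
  have "AE \<omega> in \<gamma>. AE b in strategy K t (past t \<omega>). ?Q (past t \<omega>, b)"
  proof (rule AE_I2)
    fix \<omega> assume "\<omega> \<in> space \<gamma>"
    from strategy(3)[OF t measurable_space[OF P(3)[OF less_imp_le[OF t]] this]]
    show "AE b in strategy K t (past t \<omega>). ?Q (past t \<omega>, b)" by simp
  qed
  then have "AE \<omega> in \<gamma>. ?Q (past t \<omega>, pstep \<omega> (Suc t))"
    using is_cond_law_AE_iff[OF P(1) P(3)[OF less_imp_le[OF t]] P(4)[OF t] P(5)[OF t] Q] by simp
  moreover have "AE \<omega> in \<gamma>. fst (past t \<omega>) = decode_path K t (snd (past t \<omega>))"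
    using Suc by simp
  ultimately show ?case
  proof eventually_elim
    case (elim \<omega>)
    have a: "snd (past s \<omega>) = restrict (snd \<omega>) {1..s}" for s by (simp add: prestrict_def)
    have b: "restrict (restrict (snd \<omega>) {1..Suc t}) {1..t} = restrict (snd \<omega>) {1..t}" by (auto simp: fun_eq_iff)
    have c: "decode_path K t (restrict (snd \<omega>) {1..Suc t}) = fst (past t \<omega>)"
      unfolding elim(2) a decode_path_restrict[OF le_SucI[OF order_refl]] decode_path_restrict[OF order_refl] ..
    have d: "past t \<omega> = (fst (past t \<omega>), restrict (snd \<omega>) {1..t})"
      by (simp add: prestrict_def)
    have "decode_path K (Suc t) (snd (past (Suc t) \<omega>)) =
      (fst (past t \<omega>))(Suc t := dc (sel K t (past t \<omega>)) (snd \<omega> (Suc t)))"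
      unfolding a decode_path.simps b c using d by simp
    also have "\<dots> = fst (past (Suc t) \<omega>)"
      using elim(1) unfolding prestrict_Suc by (simp add: pupd_def pstep_def)
    finally show ?case by simp
  qed
qed

text \<open>A kernel in y alone: the strategy is evaluated at the decoded past of x. It serves as a
  disintegration of the second marginal.\<close>

definition strategy_second :: "nat \<Rightarrow> nat \<Rightarrow> (nat \<Rightarrow> real) \<Rightarrow> real measure" where
  "strategy_second K t y = distr (strategy K t (decode_path K t y, y)) borel snd"

lemma strategy_second_meas:
  assumes t: "t < N"
  shows "strategy_second K t \<in> coords {1..t} \<rightarrow>\<^sub>M prob_algebra borel"
proof -
  have "(\<lambda>y. (decode_path K t y, y)) \<in> coords {1..t} \<rightarrow>\<^sub>M pcoords {1..t}"
    using t by (intro measurable_Pair decode_path_meas) auto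
  from measurable_compose[OF this strategy_meas[OF t]]
  have [measurable]: "(\<lambda>y. strategy K t (decode_path K t y, y)) \<in> coords {1..t} \<rightarrow>\<^sub>M prob_algebra (borel \<Otimes>\<^sub>M borel)" .
  show ?thesis unfolding strategy_second_def[abs_def] by measurable
qed

text \<open>The path measure built from the maximising kernels has the required value by the
  martingale property. What remains is that it couples \<mu> bicausally with its second marginal,
  and that this marginal has finite p-th moment and lies in the ball.\<close>

lemma value_lower_bound:
  assumes \<mu>: "\<mu> \<in> space (prob_algebra (coords {1..N}))" "disintegration N \<mu> \<kappa>"
  shows "\<exists>\<nu>\<in>AW_ball p N \<delta> \<mu>. ext_integral \<nu> (\<lambda>y. ereal (f y)) = W K 0 (\<lambda>_. undefined) (\<lambda>_. undefined)"
proof -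
  obtain \<gamma> where dis: "pair_disintegration N \<gamma> (strategy K)"
    using ex_pair_disintegration[of N "strategy K"] strategy_meas by blast
  note P = pair_disintegrationD[OF dis]
  note adm = path_strategy_value(1)[OF dis]
  define \<nu> where "\<nu> = distr \<gamma> (coords {1..N}) snd"
  have fm: "fst \<in> \<gamma> \<rightarrow>\<^sub>M coords {1..N}" and sm: "snd \<in> \<gamma> \<rightarrow>\<^sub>M coords {1..N}"
    unfolding measurable_cong_sets[OF P(2) refl] by measurable
  have rm: "(\<lambda>x. restrict x {1..t}) \<in> coords {1..N} \<rightarrow>\<^sub>M coords {1..t}" if "t < N" for t
    using that by (intro measurable_restrict_coords) auto
  have cm: "(\<lambda>x. x (Suc t)) \<in> borel_measurable (coords {1..N})" if "t < N" for t
    using that by (intro measurable_component_singleton) auto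
  have s\<mu>: "sets \<mu> = sets (coords {1..N})" using \<mu> by (simp add: space_prob_algebra)
  have s\<nu>: "sets \<nu> = sets (coords {1..N})" by (simp add: \<nu>_def)
  have fst: "distr \<gamma> (coords {1..N}) fst = \<mu>"
  proof (rule disintegration_unique[OF _ \<mu>(1) _ \<mu>(2)])
    show "distr \<gamma> (coords {1..N}) fst \<in> space (prob_algebra (coords {1..N}))"
      using prob_space.prob_space_distr[OF P(1) fm] by (simp add: space_prob_algebra)
    show "disintegration N (distr \<gamma> (coords {1..N}) fst) \<kappa>"
      unfolding disintegration_def
    proof (intro allI impI)
      fix t assume t: "t < N"
      \<comment> \<open>Whatever index is selected, the one-step law has first marginal given by the
        kernel at the past of x, which is causality from x to y.\<close>
      have "is_cond_law \<gamma> (\<lambda>\<omega>. fst (past t \<omega>)) (coords {1..t}) (\<lambda>\<omega>. fst (pstep \<omega> (Suc t))) borel (\<kappa> t)"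
        using measurable_space[OF P(3)[OF less_imp_le[OF t]]]
        by (intro is_cond_law_project[OF P(1) P(3)[OF less_imp_le[OF t]] P(4)[OF t] P(5)[OF t]] \<kappa>[OF t] AE_I2 strategy(1)[OF t]) auto
      then show "is_cond_law (distr \<gamma> (coords {1..N}) fst) (\<lambda>x. restrict x {1..t}) (coords {1..t}) (\<lambda>x. x (Suc t)) borel (\<kappa> t)"
        using fm rm[OF t] cm[OF t] by (subst is_cond_law_distr) (auto simp: prestrict_def pstep_def)
    qed
  qed
  have second: "is_cond_law \<nu> (\<lambda>x. restrict x {1..t}) (coords {1..t}) (\<lambda>x. x (Suc t)) borel (strategy_second K t)"
    and second_eq: "AE \<omega> in \<gamma>. distr (strategy K t (past t \<omega>)) borel snd = strategy_second K t (snd (past t \<omega>))"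
    if t: "t < N" for t
  proof -
    show eq: "AE \<omega> in \<gamma>. distr (strategy K t (past t \<omega>)) borel snd = strategy_second K t (snd (past t \<omega>))"
      using AE_decode_path[OF dis less_imp_le[OF t]]
    proof eventually_elim
      case (elim \<omega>)
      then show ?case unfolding strategy_second_def by (metis prod.collapse)
    qed
    \<comment> \<open>Causality from y to x: by decoding, the conditional law of the new
      y-coordinate given both pasts is almost surely a function of the past of y.\<close>
    have "is_cond_law \<gamma> (\<lambda>\<omega>. snd (past t \<omega>)) (coords {1..t}) (\<lambda>\<omega>. snd (pstep \<omega> (Suc t))) borel (strategy_second K t)"
      by (rule is_cond_law_project[OF P(1) P(3)[OF less_imp_le[OF t]] P(4)[OF t] P(5)[OF t],
            where u=snd and w=snd, OF _ _ strategy_second_meas[OF t] eq]) auto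
    then show "is_cond_law \<nu> (\<lambda>x. restrict x {1..t}) (coords {1..t}) (\<lambda>x. x (Suc t)) borel (strategy_second K t)"
      unfolding \<nu>_def using sm rm[OF t] cm[OF t] by (subst is_cond_law_distr) (auto simp: prestrict_def pstep_def)
  qed
  have bc: "\<gamma> \<in> bicausal N \<mu> \<nu>"
    unfolding bicausal_def couplings_def[of \<mu>]
  proof (intro CollectI conjI allI impI)
    have "sets (\<mu> \<Otimes>\<^sub>M \<nu>) = sets (pcoords {1..N})" using s\<mu> s\<nu> by (intro sets_pair_measure_cong)
    then show "\<gamma> \<in> space (prob_algebra (\<mu> \<Otimes>\<^sub>M \<nu>))" using P by (simp add: space_prob_algebra)
    show "distr \<gamma> \<mu> fst = \<mu>" using fst s\<mu> by (metis distr_cong)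
    show "distr \<gamma> \<nu> snd = \<nu>" using s\<nu> \<nu>_def by (metis distr_cong)
    fix t assume t: "t < N"
    have \<kappa>t: "is_cond_law \<mu> (\<lambda>x. restrict x {1..t}) (coords {1..t}) (\<lambda>x. x (Suc t)) borel (\<kappa> t)"
      using \<mu>(2) t by (simp add: disintegration_def)
    show "AE (x, y) in \<gamma>. pair_step_law \<gamma> t (restrict x {1..t}, restrict y {1..t}) \<in>
       couplings (step_law \<mu> t (restrict x {1..t})) (step_law \<nu> t (restrict y {1..t}))"
      using pair_step_law_eq_AE[OF dis t] step_law_eq_AE[OF P(1) fm fst t \<kappa>t]
        step_law_eq_AE[OF P(1) sm \<nu>_def[symmetric] t second[OF t]] second_eq[OF t] AE_space
    proof eventually_elim
      case (elim \<omega>)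
      have z: "past t \<omega> \<in> space (pcoords {1..t})"
        using measurable_space[OF P(3)[OF less_imp_le[OF t]] elim(5)] .
      then have x: "fst (past t \<omega>) \<in> space (coords {1..t})" "snd (past t \<omega>) \<in> space (coords {1..t})"
        by (auto simp: space_pair_measure)
      let ?s = "strategy K t (past t \<omega>)"
      let ?x = "\<kappa> t (fst (past t \<omega>))" and ?y = "strategy_second K t (snd (past t \<omega>))"
      have sx: "sets ?x = sets borel" by (rule kernel(2)[OF t x(1)])
      have sy: "sets ?y = sets borel" by (simp add: strategy_second_def)
      have "sets (?x \<Otimes>\<^sub>M ?y) = sets (borel \<Otimes>\<^sub>M borel)" using sx sy by (intro sets_pair_measure_cong)
      then have "?s \<in> space (prob_algebra (?x \<Otimes>\<^sub>M ?y))"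
        using measurable_space[OF strategy_meas[OF t] z] by (simp add: space_prob_algebra)
      moreover have "distr ?s ?x fst = ?x"
        using strategy(1)[OF t z] sx by (metis distr_cong)
      moreover have "distr ?s ?y snd = ?y"
        using elim(4) sy by (metis distr_cong)
      ultimately have "?s \<in> couplings ?x ?y" by (simp add: couplings_def)
      then show ?case using elim(1-3) by (simp add: prestrict_def split_beta')
    qed
  qed
  \<comment> \<open>The competitors at level K share the radius, so the essential supremum of the
    costs is bounded strictly below \<delta>.\<close>
  have "F_functional p N 0 \<gamma> \<le> ennreal (radius \<delta> K)"
    unfolding F_functional_le_iff_pair_disintegration[OF dis]
  proof (intro allI impI AE_I2)
    fix t \<omega> assume t: "t < N" and \<omega>: "\<omega> \<in> space \<gamma>"
    show "cost p (strategy K t (past t \<omega>)) \<le> ennreal (radius \<delta> K)"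
      using strategy(2)[OF t measurable_space[OF P(3)[OF less_imp_le[OF t]] \<omega>]] radius(1)[of K]
      by (subst cost_le_iff[OF p]) (auto simp: displacement_def)
  qed
  then have "AW_inf p N \<mu> \<nu> \<le> ennreal (radius \<delta> K)"
    unfolding AW_inf_def using bc by (rule INF_lower2[rotated])
  also have "\<dots> < ennreal \<delta>" using radius[of K] \<delta> by (intro ennreal_lessI) auto
  finally have AW: "AW_inf p N \<mu> \<nu> < ennreal \<delta>" .
  \<comment> \<open>At time N the bound \<open>Lb\<close> contains C times the p-th moments of y,
    and its integral along the path is finite.\<close>
  have mom: "(\<integral>\<^sup>+ y. ennreal (pnorm p N y powr p) \<partial>\<nu>) < \<infinity>"
  proof -
    have ym: "(\<lambda>y. y s) \<in> borel_measurable (coords {1..N})" if "s \<in> {1..N}" for s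
      by (rule measurable_component_singleton[OF that])
    have m: "(\<lambda>y. ennreal (\<Sum>s=1..N. \<bar>y s\<bar> powr p)) \<in> borel_measurable (coords {1..N})"
      using ym by measurable
    have m': "(\<lambda>\<omega>. ennreal (\<Sum>s=1..N. \<bar>snd \<omega> s\<bar> powr p)) \<in> borel_measurable \<gamma>"
      using measurable_compose[OF sm m] .
    have "ennreal C * (\<integral>\<^sup>+ y. ennreal (pnorm p N y powr p) \<partial>\<nu>) = ennreal C * (\<integral>\<^sup>+ \<omega>. ennreal (\<Sum>s=1..N. \<bar>snd \<omega> s\<bar> powr p) \<partial>\<gamma>)"
      unfolding pnorm_powr[OF p] \<nu>_def using m by (subst nn_integral_distr[OF sm]) auto
    also have "\<dots> = (\<integral>\<^sup>+ \<omega>. ennreal C * ennreal (\<Sum>s=1..N. \<bar>snd \<omega> s\<bar> powr p) \<partial>\<gamma>)"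
      by (rule nn_integral_cmult[OF m', symmetric])
    also have "\<dots> \<le> (\<integral>\<^sup>+ \<omega>. Lb N (fst (past N \<omega>)) (snd (past N \<omega>)) \<partial>\<gamma>)"
    proof (intro nn_integral_mono)
      fix \<omega>
      have "ennreal (\<Sum>s=1..N. \<bar>snd \<omega> s\<bar> powr p) = (\<Sum>s=1..N. ennreal (\<bar>snd (past N \<omega>) s\<bar> powr p))"
        by (simp add: sum_ennreal prestrict_def)
      then show "ennreal C * ennreal (\<Sum>s=1..N. \<bar>snd \<omega> s\<bar> powr p) \<le> Lb N (fst (past N \<omega>)) (snd (past N \<omega>))"
        unfolding Lb_def by (intro mult_left_mono) auto
    qed
    also have "\<dots> < \<infinity>" by (rule Lb_path_finite[OF adm]) auto
    finally show ?thesis using C by (auto simp: ennreal_mult_less_top)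
  qed
  have "\<nu> \<in> AW_ball p N \<delta> \<mu>"
    using AW mom prob_space.prob_space_distr[OF P(1) sm]
    by (simp add: AW_ball_def P_p_def space_prob_algebra s\<nu> \<nu>_def)
  moreover have "ext_integral \<nu> (\<lambda>y. ereal (f y)) = W K 0 (\<lambda>_. undefined) (\<lambda>_. undefined)"
    using f_measurable_path[OF dis] path_strategy_value(2)[OF dis order_refl] by (simp add: \<nu>_def W_N)
  ultimately show ?thesis by blast
qed

end

theorem theorem4p3:
  fixes N :: nat and p \<delta> \<epsilon> C :: real
    and \<mu> :: "(nat \<Rightarrow> real) measure" and \<kappa> :: "nat \<Rightarrow> (nat \<Rightarrow> real) \<Rightarrow> real measure"
    and f :: "(nat \<Rightarrow> real) \<Rightarrow> real"
  assumes "1 \<le> p" and "0 < \<delta>"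
    and "\<mu> \<in> P_p p N" and "disintegration N \<mu> \<kappa>"
    and "lower_semicontinuous N f"
    and "0 < \<epsilon>" and "0 < C"
    and "\<forall>x \<in> space (coords {1..N}). f x \<ge> - C * (1 + pnorm p N x powr (p - \<epsilon>))"
  shows "robust_value p N \<mu> f \<delta> = dp_value p N \<kappa> f \<delta> 0 (\<lambda>_. undefined) (\<lambda>_. undefined)"
proof -
  let ?o = "\<lambda>_::nat. undefined :: real"
  have \<mu>: "\<mu> \<in> space (prob_algebra (coords {1..N}))" using assms(3) by (simp add: P_p_def)
  have s: "sets \<mu> = sets (coords {1..N})" and P: "prob_space \<mu>" using \<mu> by (auto simp: space_prob_algebra)
  interpret M: prob_space \<mu> by (rule P)
  have c: "is_cond_law \<mu> (\<lambda>x. restrict x {1..t}) (coords {1..t}) (\<lambda>x. x (Suc t)) borel (\<kappa> t)" if "t < N" for t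
    using assms(4) that by (simp add: disintegration_def)
  have kern: "\<kappa> t \<in> coords {1..t} \<rightarrow>\<^sub>M prob_algebra borel" if "t < N" for t
    by (rule is_cond_lawD(1)[OF c[OF that]])
  obtain C' where C': "0 < C'" "\<And>x. x \<in> space (coords {1..N}) \<Longrightarrow> - C' * (1 + (\<Sum>s=1..N. \<bar>x s\<bar> powr p)) \<le> f x"
    using lower_growth[OF assms(1,5,6,7,8)] by blast
  obtain G dc where G: "coding_family G dc" "gain_dense p G"
    using ex_coding_family[OF assms(1)] by blast
  \<comment> \<open>The tamed kernels take the place of \<kappa> because the locale demands finite
    moments at every past; they still disintegrate \<mu>, as the change concerns a null set
    only.\<close>
  interpret dp_setting p \<delta> C' N "tame p N \<kappa>" f G dc
  proof
    show "tail_moment p N (tame p N \<kappa>) t x < \<infinity>" if "t \<le> N" "x \<in> space (coords {1..t})" for t x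
      using tail_moment_tame[of N \<kappa> t x p] kern that by blast
    show "tame p N \<kappa> t \<in> coords {1..t} \<rightarrow>\<^sub>M prob_algebra borel" if "t < N" for t
      using kern that by (rule measurable_tame)
    show "f \<in> borel_measurable (coords {1..N})"
      by (rule borel_measurable_lower_semicontinuous[OF assms(5)])
    show "ereal (f y) \<le> liminf (\<lambda>n. ereal (f (yn n)))"
      if "y \<in> space (coords {1..N})" "\<And>n. yn n \<in> space (coords {1..N})" "\<And>s. s \<in> {1..N} \<Longrightarrow> (\<lambda>n. yn n s) \<longlonglongrightarrow> y s" for y yn
      using assms(5) that by (rule lower_semicontinuous_liminf)
  qed (use assms(1,2) C' G in auto)
  have dis: "disintegration N \<mu> (tame p N \<kappa>)"
    unfolding disintegration_def
  proof (intro allI impI)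
    fix t assume t: "t < N"
    have tm: "tame p N \<kappa> t \<in> coords {1..t} \<rightarrow>\<^sub>M prob_algebra borel"
      using kern t by (rule measurable_tame)
    show "is_cond_law \<mu> (\<lambda>x. restrict x {1..t}) (coords {1..t}) (\<lambda>x. x (Suc t)) borel (tame p N \<kappa> t)"
    proof (rule is_cond_law_cong_AE[OF P _ _ c[OF t] tm])
      show "(\<lambda>x. restrict x {1..t}) \<in> \<mu> \<rightarrow>\<^sub>M coords {1..t}"
        unfolding measurable_cong_sets[OF s refl] using t by (intro measurable_restrict_coords) auto
      show "(\<lambda>x. x (Suc t)) \<in> borel_measurable \<mu>"
        unfolding measurable_cong_sets[OF s refl] using t by (intro measurable_component_singleton) auto
      show "AE x in \<mu>. \<kappa> t (restrict x {1..t}) = tame p N \<kappa> t (restrict x {1..t})"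
        using AE_tail_moment[OF assms(1,3,4) less_imp_le[OF t]] by eventually_elim (simp add: tame_def)
    qed
  qed
  have o: "?o \<in> space (coords {1..0})" by (simp add: space_PiM)
  \<comment> \<open>At time 0 the past is a constant, so finiteness almost everywhere under a
    probability measure is plain finiteness. It brings the value back from the tamed kernels to
    \<kappa>.\<close>
  have fin: "tail_moment p N \<kappa> 0 ?o < \<infinity>"
  proof -
    have "restrict x {1..0} = ?o" for x :: "nat \<Rightarrow> real" by auto
    then have "AE x in \<mu>. tail_moment p N \<kappa> 0 ?o < \<infinity>"
      using AE_tail_moment[OF assms(1,3,4), of 0] by simp
    then show ?thesis by simp
  qed
  have tame: "V 0 ?o ?o = dp_value p N \<kappa> f \<delta> 0 ?o ?o"
    using kern le0 o fin by (rule dp_value_tame)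
  have "robust_value p N \<mu> f \<delta> = V 0 ?o ?o"
  proof (rule antisym)
    show "robust_value p N \<mu> f \<delta> \<le> V 0 ?o ?o"
      unfolding robust_value_def by (intro SUP_least value_upper_bound[OF \<mu> dis])
    show "V 0 ?o ?o \<le> robust_value p N \<mu> f \<delta>"
      unfolding V_eq_SUP_W[OF le0 o o]
    proof (rule SUP_least)
      fix K
      obtain \<nu> where "\<nu> \<in> AW_ball p N \<delta> \<mu>" "ext_integral \<nu> (\<lambda>y. ereal (f y)) = W K 0 ?o ?o"
        using value_lower_bound[OF \<mu> dis] by blast
      then show "W K 0 ?o ?o \<le> robust_value p N \<mu> f \<delta>"
        unfolding robust_value_def by (metis SUP_upper)
    qed
  qed
  with tame show ?thesis by simp
qed

end
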